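(* Let $K$ be an algebraically closed field of characteristic $p > 2$, let $V$ be a $K$-vector space with $\dim V = n$ for some $n \geq 5$, equipped with a non-degenerate symmetric bilinear form, and let $G = \operatorname{SO}(V)$. Let $u \in G$ be a unipotent element and suppose that the Jordan blocks of $u$ on $V$ have sizes $d_1, \ldots, d_t$ (listed with multiplicity), i.e. $V \downarrow K[u] = V_{d_1} \oplus \cdots \oplus V_{d_t}$, where $t \geq 1$ and $d_r \geq 1$ for all $1 \leq r \leq t$. Set $\alpha = \nu_p(\gcd(d_1, \ldots, d_t))$. Let $u_0$ be the action of $u$ on $S^2(V)$, and let $u_0''$ be the action of $u$ on the irreducible $G$-module $L_G(2\varpi_1)$. Then the Jordan block sizes of $u_0''$ are determined from those of $u_0$ as follows: (i) If $p \nmid n$, then $r_1(u_0'') = r_1(u_0) - 1$ and $r_m(u_0'') = r_m(u_0)$ for all $m \neq 1$. (ii) If $p \mid n$ and $\alpha = 0$, then $r_1(u_0'') = r_1(u_0) - 2$ and $r_m(u_0'') = r_m(u_0)$ for all $m \neq 1$. (iii) If $p \mid n$ and $\alpha > 0$: (a) If $p \mid \frac{n}{p^{\alpha}}$, then $r_{p^{\alpha}}(u_0'') = r_{p^{\alpha}}(u_0) - 2$, $r_{p^{\alpha}-1}(u_0'') = 2$ and $r_m(u_0'') = r_m(u_0)$ for all $m \neq p^{\alpha}, p^{\alpha} - 1$. (b) If $p \nmid \frac{n}{p^{\alpha}}$ and $p^{\alpha} > 2$, then $r_{p^{\alpha}}(u_0'') = r_{p^{\alpha}}(u_0) - 1$,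 $r_{p^{\alpha}-2}(u_0'') = 1$ and $r_m(u_0'') = r_m(u_0)$ for all $m \neq p^{\alpha}, p^{\alpha} - 2$. (c) If $p \nmid \frac{n}{p^{\alpha}}$ and $p^{\alpha} = 2$, then $r_{2}(u_0'') = r_{2}(u_0) - 1$ and $r_m(u_0'') = r_m(u_0)$ for all $m \neq 2$.
   Context: For a unipotent linear map $x$ and an integer $m \geq 1$, $r_m(x)$ denotes the number of Jordan blocks of size $m$ in the Jordan decomposition of $x$; here $m$ ranges over integers $\geq 1$. $\nu_p$ is the $p$-adic valuation on the integers: $\nu_p(a)$ is the largest $k \geq 0$ such that $p^k \mid a$. $K[u]$ is the group algebra of the cyclic $p$-group generated by $u$, and $V_d$ denotes the indecomposable $K[u]$-module of dimension $d$, on which $u$ acts as a single $d \times d$ unipotent Jordan block; $V \downarrow K[u]$ is the restriction of $V$ to $K[u]$. $L_G(\lambda)$ denotes the rational irreducible $G$-module with highest weight $\lambda$ (with respect to a fixed maximal torus and base of simple roots), and $\varpi_i$ is the fundamental dominant weight corresponding to the $i$-th simple root $\alpha_i$ in the standard Bourbaki labeling for type $B$ or $D$ (so $\varpi_1$ is the highest weight of the natural module $V$). *)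

theory Defs
  imports
    "Jordan_Normal_Form.Determinant"
    "Jordan_Normal_Form.Jordan_Normal_Form"
begin

section \<open>Matrices, determinants and Jordan blocks of linear endomorphisms\<close>

definition ordered_basis :: "('k::field \<Rightarrow> 'v::ab_group_add \<Rightarrow> 'v) \<Rightarrow> 'v list \<Rightarrow> bool" where
  "ordered_basis scale bs \<longleftrightarrow>
     distinct bs \<and> \<not> module.dependent scale (set bs) \<and> module.span scale (set bs) = UNIV"

definition finite_dim :: "('k::field \<Rightarrow> 'v::ab_group_add \<Rightarrow> 'v) \<Rightarrow> bool" where
  "finite_dim scale \<longleftrightarrow> vector_space scale \<and> (\<exists>B. finite B \<and> module.span scale B = UNIV)"

text \<open>The matrix of \<open>f\<close> depends on an arbitrarily chosen ordered basis of the
  finite-dimensional space; only similarity invariants of it are used below.\<close>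

definition matrix_of :: "('k::field \<Rightarrow> 'v::ab_group_add \<Rightarrow> 'v) \<Rightarrow> ('v \<Rightarrow> 'v) \<Rightarrow> 'k mat" where
  "matrix_of scale f =
     (let bs = (SOME bs. ordered_basis scale bs); n = length bs
      in mat n n (\<lambda>(i, j). module.representation scale (set bs) (f (bs ! j)) (bs ! i)))"

definition endo_det :: "('k::field \<Rightarrow> 'v::ab_group_add \<Rightarrow> 'v) \<Rightarrow> ('v \<Rightarrow> 'v) \<Rightarrow> 'k" where
  "endo_det scale f = det (matrix_of scale f)"

definition unipotent :: "('v::ab_group_add \<Rightarrow> 'v) \<Rightarrow> bool" where
  "unipotent f \<longleftrightarrow> (\<exists>N. (((\<lambda>v. f v - v) ^^ N) = (\<lambda>v. 0)))"

text \<open>\<open>unipotent_block_sizes scale f ds\<close>: the module of the cyclic group generated by \<open>f\<close> is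
  \<open>V\<^bsub>d\<^sub>1\<^esub> \<oplus> \<dots> \<oplus> V\<^bsub>d\<^sub>t\<^esub>\<close> with \<open>ds = [d\<^sub>1, \<dots>, d\<^sub>t]\<close>,
  where \<open>f\<close> acts on \<open>V\<^bsub>d\<^esub>\<close> as one unipotent Jordan block of size \<open>d\<close>.\<close>

definition unipotent_block_sizes ::
    "('k::field \<Rightarrow> 'v::ab_group_add \<Rightarrow> 'v) \<Rightarrow> ('v \<Rightarrow> 'v) \<Rightarrow> nat list \<Rightarrow> bool" where
  "unipotent_block_sizes scale f ds \<longleftrightarrow> jordan_nf (matrix_of scale f) (map (\<lambda>d. (d, 1)) ds)"

text \<open>The number \<open>r\<^sub>m(f)\<close> of Jordan blocks of size \<open>m\<close> of a unipotent map \<open>f\<close>. The list of block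
  sizes is unique up to order.\<close>

definition num_blocks ::
    "('k::field \<Rightarrow> 'v::ab_group_add \<Rightarrow> 'v) \<Rightarrow> ('v \<Rightarrow> 'v) \<Rightarrow> nat \<Rightarrow> nat" where
  "num_blocks scale f m = count_list (SOME ds. unipotent_block_sizes scale f ds) m"


section \<open>Bilinear forms, the special orthogonal group and the symmetric square\<close>

definition bilinear_map ::
    "('k::field \<Rightarrow> 'v::ab_group_add \<Rightarrow> 'v) \<Rightarrow> ('k \<Rightarrow> 's::ab_group_add \<Rightarrow> 's) \<Rightarrow>
     ('v \<Rightarrow> 'v \<Rightarrow> 's) \<Rightarrow> bool" where
  "bilinear_map scaleV scaleS f \<longleftrightarrow>
     (\<forall>v. Vector_Spaces.linear scaleV scaleS (\<lambda>w. f v w)) \<and>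
     (\<forall>w. Vector_Spaces.linear scaleV scaleS (\<lambda>v. f v w))"

definition symmetric_map :: "('v \<Rightarrow> 'v \<Rightarrow> 's) \<Rightarrow> bool" where
  "symmetric_map f \<longleftrightarrow> (\<forall>v w. f v w = f w v)"

definition nondegenerate :: "('v::zero \<Rightarrow> 'v \<Rightarrow> 'k::zero) \<Rightarrow> bool" where
  "nondegenerate f \<longleftrightarrow> (\<forall>v. (\<forall>w. f v w = 0) \<longrightarrow> v = 0)"

definition SO ::
    "('k::field \<Rightarrow> 'v::ab_group_add \<Rightarrow> 'v) \<Rightarrow> ('v \<Rightarrow> 'v \<Rightarrow> 'k) \<Rightarrow> ('v \<Rightarrow> 'v) set" where
  "SO scaleV \<beta> = {g. Vector_Spaces.linear scaleV scaleV g \<and>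
     (\<forall>v w. \<beta> (g v) (g w) = \<beta> v w) \<and> endo_det scaleV g = 1}"

text \<open>\<open>S\<close> together with the product \<open>\<sigma> v w = v \<cdot> w\<close> is the symmetric square of \<open>V\<close>: symmetric
  bilinear maps on \<open>V\<close> factor uniquely through \<open>\<sigma>\<close>. It suffices to ask this for maps into the
  ground field: it says that the canonical linear map from \<open>S\<^sup>2(V)\<close> to \<open>S\<close> has a
  bijective transpose, hence is itself bijective.\<close>

definition symmetric_square ::
    "('k::field \<Rightarrow> 'v::ab_group_add \<Rightarrow> 'v) \<Rightarrow> ('k \<Rightarrow> 's::ab_group_add \<Rightarrow> 's) \<Rightarrow>
     ('v \<Rightarrow> 'v \<Rightarrow> 's) \<Rightarrow> bool" where
  "symmetric_square scaleV scaleS \<sigma> \<longleftrightarrow>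
     vector_space scaleS \<and> bilinear_map scaleV scaleS \<sigma> \<and> symmetric_map \<sigma> \<and>
     (\<forall>f :: 'v \<Rightarrow> 'v \<Rightarrow> 'k. bilinear_map scaleV (*) f \<and> symmetric_map f \<longrightarrow>
        (\<exists>!\<phi>. Vector_Spaces.linear scaleS (*) \<phi> \<and> (\<forall>v w. \<phi> (\<sigma> v w) = f v w)))"


section \<open>Rational representations\<close>

text \<open>Polynomial functions in the matrix entries. On a closed subgroup of \<open>SL(V)\<close> their
  restrictions are exactly the regular functions, since the determinant is 1 there.\<close>

inductive_set polynomial_functions ::
    "('k::field \<Rightarrow> 'v::ab_group_add \<Rightarrow> 'v) \<Rightarrow> (('v \<Rightarrow> 'v) \<Rightarrow> 'k) set"
  for scaleV :: "'k \<Rightarrow> 'v \<Rightarrow> 'v" where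
  const: "(\<lambda>g. c) \<in> polynomial_functions scaleV"
| coefficient: "Vector_Spaces.linear scaleV (*) \<phi> \<Longrightarrow> (\<lambda>g. \<phi> (g v)) \<in> polynomial_functions scaleV"
| add: "f \<in> polynomial_functions scaleV \<Longrightarrow> h \<in> polynomial_functions scaleV \<Longrightarrow>
    (\<lambda>g. f g + h g) \<in> polynomial_functions scaleV"
| mult: "f \<in> polynomial_functions scaleV \<Longrightarrow> h \<in> polynomial_functions scaleV \<Longrightarrow>
    (\<lambda>g. f g * h g) \<in> polynomial_functions scaleV"

definition rational_representation ::
    "('k::field \<Rightarrow> 'v::ab_group_add \<Rightarrow> 'v) \<Rightarrow> ('v \<Rightarrow> 'v) set \<Rightarrow>
     ('k \<Rightarrow> 'w::ab_group_add \<Rightarrow> 'w) \<Rightarrow> (('v \<Rightarrow> 'v) \<Rightarrow> 'w \<Rightarrow> 'w) \<Rightarrow> bool" where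
  "rational_representation scaleV G scaleW \<rho> \<longleftrightarrow>
     finite_dim scaleW \<and>
     (\<forall>g\<in>G. Vector_Spaces.linear scaleW scaleW (\<rho> g)) \<and>
     \<rho> id = id \<and> (\<forall>g\<in>G. \<forall>h\<in>G. \<rho> (g \<circ> h) = \<rho> g \<circ> \<rho> h) \<and>
     (\<forall>\<psi> w. Vector_Spaces.linear scaleW (*) \<psi> \<longrightarrow>
        (\<exists>f\<in>polynomial_functions scaleV. \<forall>g\<in>G. \<psi> (\<rho> g w) = f g))"

definition irreducible_representation ::
    "('v \<Rightarrow> 'v) set \<Rightarrow> ('k::field \<Rightarrow> 'w::ab_group_add \<Rightarrow> 'w) \<Rightarrow> (('v \<Rightarrow> 'v) \<Rightarrow> 'w \<Rightarrow> 'w) \<Rightarrow> bool" where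
  "irreducible_representation G scaleW \<rho> \<longleftrightarrow>
     (UNIV :: 'w set) \<noteq> {0} \<and>
     (\<forall>U. module.subspace scaleW U \<and> (\<forall>g\<in>G. \<rho> g ` U \<subseteq> U) \<longrightarrow> U = {0} \<or> U = UNIV)"


section \<open>Weights of the special orthogonal group\<close>

text \<open>A basis \<open>e\<^sub>1, \<dots>, e\<^sub>n\<close> of \<open>V\<close> with \<open>\<beta>(e\<^sub>i, e\<^sub>j) = 1\<close> if \<open>i + j = n + 1\<close> and 0 otherwise. The
  elements of \<open>SO(V)\<close> that are diagonal in it form a maximal torus, whose rank is
  \<open>l = n div 2\<close>.\<close>

definition witt_basis ::
    "('k::field \<Rightarrow> 'v::ab_group_add \<Rightarrow> 'v) \<Rightarrow> ('v \<Rightarrow> 'v \<Rightarrow> 'k) \<Rightarrow> nat \<Rightarrow> (nat \<Rightarrow> 'v) \<Rightarrow> bool" where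
  "witt_basis scaleV \<beta> n e \<longleftrightarrow>
     ordered_basis scaleV (map e [1..<Suc n]) \<and>
     (\<forall>i\<in>{1..n}. \<forall>j\<in>{1..n}. \<beta> (e i) (e j) = (if i + j = n + 1 then 1 else 0))"

definition torus ::
    "('k::field \<Rightarrow> 'v::ab_group_add \<Rightarrow> 'v) \<Rightarrow> ('v \<Rightarrow> 'v \<Rightarrow> 'k) \<Rightarrow> nat \<Rightarrow> (nat \<Rightarrow> 'v) \<Rightarrow> ('v \<Rightarrow> 'v) set" where
  "torus scaleV \<beta> n e = {h \<in> SO scaleV \<beta>. \<forall>i\<in>{1..n}. \<exists>c. h (e i) = scaleV c (e i)}"

text \<open>A character \<open>\<epsilon>\<^sub>1\<^bsup>\<mu> 1\<^esup> \<dots> \<epsilon>\<^sub>l\<^bsup>\<mu> l\<^esup>\<close> of the torus is encoded by its exponent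
  vector \<open>\<mu>\<close>, a function vanishing outside \<open>{1..l}\<close>. Addition of weights is pointwise.\<close>

definition torus_coordinate ::
    "('k::field \<Rightarrow> 'v::ab_group_add \<Rightarrow> 'v) \<Rightarrow> (nat \<Rightarrow> 'v) \<Rightarrow> nat \<Rightarrow> ('v \<Rightarrow> 'v) \<Rightarrow> 'k" where
  "torus_coordinate scaleV e i h = (THE c. h (e i) = scaleV c (e i))"

definition weights :: "nat \<Rightarrow> (nat \<Rightarrow> int) set" where
  "weights n = {\<mu>. \<forall>i. i \<notin> {1..n div 2} \<longrightarrow> \<mu> i = 0}"

definition character ::
    "('k::field \<Rightarrow> 'v::ab_group_add \<Rightarrow> 'v) \<Rightarrow> nat \<Rightarrow> (nat \<Rightarrow> 'v) \<Rightarrow> (nat \<Rightarrow> int) \<Rightarrow> ('v \<Rightarrow> 'v) \<Rightarrow> 'k" where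
  "character scaleV n e \<mu> h = (\<Prod>i\<in>{1..n div 2}. torus_coordinate scaleV e i h powi \<mu> i)"

definition weight_space ::
    "('k::field \<Rightarrow> 'v::ab_group_add \<Rightarrow> 'v) \<Rightarrow> ('v \<Rightarrow> 'v \<Rightarrow> 'k) \<Rightarrow> nat \<Rightarrow> (nat \<Rightarrow> 'v) \<Rightarrow>
     ('k \<Rightarrow> 'w::ab_group_add \<Rightarrow> 'w) \<Rightarrow> (('v \<Rightarrow> 'v) \<Rightarrow> 'w \<Rightarrow> 'w) \<Rightarrow> (nat \<Rightarrow> int) \<Rightarrow> 'w set" where
  "weight_space scaleV \<beta> n e scaleW \<rho> \<mu> =
     {w. \<forall>h\<in>torus scaleV \<beta> n e. \<rho> h w = scaleW (character scaleV n e \<mu> h) w}"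

definition eps :: "nat \<Rightarrow> nat \<Rightarrow> int" where
  "eps i = (\<lambda>j. if j = i then 1 else 0)"

text \<open>Bourbaki's simple roots, of type \<open>B\<^sub>l\<close> for \<open>n = 2 l + 1\<close> and of type \<open>D\<^sub>l\<close> for \<open>n = 2 l\<close>.\<close>

definition simple_root :: "nat \<Rightarrow> nat \<Rightarrow> nat \<Rightarrow> int" where
  "simple_root n i =
     (let l = n div 2 in
      if i < l then (\<lambda>j. eps i j - eps (i + 1) j)
      else if odd n then eps l
      else (\<lambda>j. eps (l - 1) j + eps l j))"

definition weight_inner :: "nat \<Rightarrow> (nat \<Rightarrow> int) \<Rightarrow> (nat \<Rightarrow> int) \<Rightarrow> int" where
  "weight_inner n \<kappa> \<mu> = (\<Sum>j\<in>{1..n div 2}. \<kappa> j * \<mu> j)"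

text \<open>\<open>\<varpi>\<^sub>i\<close> is given by \<open>2 (\<varpi>\<^sub>i, \<alpha>\<^sub>j) / (\<alpha>\<^sub>j, \<alpha>\<^sub>j) = \<delta>\<^sub>i\<^sub>j\<close>. Only those \<open>\<varpi>\<^sub>i\<close> that are characters of the
  torus of \<open>SO(V)\<close> itself exist as integer vectors; the spin weights do not.\<close>

definition fundamental_weight :: "nat \<Rightarrow> nat \<Rightarrow> nat \<Rightarrow> int" where
  "fundamental_weight n i = (THE \<kappa>. \<kappa> \<in> weights n \<and>
     (\<forall>j\<in>{1..n div 2}. 2 * weight_inner n \<kappa> (simple_root n j) =
        (if i = j then weight_inner n (simple_root n j) (simple_root n j) else 0)))"

lemma fundamental_weight_1:
  assumes "n \<ge> 5"
  shows "fundamental_weight n 1 = eps 1"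
proof -
  define l where "l = n div 2"
  have l2: "l \<ge> 2" and l3: "even n \<Longrightarrow> l \<ge> 3" using assms by (auto simp: l_def)
  have sum_eps: "(\<Sum>j\<in>{1..l}. f j * eps i j) = f i" if "1 \<le> i" "i \<le> l" for f :: "nat \<Rightarrow> int" and i
    using that by (simp add: eps_def if_distrib cong: if_cong)
  have inner_lt: "weight_inner n f (simple_root n j) = f j - f (j + 1)"
    if "1 \<le> j" "j < l" for f j
    using that sum_eps[of j f] sum_eps[of "j + 1" f]
    by (simp add: weight_inner_def simple_root_def Let_def l_def [symmetric] right_diff_distrib
        sum_subtractf)
  have inner_odd: "weight_inner n f (simple_root n l) = f l" if "odd n" for f
    using that l2 sum_eps[of l f]
    by (simp add: weight_inner_def simple_root_def Let_def l_def [symmetric])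
  have inner_even: "weight_inner n f (simple_root n l) = f (l - 1) + f l" if "even n" for f
    using that l2 sum_eps[of l f] sum_eps[of "l - 1" f]
    by (simp add: weight_inner_def simple_root_def Let_def l_def [symmetric] distrib_left
        sum.distrib)
  let ?P = "\<lambda>f. f \<in> weights n \<and> (\<forall>j\<in>{1..l}. 2 * weight_inner n f (simple_root n j) =
        (if 1 = j then weight_inner n (simple_root n j) (simple_root n j) else 0))"
  have norm1: "weight_inner n (simple_root n 1) (simple_root n 1) = 2"
    using l2 inner_lt[of 1] by (simp add: simple_root_def Let_def l_def [symmetric] eps_def)
  have P1: "?P (eps 1)"
  proof (intro conjI ballI)
    show "eps 1 \<in> weights n" using l2 by (auto simp: weights_def eps_def l_def [symmetric])
    fix j assume j: "j \<in> {1..l}"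
    show "2 * weight_inner n (eps 1) (simple_root n j) =
        (if 1 = j then weight_inner n (simple_root n j) (simple_root n j) else 0)"
    proof (cases "j < l")
      case True
      then show ?thesis using j norm1 inner_lt[of j] by (auto simp: eps_def)
    next
      case False
      then have "j = l" using j by simp
      then show ?thesis using inner_odd inner_even l2 l3
        by (cases "even n") (auto simp: eps_def)
    qed
  qed
  have "f = eps 1" if P: "?P f" for f
  proof -
    have eq: "2 * weight_inner n f (simple_root n j) = (if 1 = j then 2 else 0)"
      if "1 \<le> j" "j \<le> l" for j
      using P that norm1 by auto
    have step: "f j = f (j + 1)" if "2 \<le> j" "j < l" for j
      using eq[of j] inner_lt[of j f] that by simp
    have first: "f 1 = f 2 + 1"
      using eq[of 1] inner_lt[of 1 f] l2 by (simp add: numeral_2_eq_2)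
    have "f l = 0"
    proof (cases "even n")
      case True
      have "f (l - 1) + f l = 0" using eq[of l] inner_even[OF True, of f] l3[OF True] by simp
      moreover have "f (l - 1) = f l" using step[of "l - 1"] l3[OF True] by simp
      ultimately show ?thesis by simp
    next
      case False
      then show ?thesis using eq[of l] inner_odd[of f] l2 by simp
    qed
    have zero: "f j = 0" if "j \<le> l" "2 \<le> j" for j
      using that
    proof (induction rule: inc_induct)
      case base
      then show ?case using \<open>f l = 0\<close> by simp
    next
      case (step m)
      then show ?case using \<open>\<And>j. 2 \<le> j \<Longrightarrow> j < l \<Longrightarrow> f j = f (j + 1)\<close>[of m] by simp
    qed
    show ?thesis
    proof
      fix j
      have out: "f j = 0" if "j \<notin> {1..l}" using P that by (auto simp: weights_def l_def)
      show "f j = eps 1 j"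
        using out zero[of j] zero[of 2] first l2 by (cases "j = 1"; cases "j \<in> {1..l}") (auto simp: eps_def)
    qed
  qed
  then have "(THE f. ?P f) = eps 1" using P1 by (intro the_equality) blast+
  then show ?thesis unfolding fundamental_weight_def l_def by simp
qed

definition weight_le :: "nat \<Rightarrow> (nat \<Rightarrow> int) \<Rightarrow> (nat \<Rightarrow> int) \<Rightarrow> bool" where
  "weight_le n \<mu> \<kappa> \<longleftrightarrow>
     (\<exists>c :: nat \<Rightarrow> nat. \<forall>j. \<kappa> j - \<mu> j = (\<Sum>i\<in>{1..n div 2}. int (c i) * simple_root n i j))"

definition has_highest_weight ::
    "('k::field \<Rightarrow> 'v::ab_group_add \<Rightarrow> 'v) \<Rightarrow> ('v \<Rightarrow> 'v \<Rightarrow> 'k) \<Rightarrow> nat \<Rightarrow> (nat \<Rightarrow> 'v) \<Rightarrow>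
     ('k \<Rightarrow> 'w::ab_group_add \<Rightarrow> 'w) \<Rightarrow> (('v \<Rightarrow> 'v) \<Rightarrow> 'w \<Rightarrow> 'w) \<Rightarrow> (nat \<Rightarrow> int) \<Rightarrow> bool" where
  "has_highest_weight scaleV \<beta> n e scaleW \<rho> \<kappa> \<longleftrightarrow>
     \<kappa> \<in> weights n \<and> weight_space scaleV \<beta> n e scaleW \<rho> \<kappa> \<noteq> {0} \<and>
     (\<forall>\<mu>\<in>weights n. weight_space scaleV \<beta> n e scaleW \<rho> \<mu> \<noteq> {0} \<longrightarrow> weight_le n \<mu> \<kappa>)"

text \<open>\<open>(W, \<rho>)\<close> is the irreducible module \<open>L\<^sub>G(\<kappa>)\<close> for \<open>G = SO(V)\<close>, with respect to the
  maximal torus and base attached to \<open>e\<close>. It is determined by \<open>\<kappa>\<close> up to isomorphism.\<close>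

definition irreducible_highest_weight_module ::
    "('k::field \<Rightarrow> 'v::ab_group_add \<Rightarrow> 'v) \<Rightarrow> ('v \<Rightarrow> 'v \<Rightarrow> 'k) \<Rightarrow> nat \<Rightarrow> (nat \<Rightarrow> 'v) \<Rightarrow>
     ('k \<Rightarrow> 'w::ab_group_add \<Rightarrow> 'w) \<Rightarrow> (('v \<Rightarrow> 'v) \<Rightarrow> 'w \<Rightarrow> 'w) \<Rightarrow> (nat \<Rightarrow> int) \<Rightarrow> bool" where
  "irreducible_highest_weight_module scaleV \<beta> n e scaleW \<rho> \<kappa> \<longleftrightarrow>
     rational_representation scaleV (SO scaleV \<beta>) scaleW \<rho> \<and>
     irreducible_representation (SO scaleV \<beta>) scaleW \<rho> \<and>
     has_highest_weight scaleV \<beta> n e scaleW \<rho> \<kappa>"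

end

theory Submission
  imports Defs
begin

text \<open>Let \<open>\<tau>\<close> be the linear map from the symmetric square \<open>S\<close> of \<open>V\<close> to the field which is induced by
  \<open>\<beta>\<close>, let \<open>Z\<close> be its kernel, and let \<open>\<omega>\<close> be the invariant tensor \<open>\<Sum>\<^sub>i e\<^sub>i e\<^bsub>n+1-i\<^esub>\<close>, for which
  \<open>\<tau> \<omega> = n\<close>. The proof consists of two parts.

  The first part identifies the irreducible module \<open>W\<close> of highest weight \<open>2 \<epsilon>\<^sub>1\<close> with
  \<open>Z / (Z \<inter> K\<omega>)\<close>. Take a highest weight vector \<open>w\<close> and a lowest weight functional \<open>\<xi>\<close> with
  \<open>\<xi> w = 1\<close>. The functions \<open>g \<mapsto> \<xi> (g w)\<close> and \<open>g \<mapsto> (\<beta> (g e\<^sub>1) e\<^sub>n)\<^sup>2\<close> are invariant under two opposite maximal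
  unipotent subgroups, one acting from the left and one from the right, and transform in the same way under the torus, so they agree on the big cell and
  therefore on all of \<open>SO(V)\<close> (\<open>big_cell_density\<close>, \<open>extremal_coefficient\<close>). A vector \<open>y\<close> of the irreducible
  module is determined by the function \<open>h \<mapsto> \<xi> (h y)\<close>. A tensor \<open>s\<close> defines a function as well, by
  \<open>v v' \<mapsto> \<beta> (h v) e\<^sub>n * \<beta> (h v') e\<^sub>n\<close>, and \<open>g w\<close> and \<open>(g e\<^sub>1)\<^sup>2\<close> define the same one. The squares of isotropic vectors span
  \<open>Z\<close> (\<open>form_zero_on_isotropic\<close>), so equality of functions is the graph of an equivariant surjection from \<open>Z\<close>
  to \<open>W\<close>. Its kernel consists of the tensors in \<open>Z\<close> which are orthogonal to the squares of isotropic vectors, that is,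
  of the multiples of \<open>\<omega>\<close> in \<open>Z\<close>.

  The second part is about \<open>X = u - 1\<close> on \<open>S\<close>. The number of Jordan blocks of size \<open>m\<close> is a second
  difference of dimensions of kernels of powers (\<open>num_blocks_kernel_dims\<close>). For the subquotient
  \<open>Z / (Z \<inter> K\<omega>)\<close> these dimensions depend on the dimensions for \<open>S\<close>, on the powers of \<open>X\<close>
  whose image contains \<open>\<omega>\<close>, and on the vanishing of \<open>\<tau>\<close> on the preimages of \<open>K\<omega>\<close> (\<open>dim_balance\<close>). Identify tensors with
  endomorphisms of \<open>V\<close> in such a way that \<open>\<omega>\<close> becomes the identity and \<open>\<tau>\<close> the trace. Let \<open>q = p ^ \<alpha>\<close>. As
  \<open>q\<close> divides all block sizes, \<open>V\<close> is induced from the subgroup generated by \<open>u ^ q\<close>, and the identity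
  is a relative trace: there is an endomorphism \<open>A\<close> with
  \<open>id = \<Sum>\<^bsub>i<q\<^esub> u\<^sup>i A u\<^bsup>-i\<^esup> = X\<^bsup>q-1\<^esup> A\<close> and \<open>tr A = n / q\<close> (\<open>\<omega>_depth\<close>). Consequently \<open>\<omega>\<close> is in the image
  of \<open>X\<^bsup>q-1\<^esup>\<close>, and every invariant tensor is (\<open>kernel_in_image\<close>), so that all blocks on \<open>S\<close> have size at
  least \<open>q\<close>. The restriction of \<open>A\<close> to a block of size \<open>d\<close> with \<open>d / q\<close> prime to \<open>p\<close> is an element of the kernel
  of \<open>X\<^sup>q\<close> with nonzero trace (\<open>block_tensor\<close>). Since images and kernels of powers of \<open>X\<close> are orthogonal
  for the trace form, \<open>\<omega>\<close> is not in the image of \<open>X\<^sup>q\<close>. The cases of the theorem are distinguished by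
  the vanishing of \<open>\<tau> \<omega> = n\<close> and of \<open>tr A = n / q\<close> in the field.\<close>

section \<open>Bases, coordinates and matrices\<close>

lemma ordered_basisD:
  assumes "ordered_basis scale bs"
  shows "distinct bs" "\<not> module.dependent scale (set bs)" "module.span scale (set bs) = UNIV"
  using assms by (auto simp: ordered_basis_def)

definition coord :: "('k::field \<Rightarrow> 'v::ab_group_add \<Rightarrow> 'v) \<Rightarrow> 'v list \<Rightarrow> nat \<Rightarrow> 'v \<Rightarrow> 'k" where
  "coord scale bs i v = module.representation scale (set bs) v (bs ! i)"

context vector_space
begin

lemma sum_list_basis: "distinct bs \<Longrightarrow> (\<Sum>b\<in>set bs. f b) = (\<Sum>i<length bs. f (bs ! i))"
  using sum.reindex_bij_betw[OF bij_betw_nth[OF _ refl refl]] by metis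

lemma coord_expansion:
  assumes "ordered_basis scale bs"
  shows "(\<Sum>i<length bs. coord scale bs i v *s bs ! i) = v"
proof -
  note ob = ordered_basisD[OF assms]
  have "(\<Sum>b\<in>set bs. representation (set bs) v b *s b) = v"
    by (rule sum_representation_eq) (use ob in auto)
  then show ?thesis by (simp add: sum_list_basis[OF ob(1)] coord_def)
qed

lemma coord_eqI:
  assumes "ordered_basis scale bs" and "v = (\<Sum>i<length bs. a i *s bs ! i)" and "i < length bs"
  shows "coord scale bs i v = a i"
proof -
  note ob = ordered_basisD[OF assms(1)]
  have "representation (set bs) v = (\<lambda>b. \<Sum>j<length bs. a j * (if b = bs ! j then 1 else 0))"
    unfolding assms(2)
    by (subst representation_sum)
       (auto simp: ob representation_scale representation_basis intro!: sum.cong)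
  then have "representation (set bs) v (bs ! i)
      = (\<Sum>j<length bs. a j * (if bs ! i = bs ! j then 1 else 0))"
    by simp
  also have "\<dots> = (\<Sum>j<length bs. if j = i then a j else 0)"
    by (rule sum.cong) (use ob(1) assms(3) in \<open>auto simp: nth_eq_iff_index_eq\<close>)
  finally have "representation (set bs) v (bs ! i) = (\<Sum>j<length bs. if j = i then a j else 0)" .
  then show ?thesis using assms(3) by (simp add: coord_def)
qed

lemma linear_coord:
  assumes "ordered_basis scale bs"
  shows "Vector_Spaces.linear scale (*) (\<lambda>v. coord scale bs i v)"
proof -
  note ob = ordered_basisD[OF assms(1)]
  interpret K: vector_space "(*) :: 'a \<Rightarrow> 'a \<Rightarrow> 'a" by unfold_locales (auto simp: algebra_simps)
  interpret vector_space_pair scale "(*)" by unfold_locales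
  show ?thesis
    by (simp add: module_hom_iff_linear[symmetric] module_hom_iff coord_def representation_add
        representation_scale ob module_axioms K.module_axioms)
qed

lemma ordered_basis_finite_dim: "ordered_basis scale bs \<Longrightarrow> finite_dimensional_vector_space scale (set bs)"
  by unfold_locales (auto dest: ordered_basisD)

lemma ordered_basis_length: "ordered_basis scale bs \<Longrightarrow> length bs = dim UNIV"
  using basis_card_eq_dim[of "set bs" UNIV] ordered_basisD[of scale bs] by (metis UNIV_I distinct_card subsetI)

lemma finite_dim_ordered_basis:
  assumes "finite_dim scale"
  shows "\<exists>bs. ordered_basis scale bs"
proof -
  obtain B where "finite B" "span B = UNIV" using assms by (auto simp: finite_dim_def)
  moreover obtain B' where "B' \<subseteq> B" "independent B'" "B \<subseteq> span B'"
    using maximal_independent_subset[of B] by auto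
  ultimately have B': "finite B'" "independent B'" "span B' = UNIV"
    using finite_subset span_mono[of B "span B'"] by (auto simp: span_span)
  obtain bs where "set bs = B'" "distinct bs" using finite_distinct_list[OF B'(1)] by auto
  then have "ordered_basis scale bs" using B' by (simp add: ordered_basis_def)
  then show ?thesis ..
qed

lemma independent_family:
  assumes "\<And>a. (\<Sum>i<length bs. a i *s bs ! i) = 0 \<Longrightarrow> \<forall>i<length bs. a i = 0"
  shows "distinct bs" "independent (set bs)"
proof -
  show d: "distinct bs"
  proof (rule ccontr)
    assume "\<not> distinct bs"
    then obtain i j where ij: "i < length bs" "j < length bs" "i \<noteq> j" "bs ! i = bs ! j"
      by (auto simp: distinct_conv_nth)
    let ?a = "\<lambda>k. if k = i then 1 else if k = j then - 1 else (0::'a)"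
    have "(\<Sum>k<length bs. ?a k *s bs ! k) = (\<Sum>k\<in>{i,j}. ?a k *s bs ! k)"
      by (rule sum.mono_neutral_right) (use ij in auto)
    also have "\<dots> = 0" using ij by simp
    finally have "?a i = 0" using assms[of ?a] ij(1) by blast
    then show False by simp
  qed
  show "independent (set bs)"
    unfolding dependent_finite[OF finite_set] 
  proof clarify
    fix u v assume uv: "v \<in> set bs" "u v \<noteq> 0" "(\<Sum>v\<in>set bs. u v *s v) = 0"
    then have "(\<Sum>i<length bs. u (bs ! i) *s bs ! i) = 0" by (simp add: sum_list_basis[OF d])
    then have "\<forall>i<length bs. u (bs ! i) = 0" using assms[of "\<lambda>i. u (bs ! i)"] by simp
    then show False using uv by (auto simp: in_set_conv_nth)
  qed
qed

lemma ordered_basis_sum_zero: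
  assumes "distinct bs" "independent (set bs)" "(\<Sum>i<length bs. a i *s bs ! i) = 0" "i < length bs"
  shows "a i = 0"
proof -
  define f where "f b = a (THE i. i < length bs \<and> bs ! i = b)" for b
  have f: "f (bs ! i) = a i" if "i < length bs" for i
    unfolding f_def using that assms(1)
    by (intro arg_cong[of _ _ a] the_equality) (auto simp: nth_eq_iff_index_eq)
  have "(\<Sum>b\<in>set bs. f b *s b) = 0"
    using assms(3) f by (simp add: sum_list_basis[OF assms(1)])
  then have "f (bs ! i) = 0"
    using assms(2,4) dependent_finite[OF finite_set] nth_mem by blast
  then show ?thesis using f assms(4) by simp
qed

end

text \<open>For the identity map this is the matrix of a change of basis, so the behaviour under composition
  covers products of endomorphisms and base change at once.\<close>

definition mat_between :: "('k::field \<Rightarrow> 'v::ab_group_add \<Rightarrow> 'v) \<Rightarrow> 'v list \<Rightarrow> 'v list \<Rightarrow> ('v \<Rightarrow> 'v) \<Rightarrow> 'k mat" where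
  "mat_between scale bs cs f =
     mat (length cs) (length bs) (\<lambda>(i, j). coord scale cs i (f (bs ! j)))"

context vector_space
begin

lemma linear_endo_sum:
  assumes "Vector_Spaces.linear scale scale f"
  shows "f (\<Sum>i\<in>I. a i *s b i) = (\<Sum>i\<in>I. a i *s f (b i))"
proof -
  interpret f: Vector_Spaces.linear scale scale f by fact
  show ?thesis by (simp add: f.sum f.scale)
qed

lemma linear_eq_on_basis:
  assumes "ordered_basis scale bs" "Vector_Spaces.linear scale scale2 f" "Vector_Spaces.linear scale scale2 g"
    and "\<And>i. i < length bs \<Longrightarrow> f (bs ! i) = g (bs ! i)"
  shows "f = g"
proof
  fix v
  interpret f: Vector_Spaces.linear scale scale2 f by fact
  interpret g: Vector_Spaces.linear scale scale2 g by fact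
  interpret vector_space_pair scale scale2 by unfold_locales
  have "v \<in> span (set bs)" using ordered_basisD[OF assms(1)] by simp
  then show "f v = g v"
    by (rule linear_eq_on[OF assms(2,3)]) (use assms(4) in \<open>auto simp: in_set_conv_nth\<close>)
qed

lemma mat_between_carrier: "mat_between scale bs cs f \<in> carrier_mat (length cs) (length bs)"
  by (simp add: mat_between_def)

lemma mat_between_apply:
  assumes "ordered_basis scale cs" "j < length bs"
  shows "f (bs ! j) = (\<Sum>i<length cs. mat_between scale bs cs f $$ (i, j) *s cs ! i)"
  using coord_expansion[OF assms(1), of "f (bs ! j)"] assms(2) by (simp add: mat_between_def)

lemma mat_between_eqI:
  assumes "ordered_basis scale cs" "M \<in> carrier_mat (length cs) (length bs)"
    and "\<And>j. j < length bs \<Longrightarrow> f (bs ! j) = (\<Sum>i<length cs. M $$ (i, j) *s cs ! i)"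
  shows "mat_between scale bs cs f = M"
proof (rule eq_matI)
  fix i j assume "i < dim_row M" "j < dim_col M"
  then show "mat_between scale bs cs f $$ (i, j) = M $$ (i, j)"
    using assms(2) coord_eqI[OF assms(1) assms(3)] by (auto simp: mat_between_def)
qed (use assms(2) in \<open>auto simp: mat_between_def\<close>)

lemma mat_between_comp:
  assumes "ordered_basis scale bs" "ordered_basis scale cs" "ordered_basis scale ds"
    and f: "Vector_Spaces.linear scale scale f"
  shows "mat_between scale bs ds (f \<circ> g) = mat_between scale cs ds f * mat_between scale bs cs g"
proof (rule mat_between_eqI)
  let ?F = "mat_between scale cs ds f" and ?G = "mat_between scale bs cs g"
  note c = mat_between_carrier[of cs ds f] mat_between_carrier[of bs cs g]
  show "?F * ?G \<in> carrier_mat (length ds) (length bs)" using c by simp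
  fix j assume j: "j < length bs"
  have "(f \<circ> g) (bs ! j) = (\<Sum>k<length cs. ?G $$ (k, j) *s f (cs ! k))"
    using mat_between_apply[OF assms(2) j, of g] by (simp add: linear_endo_sum[OF f])
  also have "\<dots> = (\<Sum>k<length cs. \<Sum>i<length ds. (?F $$ (i, k) * ?G $$ (k, j)) *s ds ! i)"
    by (rule sum.cong)
      (simp_all add: mat_between_apply[OF assms(3), of _ cs f] scale_sum_right mult.commute)
  also have "\<dots> = (\<Sum>i<length ds. (\<Sum>k<length cs. ?F $$ (i, k) * ?G $$ (k, j)) *s ds ! i)"
    by (subst sum.swap) (simp add: scale_sum_left)
  also have "\<dots> = (\<Sum>i<length ds. (?F * ?G) $$ (i, j) *s ds ! i)"
    using c j by (auto intro!: sum.cong simp: scalar_prod_def atLeast0LessThan)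
  finally show "(f \<circ> g) (bs ! j) = (\<Sum>i<length ds. (?F * ?G) $$ (i, j) *s ds ! i)" .
qed (use assms in auto)

lemma mat_between_id:
  assumes "ordered_basis scale bs"
  shows "mat_between scale bs bs id = 1\<^sub>m (length bs)"
  by (rule mat_between_eqI[OF assms])
     (auto simp: if_distrib[of "\<lambda>x. scale x _"] if_distrib[of "\<lambda>x. x *s _"] cong: if_cong)

lemma linear_id': "Vector_Spaces.linear scale scale id"
  using linear_id by (simp add: id_def)

lemma mat_between_similar:
  assumes "ordered_basis scale bs" "ordered_basis scale cs" "Vector_Spaces.linear scale scale f"
  shows "similar_mat_wit (mat_between scale bs bs f) (mat_between scale cs cs f)
           (mat_between scale cs bs id) (mat_between scale bs cs id)"
proof -
  have l: "length cs = length bs" using assms(1,2) by (simp add: ordered_basis_length)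
  have "mat_between scale cs bs id * mat_between scale cs cs f * mat_between scale bs cs id
      = mat_between scale bs bs (id \<circ> f \<circ> id)"
    using assms by (simp add: mat_between_comp[of cs cs bs id f] linear_id'
        mat_between_comp[of bs cs bs f id] flip: mat_between_comp)
  then show ?thesis
    using assms l mat_between_comp[OF assms(1,2,1) linear_id', of id]
      mat_between_comp[OF assms(2,1,2) linear_id', of id]
    by (auto simp: similar_mat_wit_def Let_def mat_between_carrier mat_between_id
        carrier_matD[OF mat_between_carrier])
qed

lemma matrix_of_eq_mat_between:
  assumes "ordered_basis scale cs"
  obtains bs where "ordered_basis scale bs" "\<And>f. matrix_of scale f = mat_between scale bs bs f"
proof -
  let ?bs = "SOME bs. ordered_basis scale bs"
  have "ordered_basis scale ?bs" using assms by (rule someI)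
  moreover have "matrix_of scale f = mat_between scale ?bs ?bs f" for f
    by (simp add: matrix_of_def mat_between_def Let_def coord_def)
  ultimately show ?thesis using that by blast
qed

lemma matrix_of_similar:
  assumes "ordered_basis scale cs" "Vector_Spaces.linear scale scale f"
  shows "similar_mat (matrix_of scale f) (mat_between scale cs cs f)"
  using matrix_of_eq_mat_between[OF assms(1)] mat_between_similar[OF _ assms]
  unfolding similar_mat_def by metis

lemma endo_det_basis:
  assumes "ordered_basis scale cs" "Vector_Spaces.linear scale scale f"
  shows "endo_det scale f = det (mat_between scale cs cs f)"
  unfolding endo_det_def by (rule det_similar[OF matrix_of_similar[OF assms]])

lemma endo_det_comp:
  assumes "ordered_basis scale cs" "Vector_Spaces.linear scale scale f" "Vector_Spaces.linear scale scale g"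
  shows "endo_det scale (f \<circ> g) = endo_det scale f * endo_det scale g"
proof -
  have "Vector_Spaces.linear scale scale (f \<circ> g)" using Vector_Spaces.linear_compose[OF assms(3,2)] .
  then show ?thesis
    using endo_det_basis[OF assms(1)] assms mat_between_comp[OF assms(1,1,1,2), of g]
      det_mult[OF mat_between_carrier mat_between_carrier] by metis
qed

lemma endo_det_id: "ordered_basis scale cs \<Longrightarrow> endo_det scale id = 1"
  using endo_det_basis[OF _ linear_id'] by (simp add: mat_between_id)

end

section \<open>Jordan chains\<close>

lemma sum_lessThan_add:
  fixes g :: "nat \<Rightarrow> 'a::comm_monoid_add"
  shows "(\<Sum>i<d + n. g i) = (\<Sum>i<d. g i) + (\<Sum>i<n. g (d + i))"
  by (induction n) (simp_all add: add.assoc)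

definition jordan_chain :: "('v::ab_group_add \<Rightarrow> 'v) \<Rightarrow> 'v list \<Rightarrow> bool" where
  "jordan_chain f xs \<longleftrightarrow> (\<forall>j<length xs. f (xs ! j) - xs ! j = (if j = 0 then 0 else xs ! (j - 1)))"

definition jordan_basis :: "('k::field \<Rightarrow> 'v::ab_group_add \<Rightarrow> 'v) \<Rightarrow> ('v \<Rightarrow> 'v) \<Rightarrow> 'v list list \<Rightarrow> bool" where
  "jordan_basis scale f css \<longleftrightarrow>
     ordered_basis scale (concat css) \<and> [] \<notin> set css \<and> (\<forall>xs\<in>set css. jordan_chain f xs)"

context vector_space
begin

text \<open>A spanning list whose length is the dimension is repetition-free and independent by counting.\<close>

lemma spanning_list_ordered_basis:
  assumes "ordered_basis scale bs" "length cs = length bs" "set bs \<subseteq> span (set cs)"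
  shows "ordered_basis scale cs"
proof -
  interpret finite_dimensional_vector_space scale "set bs"
    using assms(1) by (rule ordered_basis_finite_dim)
  note ob = ordered_basisD[OF assms(1)]
  have sp: "span (set cs) = UNIV"
    using assms(3) ob(3) span_minimal[of "set bs" "span (set cs)"] by auto
  have "dim UNIV \<le> card (set cs)"
    using dim_le_card[of UNIV "set cs"] sp by simp
  then have "card (set cs) = length cs" "card (set cs) = dim UNIV"
    using card_length[of cs] assms(2) ordered_basis_length[OF assms(1)] by auto
  then show ?thesis
    using sp card_distinct card_le_dim_spanning[of "set cs" UNIV] by (auto simp: ordered_basis_def)
qed

text \<open>Stated for columns, the equivalence serves both to read off chains from a Jordan form and to obtain a
  Jordan form from chains. The induction splits off the first block.\<close>

lemma jordan_matrix_columns: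
  defines "J \<equiv> \<lambda>css::'b list list. jordan_matrix (map (\<lambda>xs. (length xs, 1 :: 'a)) css)"
  shows "(\<forall>j<length (concat css). f (concat css ! j) = (\<Sum>i<length (concat css). J css $$ (i, j) *s concat css ! i))
     \<longleftrightarrow> (\<forall>xs\<in>set css. jordan_chain f xs)"
proof (induction css)
  case Nil
  then show ?case by simp
next
  case (Cons xs css)
  let ?d = "length xs" and ?n = "length (concat css)"
  have dim: "dim_row (J css) = ?n" "dim_col (J css) = ?n"
    by (simp_all add: J_def length_concat o_def)
  have "J (xs # css) = (let B = jordan_block ?d 1; C = J css in
      four_block_mat B (0\<^sub>m (dim_row B) (dim_col C)) (0\<^sub>m (dim_row C) (dim_col B)) C)"
    by (simp add: J_def jordan_matrix_def)
  then have J: "J (xs # css) = four_block_mat (jordan_block ?d 1) (0\<^sub>m ?d ?n) (0\<^sub>m ?n ?d) (J css)"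
    by (simp add: Let_def dim)
  have block: "(\<Sum>i<?d. jordan_block ?d (1::'a) $$ (i, j) *s xs ! i) = xs ! j + (if j = 0 then 0 else xs ! (j - 1))"
    if "j < ?d" for j
  proof -
    have "(\<Sum>i<?d. jordan_block ?d (1::'a) $$ (i, j) *s xs ! i)
        = (\<Sum>i<?d. (if i = j then xs ! i else 0) + (if Suc i = j then xs ! i else 0))"
      by (rule sum.cong) (use that in auto)
    also have "(\<Sum>i<?d. if Suc i = j then xs ! i else 0) = (if j = 0 then 0 else xs ! (j - 1))"
    proof (cases j)
      case (Suc k)
      then have "(\<Sum>i<?d. if Suc i = j then xs ! i else 0) = (\<Sum>i<?d. if i = k then xs ! i else 0)"
        by (intro sum.cong) auto
      then show ?thesis using that Suc by simp
    qed simp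
    ultimately show ?thesis using that by (simp add: sum.distrib)
  qed
  let ?col = "\<lambda>j. (\<Sum>i<?d + ?n. J (xs # css) $$ (i, j) *s concat (xs # css) ! i)"
  have c1: "?col j = xs ! j + (if j = 0 then 0 else xs ! (j - 1))" if "j < ?d" for j
    unfolding sum_lessThan_add using that block[OF that]
    by (simp add: J dim nth_append)
  have c2: "?col (?d + j) = (\<Sum>i<?n. J css $$ (i, j) *s concat css ! i)" if "j < ?n" for j
    unfolding sum_lessThan_add using that by (simp add: J dim nth_append)
  have "(\<forall>j<?d + ?n. f (concat (xs # css) ! j) = ?col j) \<longleftrightarrow>
      (\<forall>j<?d. f (xs ! j) = ?col j) \<and> (\<forall>j<?n. f (concat css ! j) = ?col (?d + j))"
    (is "?L \<longleftrightarrow> ?R")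
  proof
    assume L: ?L
    have "f (xs ! j) = ?col j" if "j < ?d" for j using spec[OF L, of j] that by (simp add: nth_append)
    moreover have "f (concat css ! j) = ?col (?d + j)" if "j < ?n" for j
      using spec[OF L, of "?d + j"] that by (simp add: nth_append)
    ultimately show ?R by blast
  next
    assume R: ?R
    show ?L
    proof (intro allI impI)
      fix j assume j: "j < ?d + ?n"
      show "f (concat (xs # css) ! j) = ?col j"
      proof (cases "j < ?d")
        case True then show ?thesis using R by (simp add: nth_append)
      next
        case False
        then obtain k where "j = ?d + k" using le_Suc_ex by (meson not_less)
        then show ?thesis using R j by (simp add: nth_append)
      qed
    qed
  qed
  also have "(\<forall>j<?d. f (xs ! j) = ?col j) \<longleftrightarrow> jordan_chain f xs"
    unfolding jordan_chain_def using c1 by (auto simp: algebra_simps)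
  also have "(\<forall>j<?n. f (concat css ! j) = ?col (?d + j)) \<longleftrightarrow> (\<forall>xs\<in>set css. jordan_chain f xs)"
    using c2 Cons.IH by auto
  finally show ?case by simp
qed

lemma split_by_lengths: "sum_list ds = length cs \<Longrightarrow> \<exists>css. concat css = cs \<and> map length css = ds"
proof (induction ds arbitrary: cs)
  case (Cons d ds)
  have len: "sum_list ds = length (drop d cs)" using Cons.prems by simp
  obtain css where "concat css = drop d cs" "map length css = ds"
    using Cons.IH[OF len] by blast
  then have "concat (take d cs # css) = cs \<and> map length (take d cs # css) = d # ds"
    using Cons.prems by simp
  then show ?case by (rule exI)
qed simp

text \<open>A similarity between the matrix of \<open>f\<close> and a Jordan matrix is a base change to a basis consisting of
  Jordan chains. This removes the chosen basis and all matrices from the arguments below.\<close>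

lemma block_sizes_iff_jordan_basis:
  assumes bs: "ordered_basis scale bs0" and f: "Vector_Spaces.linear scale scale f"
  shows "unipotent_block_sizes scale f ds \<longleftrightarrow> (\<exists>css. jordan_basis scale f css \<and> map length css = ds)"
proof
  obtain bs where bs: "ordered_basis scale bs" and M: "matrix_of scale f = mat_between scale bs bs f"
    using matrix_of_eq_mat_between[OF bs] by metis
  let ?n = "length bs" and ?M = "mat_between scale bs bs f"
  assume "unipotent_block_sizes scale f ds"
  then have nz: "0 \<notin> set ds" and sim: "similar_mat ?M (jordan_matrix (map (\<lambda>d. (d, 1)) ds))"
    by (auto simp: unipotent_block_sizes_def jordan_nf_def M image_image)
  let ?J = "jordan_matrix (map (\<lambda>d. (d, 1::'a)) ds)"
  obtain P Q where PQ: "similar_mat_wit ?M ?J P Q" using sim by (auto simp: similar_mat_def)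
  have Mc: "?M \<in> carrier_mat ?n ?n" by (rule mat_between_carrier)
  note W = similar_mat_witD2[OF Mc PQ]
  define cs where "cs = map (\<lambda>k. \<Sum>i<?n. P $$ (i, k) *s bs ! i) [0..<?n]"
  have lcs: "length cs = ?n" by (simp add: cs_def)
  have cs: "cs ! k = (\<Sum>i<?n. P $$ (i, k) *s bs ! i)" if "k < ?n" for k
    using that by (simp add: cs_def)
  have comb: "(\<Sum>k<?n. A $$ (k, l) *s cs ! k) = (\<Sum>i<?n. (P * A) $$ (i, l) *s bs ! i)"
    if "A \<in> carrier_mat ?n ?n" "l < ?n" for A l
  proof -
    have "(\<Sum>k<?n. A $$ (k, l) *s cs ! k) = (\<Sum>k<?n. \<Sum>i<?n. (P $$ (i, k) * A $$ (k, l)) *s bs ! i)"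
      by (rule sum.cong) (simp_all add: cs scale_sum_right mult.commute)
    also have "\<dots> = (\<Sum>i<?n. (\<Sum>k<?n. P $$ (i, k) * A $$ (k, l)) *s bs ! i)"
      by (subst sum.swap) (simp add: scale_sum_left)
    also have "\<dots> = (\<Sum>i<?n. (P * A) $$ (i, l) *s bs ! i)"
      using that W(6) by (auto intro!: sum.cong simp: scalar_prod_def atLeast0LessThan)
    finally show ?thesis .
  qed
  have bs_cs: "bs ! l = (\<Sum>k<?n. Q $$ (k, l) *s cs ! k)" if "l < ?n" for l
    using comb[OF W(7) that] that W(1) 
    by (simp add: if_distrib[of "\<lambda>x. scale x _"] cong: if_cong)
  have "set bs \<subseteq> span (set cs)"
  proof
    fix b assume "b \<in> set bs"
    then obtain l where "l < ?n" "b = bs ! l" by (auto simp: in_set_conv_nth)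
    then show "b \<in> span (set cs)"
      unfolding bs_cs[OF \<open>l < ?n\<close>] \<open>b = bs ! l\<close> using lcs
      by (intro span_sum span_scale span_base) simp
  qed
  then have ob: "ordered_basis scale cs"
    using spanning_list_ordered_basis[OF bs lcs] by blast
  have PJ: "?M * P = P * ?J"
  proof -
    have "?M * P = P * ?J * (Q * P)"
      unfolding W(3) using W(5,6,7) by (simp add: assoc_mult_mat[of _ ?n ?n _ ?n _ ?n])
    then show ?thesis using W(2) right_mult_one_mat[OF mult_carrier_mat[OF W(6,5)]] by simp
  qed
  have fcs: "f (cs ! k) = (\<Sum>j<?n. ?J $$ (j, k) *s cs ! j)" if k: "k < ?n" for k
  proof -
    have "f (cs ! k) = (\<Sum>i<?n. P $$ (i, k) *s f (bs ! i))"
      by (simp add: cs k linear_endo_sum[OF f])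
    also have "\<dots> = (\<Sum>i<?n. \<Sum>l<?n. (?M $$ (l, i) * P $$ (i, k)) *s bs ! l)"
      by (rule sum.cong) (simp_all add: mat_between_apply[OF bs, of _ bs f] scale_sum_right mult.commute)
    also have "\<dots> = (\<Sum>l<?n. (\<Sum>i<?n. ?M $$ (l, i) * P $$ (i, k)) *s bs ! l)"
      by (subst sum.swap) (simp add: scale_sum_left)
    also have "\<dots> = (\<Sum>l<?n. (?M * P) $$ (l, k) *s bs ! l)"
      using k W(6) Mc by (auto intro!: sum.cong simp: scalar_prod_def atLeast0LessThan)
    also have "\<dots> = (\<Sum>j<?n. ?J $$ (j, k) *s cs ! j)"
      unfolding PJ using comb[OF W(5) k] by simp
    finally show ?thesis .
  qed
  have "sum_list ds = length cs"
    using W(5) lcs by (auto simp: o_def)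
  then obtain css where css: "concat css = cs" "map length css = ds"
    using split_by_lengths by blast
  have "map (\<lambda>d. (d, 1::'a)) ds = map (\<lambda>xs. (length xs, 1)) css"
    by (simp flip: css(2))
  then have "\<forall>xs\<in>set css. jordan_chain f xs"
    using fcs jordan_matrix_columns[of css f] css(1) lcs by simp
  moreover have "[] \<notin> set css" using nz css(2) by force
  ultimately show "\<exists>css. jordan_basis scale f css \<and> map length css = ds"
    using ob css by (auto simp: jordan_basis_def)
next
  assume "\<exists>css. jordan_basis scale f css \<and> map length css = ds"
  then obtain css where css: "ordered_basis scale (concat css)" "[] \<notin> set css"
      "\<forall>xs\<in>set css. jordan_chain f xs" "map length css = ds"
    by (auto simp: jordan_basis_def)
  let ?J = "jordan_matrix (map (\<lambda>xs. (length xs, 1::'a)) css)"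
  have "mat_between scale (concat css) (concat css) f = ?J"
  proof (rule mat_between_eqI[OF css(1)])
    show "?J \<in> carrier_mat (length (concat css)) (length (concat css))"
      by (auto simp: length_concat o_def)
  qed (use jordan_matrix_columns[of css f] css(3) in blast)
  moreover have "map (\<lambda>xs. (length xs, 1::'a)) css = map (\<lambda>d. (d, 1)) ds"
    by (simp flip: css(4))
  moreover have "0 \<notin> set ds" using css(2) by (auto simp flip: css(4))
  ultimately show "unipotent_block_sizes scale f ds"
    using matrix_of_similar[OF css(1) f] by (simp add: unipotent_block_sizes_def jordan_nf_def image_image)
qed


text \<open>The coordinates with respect to \<open>B\<close> of such a vector are supported both on \<open>C\<close> and on \<open>D\<close>.\<close>

lemma span_Int_of_independent:
  assumes "independent B" "C \<subseteq> B" "D \<subseteq> B" "C \<inter> D = {}" "x \<in> span C" "x \<in> span D"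
  shows "x = 0"
proof -
  have eq: "representation B x = representation C x" "representation B x = representation D x"
    using assms by (auto intro!: representation_extend)
  then have "representation B x b = 0" for b
    using representation_ne_zero[of C x b] representation_ne_zero[of D x b] assms(4) by auto
  moreover have "x \<in> span B" using assms(2,5) span_mono by blast
  ultimately show ?thesis using sum_nonzero_representation_eq[OF assms(1), of x] by simp
qed

end

text \<open>The map is injective on the span of a complement of a basis of its kernel.\<close>

lemma rank_nullity:
  assumes V: "finite_dimensional_vector_space s1 B1" and W: "vector_space s2"
    and f: "Vector_Spaces.linear s1 s2 f" and U: "module.subspace s1 U"
  shows "vector_space.dim s1 U = vector_space.dim s2 (f ` U) + vector_space.dim s1 {u \<in> U. f u = 0}"
proof -
  interpret V: finite_dimensional_vector_space s1 B1 by fact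
  interpret W: vector_space s2 by fact
  interpret finite_dimensional_vector_space_pair_1 s1 B1 s2 by unfold_locales
  interpret f: Vector_Spaces.linear s1 s2 f by fact
  let ?K = "{u \<in> U. f u = 0}"
  have subK: "V.subspace ?K"
    using U by (auto simp: V.subspace_def f.add f.scale f.zero)
  obtain B0 where B0: "B0 \<subseteq> ?K" "V.independent B0" "?K \<subseteq> V.span B0" "card B0 = V.dim ?K"
    using V.basis_exists by blast
  obtain B where B: "B0 \<subseteq> B" "B \<subseteq> U" "V.independent B" "U \<subseteq> V.span B"
    using V.maximal_independent_subset_extend[of B0 U] B0 by blast
  have fin: "finite B" "finite B0" using B B0(1) V.finiteI_independent finite_subset by blast+
  have UB: "U = V.span B" using B U V.span_minimal by blast
  have inj: "inj_on f (V.span (B - B0))"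
  proof (subst f.inj_on_iff_eq_0)
    show "V.subspace (V.span (B - B0))" by simp
    show "\<forall>x\<in>V.span (B - B0). f x = 0 \<longrightarrow> x = 0"
    proof (intro ballI impI)
      fix x assume x: "x \<in> V.span (B - B0)" "f x = 0"
      then have "x \<in> U" using V.span_mono[of "B - B0" B] UB by blast
      then have "x \<in> V.span B0" using x(2) B0(3) by blast
      then show "x = 0"
        using V.span_Int_of_independent[OF B(3), of "B - B0" B0 x] x B(1) by auto
    qed
  qed
  have "f ` U = f ` V.span (B - B0)"
  proof
    show "f ` U \<subseteq> f ` V.span (B - B0)"
    proof
      fix y assume "y \<in> f ` U"
      then obtain u where u: "u \<in> V.span ((B - B0) \<union> B0)" "y = f u"
        using UB B(1) by (metis Diff_partition Un_commute image_iff)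
      then obtain a b where ab: "u = a + b" "a \<in> V.span (B - B0)" "b \<in> V.span B0"
        unfolding V.span_Un by blast
      have "V.span B0 \<subseteq> ?K" using B0(1) subK by (rule V.span_minimal)
      then have "f b = 0" using ab by blast
      then show "y \<in> f ` V.span (B - B0)" using ab u by (auto simp: f.add)
    qed
    show "f ` V.span (B - B0) \<subseteq> f ` U" using UB V.span_mono[of "B - B0" B] by blast
  qed
  then have "W.dim (f ` U) = V.dim (V.span (B - B0))"
    using dim_image_eq[OF f, of "V.span (B - B0)"] inj by (simp only: V.span_span)
  also have "\<dots> = card (B - B0)"
    using V.dim_span_eq_card_independent[OF V.independent_mono[OF B(3) Diff_subset]] .
  also have "\<dots> = card B - card B0" using fin B(1) by (simp add: card_Diff_subset)
  moreover have "V.dim U = card B" using UB V.dim_span_eq_card_independent[OF B(3)] by simp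
  moreover have "card B0 \<le> card B" using fin B(1) by (simp add: card_mono)
  ultimately show ?thesis using B0(4) by simp
qed

context vector_space
begin

text \<open>Applying \<open>X\<close> to a linear relation kills the first list and leaves a relation between the images of the
  second one.\<close>

lemma independent_append_of_image:
  assumes f: "Vector_Spaces.linear scale scale X"
    and ker: "\<forall>a\<in>set as. X a = 0"
    and a: "distinct as" "independent (set as)"
    and b: "distinct (map X bs)" "independent (X ` set bs)"
  shows "distinct (as @ bs)" "independent (set (as @ bs))"
proof -
  interpret X: Vector_Spaces.linear scale scale X by fact
  have *: "\<forall>i<length (as @ bs). c i = 0" if c: "(\<Sum>i<length (as @ bs). c i *s (as @ bs) ! i) = 0" for c
  proof -
    let ?m = "length as" and ?n = "length bs"
    have split: "(\<Sum>i<?m. c i *s as ! i) + (\<Sum>i<?n. c (?m + i) *s bs ! i) = 0"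
      using c by (simp add: sum_lessThan_add nth_append)
    have "X (\<Sum>i<?m. c i *s as ! i) = 0"
      using ker by (simp add: X.sum X.scale)
    then have "X (\<Sum>i<?n. c (?m + i) *s bs ! i) = 0"
      using arg_cong[OF split, of X] by (simp add: X.add X.zero)
    then have "(\<Sum>i<length (map X bs). c (?m + i) *s map X bs ! i) = 0"
      by (simp add: X.sum X.scale)
    then have cb: "c (?m + i) = 0" if "i < ?n" for i
      using ordered_basis_sum_zero[of "map X bs" "\<lambda>i. c (?m + i)" i] b that by simp
    then have "(\<Sum>i<?m. c i *s as ! i) = 0" using split by simp
    then have ca: "c i = 0" if "i < ?m" for i
      using ordered_basis_sum_zero[of as c i] a that by simp
    show ?thesis
    proof (intro allI impI)
      fix i assume "i < length (as @ bs)"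
      then show "c i = 0" using ca[of i] cb[of "i - ?m"] by (cases "i < ?m") auto
    qed
  qed
  show "distinct (as @ bs)" "independent (set (as @ bs))"
    using independent_family[of "as @ bs", OF *] by blast+
qed

end

text \<open>For the nilpotent part \<open>f - 1\<close> of a unipotent map \<open>f\<close>, these are the Jordan chains of \<open>f\<close>.\<close>

definition nil_chain :: "('v::ab_group_add \<Rightarrow> 'v) \<Rightarrow> 'v list \<Rightarrow> bool" where
  "nil_chain X xs \<longleftrightarrow> (\<forall>j<length xs. X (xs ! j) = (if j = 0 then 0 else xs ! (j - 1)))"

lemma jordan_chain_iff_nil_chain: "jordan_chain f xs \<longleftrightarrow> nil_chain (\<lambda>v. f v - v) xs"
  by (simp add: jordan_chain_def nil_chain_def)

lemma nil_chain_append: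
  assumes "nil_chain X xs" "xs \<noteq> []" "X y = last xs"
  shows "nil_chain X (xs @ [y])"
  using assms by (auto simp: nil_chain_def nth_append last_conv_nth less_Suc_eq)

lemma nil_chain_map_tl:
  assumes "nil_chain X (xs @ [y])" 
  shows "map X (tl (xs @ [y])) = xs"
proof (rule nth_equalityI)
  fix i assume "i < length (map X (tl (xs @ [y])))"
  then have i: "i < length xs" by simp
  then have "tl (xs @ [y]) ! i = (xs @ [y]) ! Suc i" by (metis length_append_singleton less_Suc_eq_le nth_tl length_tl diff_Suc_1 Suc_leI le_imp_less_Suc lessI less_le_trans)
  then have "X (tl (xs @ [y]) ! i) = (xs @ [y]) ! i"
    using assms i by (auto simp: nil_chain_def)
  then show "map X (tl (xs @ [y])) ! i = xs ! i" using i by (simp add: nth_append)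
qed simp

lemma mset_concat_hd_tl:
  "[] \<notin> set css \<Longrightarrow> mset (concat css) = mset (map hd css @ concat (map tl css))"
proof (induction css)
  case (Cons xs css)
  then have "mset xs = add_mset (hd xs) (mset (tl xs))" by (cases xs) auto
  with Cons show ?case by simp
qed simp

lemma distinct_map_hd: "distinct (concat css) \<Longrightarrow> [] \<notin> set css \<Longrightarrow> distinct (map hd css)"
proof (induction css)
  case (Cons xs css)
  then have "hd xs \<in> set xs" by auto
  moreover have "hd ` set css \<subseteq> set (concat css)" using Cons.prems(2) by (auto intro!: bexI hd_in_set)
  ultimately show ?case using Cons by auto
qed simp

text \<open>A nilpotent endomorphism has a basis of chains: lift the chains of the image by one step and
  complete the vectors at their bottoms to a basis of the kernel.\<close>

lemma (in vector_space) nilpotent_chain_basis: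
  assumes X: "Vector_Spaces.linear scale scale X"
    and U: "subspace U" "X ` U \<subseteq> U" "\<And>v. v \<in> U \<Longrightarrow> (X ^^ N) v = 0"
    and fin: "finite B" "span B = UNIV"
  shows "\<exists>css. [] \<notin> set css \<and> (\<forall>xs\<in>set css. nil_chain X xs) \<and> distinct (concat css) \<and>
           independent (set (concat css)) \<and> span (set (concat css)) = U"
  using U
proof (induction N arbitrary: U)
  case 0
  then have "U = {0}" using subspace_0 by auto
  then show ?case by (intro exI[of _ "[]"]) (simp add: independent_empty)
next
  case (Suc N)
  interpret X: Vector_Spaces.linear scale scale X by fact
  have sub': "subspace (X ` U)" using Suc.prems(1) by (rule X.subspace_image)
  have "\<exists>css. [] \<notin> set css \<and> (\<forall>xs\<in>set css. nil_chain X xs) \<and> distinct (concat css) \<and>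
           independent (set (concat css)) \<and> span (set (concat css)) = X ` U"
  proof (rule Suc.IH[OF sub'])
    show "X ` X ` U \<subseteq> X ` U" using Suc.prems(2) by blast
    show "(X ^^ N) v = 0" if "v \<in> X ` U" for v
      using that Suc.prems(3) by (auto simp: funpow_swap1)
  qed
  then obtain css' where css': "[] \<notin> set css'" "\<forall>xs\<in>set css'. nil_chain X xs"
      "distinct (concat css')" "independent (set (concat css'))" "span (set (concat css')) = X ` U"
    by blast
  have inXU: "x \<in> X ` U" if "xs \<in> set css'" "x \<in> set xs" for x xs
    using that span_superset[of "set (concat css')"] css'(5) by auto
  define top where "top xs = (SOME y. y \<in> U \<and> X y = last xs)" for xs
  have top: "top xs \<in> U \<and> X (top xs) = last xs" if "xs \<in> set css'" for xs
  proof -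
    have "last xs \<in> X ` U" using that css'(1) by (intro inXU[OF that]) (metis last_in_set)
    then have "\<exists>y. y \<in> U \<and> X y = last xs" by auto
    then show ?thesis unfolding top_def by (rule someI_ex)
  qed
  define ups where "ups = map (\<lambda>xs. xs @ [top xs]) css'"
  let ?K = "{v \<in> U. X v = 0}"
  let ?H = "set (map hd css')"
  have hd_in: "hd xs \<in> set (concat css') \<and> hd xs \<in> ?K" if "xs \<in> set css'" for xs
  proof -
    have ne: "xs \<noteq> []" using that css'(1) by auto
    then have "X (hd xs) = 0" using css'(2) that by (auto simp: nil_chain_def hd_conv_nth)
    moreover have "hd xs \<in> U" using inXU[OF that hd_in_set[OF ne]] Suc.prems(2) by blast
    ultimately show ?thesis using that hd_in_set[OF ne] by auto
  qed
  have H: "?H \<subseteq> ?K" "independent ?H"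
    using hd_in independent_mono[OF css'(4), of ?H] by auto
  obtain Z where Z: "?H \<subseteq> Z" "Z \<subseteq> ?K" "independent Z" "?K \<subseteq> span Z"
    using maximal_independent_subset_extend[OF H] by blast
  have "finite Z"
    using independent_span_bound[OF fin(1) Z(3)] fin(2) by simp
  then obtain zs where zs: "set zs = Z - ?H" "distinct zs"
    using finite_distinct_list[of "Z - ?H"] by auto
  define css where "css = ups @ map (\<lambda>z. [z]) zs"
  have "hd (xs @ [y]) = hd xs" if "xs \<in> set css'" for xs y
    using that css'(1) by (metis hd_append2)
  then have hds: "map hd css = map hd css' @ zs"
    by (simp add: css_def ups_def o_def)
  have chains_up: "nil_chain X (xs @ [top xs])" if "xs \<in> set css'" for xs
    using that css'(1,2) top by (intro nil_chain_append) auto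
  have "map X (concat (map tl css)) = concat (map (\<lambda>xs. map X (tl (xs @ [top xs]))) css')"
    by (simp add: css_def ups_def map_concat o_def)
  also have "\<dots> = concat css'"
    using chains_up nil_chain_map_tl by (intro arg_cong[of _ _ concat] map_idI) blast
  finally have tls: "map X (concat (map tl css)) = concat css'" .
  have ne: "[] \<notin> set css" by (auto simp: css_def ups_def)
  let ?as = "map hd css' @ zs" and ?bs = "concat (map tl css)"
  have setas: "set ?as = Z" using zs Z(1) by auto
  have indep: "distinct (?as @ ?bs)" "independent (set (?as @ ?bs))"
  proof -
    note * = independent_append_of_image[OF X, of ?as ?bs]
    have 1: "\<forall>a\<in>set ?as. X a = 0" using setas Z(2) by auto
    have 2: "distinct ?as" using distinct_map_hd[OF css'(3,1)] zs by auto
    have 3: "independent (set ?as)" using setas Z(3) by simp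
    have 4: "distinct (map X ?bs)" using tls css'(3) by simp
    have 5: "independent (X ` set ?bs)" using arg_cong[OF tls, of set] css'(4) by simp
    show "distinct (?as @ ?bs)" "independent (set (?as @ ?bs))"
      using *[OF 1 2 3 4 5] by blast+
  qed
  have ms: "mset (concat css) = mset (?as @ ?bs)"
    using mset_concat_hd_tl[OF ne] hds by simp
  have seteq: "set (concat css) = set (?as @ ?bs)" using ms by (metis set_mset_mset)
  have inU: "set (concat css) \<subseteq> U"
  proof -
    have "set xs \<subseteq> U" if "xs \<in> set css'" for xs
      using inXU[OF that] Suc.prems(2) by blast
    moreover have "set zs \<subseteq> U" using zs Z(2) by blast
    ultimately show ?thesis using top by (auto simp: css_def ups_def)
  qed
  have "U \<subseteq> span (set (concat css))"
  proof
    fix v assume v: "v \<in> U"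
    then have "X v \<in> span (set (concat css'))" using css'(5) by blast
    also have "set (concat css') = X ` set ?bs" using arg_cong[OF tls, of set] by simp
    finally obtain w where w: "w \<in> span (set ?bs)" "X v = X w" by (auto simp: X.span_image)
    have wU: "w \<in> U"
      using w(1) inU seteq span_minimal[OF _ Suc.prems(1), of "set ?bs"] by auto
    then have "v - w \<in> ?K" using v w Suc.prems(1) by (auto simp: X.diff intro: subspace_diff)
    then have "v - w \<in> span (set ?as)" using Z(4) setas by auto
    then have "(v - w) + w \<in> span (set ?as \<union> set ?bs)" using w(1) unfolding span_Un by blast
    then show "v \<in> span (set (concat css))" unfolding seteq set_append by simp
  qed
  then have "span (set (concat css)) = U"
    using inU span_minimal[OF inU Suc.prems(1)] by blast
  moreover have "\<forall>xs\<in>set css. nil_chain X xs"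
    using chains_up zs Z(2) by (auto simp: css_def ups_def nil_chain_def)
  moreover have "distinct (concat css)" using indep(1) mset_eq_imp_distinct_iff[OF ms] by simp
  ultimately show ?case using ne indep(2) seteq by (intro exI[of _ css]) simp
qed

context vector_space
begin

lemma linear_unipotent_part: "Vector_Spaces.linear scale scale f \<Longrightarrow> Vector_Spaces.linear scale scale (\<lambda>v. f v - v)"
proof -
  interpret vector_space_pair scale scale by unfold_locales
  show "Vector_Spaces.linear scale scale f \<Longrightarrow> Vector_Spaces.linear scale scale (\<lambda>v. f v - v)"
    using linear_compose_sub[of f "\<lambda>v. v"] linear_ident by blast
qed

lemma linear_funpow: "Vector_Spaces.linear scale scale f \<Longrightarrow> Vector_Spaces.linear scale scale (f ^^ k)"
  by (induction k) (auto intro: Vector_Spaces.linear_compose linear_id')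

lemma unipotent_jordan_basis:
  assumes "ordered_basis scale bs" "Vector_Spaces.linear scale scale f" "unipotent f"
  shows "\<exists>css. jordan_basis scale f css"
proof -
  obtain N where N: "(\<lambda>v. f v - v) ^^ N = (\<lambda>v. 0)" using assms(3) by (auto simp: unipotent_def)
  have "\<exists>css. [] \<notin> set css \<and> (\<forall>xs\<in>set css. nil_chain (\<lambda>v. f v - v) xs) \<and> distinct (concat css) \<and>
           independent (set (concat css)) \<and> span (set (concat css)) = UNIV"
    by (rule nilpotent_chain_basis[OF linear_unipotent_part[OF assms(2)], of UNIV N "set bs"])
       (use N ordered_basisD[OF assms(1)] in auto)
  then show ?thesis by (auto simp: jordan_basis_def ordered_basis_def jordan_chain_iff_nil_chain)
qed

lemma nil_chain_funpow:
  assumes "Vector_Spaces.linear scale scale X" "nil_chain X xs" "j < length xs"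
  shows "(X ^^ m) (xs ! j) = (if m \<le> j then xs ! (j - m) else 0)"
proof (induction m)
  case (Suc m)
  interpret X: Vector_Spaces.linear scale scale X by fact
  have "(X ^^ Suc m) (xs ! j) = X (if m \<le> j then xs ! (j - m) else 0)" using Suc by simp
  also have "\<dots> = (if Suc m \<le> j then xs ! (j - Suc m) else 0)"
    using assms(2)[unfolded nil_chain_def, rule_format, of "j - m"] assms(3) by (cases xs) (auto simp: X.zero)
  finally show ?case .
qed simp

lemma distinct_concat_map:
  assumes "distinct (concat css)" "\<And>xs. set (g xs) \<subseteq> set xs" "\<And>xs. distinct xs \<Longrightarrow> distinct (g xs)"
  shows "distinct (concat (map g css))"
  using assms(1)
proof (induction css)
  case (Cons xs css)
  moreover have "set (concat (map g css)) \<subseteq> set (concat css)" using assms(2) by auto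
  moreover have "set xs \<inter> set (concat css) = {}" using Cons.prems by simp
  ultimately have "set (g xs) \<inter> set (concat (map g css)) = {}" using assms(2)[of xs] by blast
  then show ?case using Cons assms(3) by simp
qed simp

text \<open>The power shifts each chain downwards by \<open>m\<close>: it kills the first \<open>m\<close> vectors and maps the others
  injectively to basis vectors.\<close>

lemma dim_kernel_chains:
  assumes "jordan_basis scale f css" and f: "Vector_Spaces.linear scale scale f"
  defines "X \<equiv> \<lambda>v. f v - v"
  shows "dim {v. (X ^^ m) v = 0} = (\<Sum>xs\<leftarrow>css. min m (length xs))"
proof -
  have lX: "Vector_Spaces.linear scale scale X" unfolding X_def by (rule linear_unipotent_part[OF f])
  interpret vector_space_pair scale scale by unfold_locales
  interpret Xm: Vector_Spaces.linear scale scale "X ^^ m" by (rule linear_funpow[OF lX])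
  note ob = ordered_basisD[of scale "concat css"]
  have bas: "distinct (concat css)" "independent (set (concat css))" "span (set (concat css)) = UNIV"
    and ch: "\<And>xs. xs \<in> set css \<Longrightarrow> nil_chain X xs"
    using assms(1) ob by (auto simp: jordan_basis_def jordan_chain_iff_nil_chain X_def)
  let ?A = "concat (map (take m) css)" and ?B = "concat (map (drop m) css)"
  let ?C = "concat (map (\<lambda>xs. take (length xs - m) xs) css)"
  have dA: "distinct ?A" and dC: "distinct ?C"
    by (rule distinct_concat_map[OF bas(1)]; auto dest: in_set_takeD)+
  have sub: "set ?A \<subseteq> set (concat css)" "set ?C \<subseteq> set (concat css)"
    by (auto dest: in_set_takeD)
  have seteq: "set (concat css) = set ?A \<union> set ?B"
  proof -
    have "set xs = set (take m xs) \<union> set (drop m xs)" for xs :: "'b list"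
      by (metis append_take_drop_id set_append)
    then have "(\<Union>xs\<in>set css. set xs) = (\<Union>xs\<in>set css. set (take m xs) \<union> set (drop m xs))"
      by (rule SUP_cong[OF refl])
    then show ?thesis by (simp only: set_concat set_map image_image UN_Un_distrib)
  qed
  have mapB: "map (X ^^ m) ?B = ?C"
  proof -
    have "map (X ^^ m) (drop m xs) = take (length xs - m) xs" if "xs \<in> set css" for xs
      by (rule nth_equalityI) (use nil_chain_funpow[OF lX ch[OF that]] in auto)
    then have "map (map (X ^^ m) \<circ> drop m) css = map (\<lambda>xs. take (length xs - m) xs) css" by simp
    then show ?thesis by (simp only: map_concat map_map)
  qed
  have kerA: "(X ^^ m) v = 0" if "v \<in> span (set ?A)" for v
  proof (rule Xm.eq_0_on_span[OF _ that])
    fix v assume "v \<in> set ?A"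
    then obtain xs j where "xs \<in> set css" "j < length xs" "j < m" "v = xs ! j"
      by (auto simp: in_set_conv_nth)
    then show "(X ^^ m) v = 0" using nil_chain_funpow[OF lX ch] by simp
  qed
  have "{v. (X ^^ m) v = 0} = span (set ?A)"
  proof (intro subset_antisym subsetI)
    fix v assume v: "v \<in> {v. (X ^^ m) v = 0}"
    have "v \<in> span (set ?A \<union> set ?B)" using bas(3) seteq by simp
    then obtain a b where ab: "v = a + b" "a \<in> span (set ?A)" "b \<in> span (set ?B)"
      by (auto simp: span_Un)
    have "(X ^^ m) b = 0" using v kerA[OF ab(2)] ab(1) by (simp add: Xm.add)
    moreover have "independent ((X ^^ m) ` set ?B)"
      using independent_mono[OF bas(2) sub(2)] arg_cong[OF mapB, of set] by simp
    moreover have "inj_on (X ^^ m) (set ?B)"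
      using dC mapB by (metis distinct_map)
    ultimately have "b = 0"
      using linear_indep_image_lemma[OF Xm.linear_axioms, of "set ?B" b] ab(3) by blast
    then show "v \<in> span (set ?A)" using ab by simp
  qed (use kerA in auto)
  then have "dim {v. (X ^^ m) v = 0} = card (set ?A)"
    using dim_span_eq_card_independent[OF independent_mono[OF bas(2) sub(1)]] by simp
  also have "\<dots> = (\<Sum>xs\<leftarrow>css. min m (length xs))"
    using distinct_card[OF dA] by (simp add: length_concat o_def min.commute)
  finally show ?thesis .
qed

end

lemma count_list_via_min:
  assumes "m \<ge> 1"
  shows "int (count_list ds m) = 2 * int (\<Sum>d\<leftarrow>ds. min m d) - int (\<Sum>d\<leftarrow>ds. min (m - 1) d) - int (\<Sum>d\<leftarrow>ds. min (m + 1) d)"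
  using assms by (induction ds) (auto simp: min_def)

text \<open>A block of size \<open>d\<close> contributes \<open>min m d\<close> to the kernel of the power with exponent \<open>m\<close>, and the second difference
  of \<open>m \<mapsto> min m d\<close> is concentrated at \<open>m = d\<close>.\<close>

lemma num_blocks_kernel_dims:
  assumes "vector_space scale" "finite_dim scale" and f: "Vector_Spaces.linear scale scale f" "unipotent f" and m: "m \<ge> 1"
  defines "\<kappa> \<equiv> \<lambda>m. vector_space.dim scale {v. ((\<lambda>v. f v - v) ^^ m) v = 0}"
  shows "int (num_blocks scale f m) = 2 * int (\<kappa> m) - int (\<kappa> (m - 1)) - int (\<kappa> (m + 1))"
proof -
  interpret vector_space scale by fact
  obtain bs where bs: "ordered_basis scale bs" using finite_dim_ordered_basis[OF assms(2)] by blast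
  define ds where "ds = (SOME ds. unipotent_block_sizes scale f ds)"
  have "\<exists>ds. unipotent_block_sizes scale f ds"
    using unipotent_jordan_basis[OF bs f] block_sizes_iff_jordan_basis[OF bs f(1)] by blast
  then have "unipotent_block_sizes scale f ds" unfolding ds_def by (rule someI_ex)
  then obtain css where css: "jordan_basis scale f css" "map length css = ds"
    using block_sizes_iff_jordan_basis[OF bs f(1)] by blast
  have "\<kappa> m = (\<Sum>d\<leftarrow>ds. min m d)" for m
    unfolding \<kappa>_def dim_kernel_chains[OF css(1) f(1)] by (simp add: o_def flip: css(2))
  then show ?thesis using count_list_via_min[OF m, of ds] by (simp add: num_blocks_def ds_def)
qed

section \<open>Polynomial functions of one variable\<close>

definition polyfun :: "('k::comm_ring_1 \<Rightarrow> 'k) \<Rightarrow> bool" where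
  "polyfun f \<longleftrightarrow> (\<exists>P. \<forall>t. f t = poly P t)"

named_theorems polyfun_intros

lemma polyfun_const [polyfun_intros]: "polyfun (\<lambda>t. c)"
  unfolding polyfun_def by (rule exI[of _ "[:c:]"]) simp

lemma polyfun_id [polyfun_intros]: "polyfun (\<lambda>t. t)"
  unfolding polyfun_def by (rule exI[of _ "[:0, 1:]"]) simp

lemma polyfun_add [polyfun_intros]: "polyfun f \<Longrightarrow> polyfun g \<Longrightarrow> polyfun (\<lambda>t. f t + g t)"
  unfolding polyfun_def by (metis poly_add)

lemma polyfun_diff [polyfun_intros]: "polyfun f \<Longrightarrow> polyfun g \<Longrightarrow> polyfun (\<lambda>t. f t - g t)"
  unfolding polyfun_def by (metis poly_diff)

lemma polyfun_mult [polyfun_intros]: "polyfun f \<Longrightarrow> polyfun g \<Longrightarrow> polyfun (\<lambda>t. f t * g t)"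
  unfolding polyfun_def by (metis poly_mult)

lemma polyfun_power [polyfun_intros]: "polyfun f \<Longrightarrow> polyfun (\<lambda>t. f t ^ m)"
  unfolding polyfun_def by (metis poly_power)

lemma polyfun_sum [polyfun_intros]: "(\<And>i. i \<in> I \<Longrightarrow> polyfun (f i)) \<Longrightarrow> polyfun (\<lambda>t. \<Sum>i\<in>I. f i t)"
  by (induction I rule: infinite_finite_induct) (auto intro: polyfun_intros)

text \<open>Otherwise the product of all \<open>x - a\<close> plus 1 would be a polynomial without roots.\<close>

lemma infinite_alg_closed: "infinite (UNIV :: 'k::alg_closed_field set)"
proof
  assume fin: "finite (UNIV :: 'k set)"
  define P where "P = (\<Prod>a\<in>UNIV. [:- a, 1 :: 'k:]) + 1"
  have "degree (\<Prod>a\<in>(UNIV :: 'k set). [:- a, 1:]) = card (UNIV :: 'k set)"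
    by (subst degree_prod_eq_sum_degree) auto
  moreover have "card (UNIV :: 'k set) > 0" using fin by (simp add: card_gt_0_iff)
  ultimately have "degree P > 0"
    unfolding P_def by (metis add.commute degree_add_eq_right degree_1)
  then obtain x where "poly P x = 0" using alg_closed_imp_poly_has_root by blast
  moreover have "poly P x = 1"
    using fin by (simp add: P_def poly_prod prod_zero_iff)
  ultimately show False by simp
qed

lemma poly_eq_0_cofinite:
  fixes P :: "'k::alg_closed_field poly"
  assumes "finite A" "\<And>t. t \<notin> A \<Longrightarrow> poly P t = 0"
  shows "P = 0"
proof (rule ccontr)
  assume "P \<noteq> 0"
  then have "finite {t. poly P t = 0}" by (rule poly_roots_finite)
  then have "finite (A \<union> {t. poly P t = 0})" using assms(1) by blast
  moreover have "A \<union> {t. poly P t = 0} = UNIV" using assms(2) by auto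
  ultimately show False using infinite_alg_closed[where 'k = 'k] by simp
qed

section \<open>Orthogonal geometry in a Witt basis\<close>

locale witt_space = vector_space scaleV
  for scaleV :: "'k::alg_closed_field \<Rightarrow> 'v::ab_group_add \<Rightarrow> 'v" (infixr \<open>*s\<close> 75) +
  fixes \<beta> :: "'v \<Rightarrow> 'v \<Rightarrow> 'k" and n :: nat and e :: "nat \<Rightarrow> 'v"
  assumes two: "(2::'k) \<noteq> 0" and n5: "n \<ge> 5"
    and bilinear: "bilinear_map scaleV (*) \<beta>" and symmetric: "symmetric_map \<beta>"
    and witt: "witt_basis scaleV \<beta> n e"
begin

lemma sym: "\<beta> x y = \<beta> y x" using symmetric by (simp add: symmetric_map_def)

lemma linear_right: "Vector_Spaces.linear scaleV (*) (\<beta> x)"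
  and linear_left: "Vector_Spaces.linear scaleV (*) (\<lambda>x. \<beta> x y)"
  using bilinear by (auto simp: bilinear_map_def)

lemma bil_right: "\<beta> x (y + z) = \<beta> x y + \<beta> x z" "\<beta> x (y - z) = \<beta> x y - \<beta> x z" "\<beta> x (- y) = - \<beta> x y"
  "\<beta> x (c *s y) = c * \<beta> x y" "\<beta> x 0 = 0" "\<beta> x (sum f A) = (\<Sum>a\<in>A. \<beta> x (f a))"
proof -
  interpret R: Vector_Spaces.linear scaleV "(*)" "\<beta> x" by (rule linear_right)
  show "\<beta> x (y + z) = \<beta> x y + \<beta> x z" "\<beta> x (y - z) = \<beta> x y - \<beta> x z" "\<beta> x (- y) = - \<beta> x y"
    "\<beta> x (c *s y) = c * \<beta> x y" "\<beta> x 0 = 0" "\<beta> x (sum f A) = (\<Sum>a\<in>A. \<beta> x (f a))"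
    by (rule R.add R.diff R.neg R.scale R.zero R.sum)+
qed

lemma bil_left: "\<beta> (y + z) x = \<beta> y x + \<beta> z x" "\<beta> (y - z) x = \<beta> y x - \<beta> z x" "\<beta> (- y) x = - \<beta> y x"
  "\<beta> (c *s y) x = c * \<beta> y x" "\<beta> 0 x = 0" "\<beta> (sum f A) x = (\<Sum>a\<in>A. \<beta> (f a) x)"
  using bil_right[of x] by (simp_all add: sym[of _ x])

lemmas bil = bil_right bil_left

lemma bil_double_sum:
  "\<beta> (\<Sum>i\<in>A. a i *s x i) (\<Sum>j\<in>B. b j *s y j) = (\<Sum>j\<in>B. \<Sum>i\<in>A. a i * \<beta> (x i) (y j) * b j)"
  unfolding bil_right unfolding bil_left sum_distrib_left
  by (rule sum.cong[OF refl], rule sum.cong[OF refl]) (rule mult.commute)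

definition bs where "bs = map e [1..<Suc n]"

definition I where "I = {1..n}"

text \<open>The basis dual to \<open>e\<close> is \<open>i \<mapsto> e (d i)\<close>.\<close>

definition d :: "nat \<Rightarrow> nat" where "d i = n + 1 - i"

lemma d_in: "i \<in> I \<Longrightarrow> d i \<in> I" by (auto simp: I_def d_def)
lemma d_d: "i \<in> I \<Longrightarrow> d (d i) = i" by (auto simp: I_def d_def)
lemma d_eq: "i \<in> I \<Longrightarrow> j \<in> I \<Longrightarrow> d i = j \<longleftrightarrow> i = d j" by (auto simp: I_def d_def)
lemma d_inj: "i \<in> I \<Longrightarrow> j \<in> I \<Longrightarrow> d i = d j \<longleftrightarrow> i = j" by (auto simp: I_def d_def)
lemma finite_I [simp]: "finite I" by (simp add: I_def)

lemma length_bs [simp]: "length bs = n" by (simp add: bs_def)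
lemma nth_bs: "i < n \<Longrightarrow> bs ! i = e (Suc i)" by (simp add: bs_def del: upt_Suc)

lemma Suc_in_I: "i < n \<Longrightarrow> Suc i \<in> I" by (simp add: I_def)

lemma ob: "ordered_basis scaleV bs" using witt by (simp add: witt_basis_def bs_def)

lemma gram: "i \<in> I \<Longrightarrow> j \<in> I \<Longrightarrow> \<beta> (e i) (e j) = (if j = d i then 1 else 0)"
  using witt by (auto simp: witt_basis_def I_def d_def)

lemma set_bs: "set bs = e ` I"
  by (simp add: bs_def I_def atLeastLessThanSuc_atLeastAtMost del: upt_Suc)

lemma inj_e: "inj_on e I"
  using ordered_basisD(1)[OF ob]
  by (simp add: bs_def distinct_map I_def atLeastLessThanSuc_atLeastAtMost del: upt_Suc)

sublocale finite_dimensional_vector_space scaleV "e ` I"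
  using ordered_basis_finite_dim[OF ob] unfolding set_bs .

lemma sum_gram:
  assumes "i \<in> I"
  shows "(\<Sum>j\<in>I. c j * \<beta> (e j) (e i)) = c (d i)"
proof -
  have "(\<Sum>j\<in>I. c j * \<beta> (e j) (e i)) = (\<Sum>j\<in>I. if j = d i then c j else 0)"
    by (rule sum.cong) (use assms d_eq in \<open>auto simp: gram\<close>)
  then show ?thesis using d_in[OF assms] by simp
qed

lemma expansion: "v = (\<Sum>i\<in>I. \<beta> v (e (d i)) *s e i)"
proof -
  have "v \<in> span (e ` I)" using span_Basis by blast
  then obtain c where c: "v = (\<Sum>b\<in>e ` I. c b *s b)"
    by (auto simp: span_finite)
  then have v: "v = (\<Sum>j\<in>I. c (e j) *s e j)" by (simp only: sum.reindex[OF inj_e] o_def)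
  have "\<beta> v (e (d i)) = c (e i)" if "i \<in> I" for i
    using sum_gram[of "d i" "\<lambda>j. c (e j)"] that d_in[OF that] by (subst v) (simp add: bil d_d)
  then show ?thesis by (subst v) simp
qed

lemma eq_by_products: "(\<And>i. i \<in> I \<Longrightarrow> \<beta> v (e i) = \<beta> w (e i)) \<Longrightarrow> v = w"
  by (subst expansion[of v], subst expansion[of w]) (intro sum.cong refl, use d_in in auto)

lemma linear_eq_on_e:
  assumes "Vector_Spaces.linear scaleV s2 f" "Vector_Spaces.linear scaleV s2 g" "\<And>i. i \<in> I \<Longrightarrow> f (e i) = g (e i)"
  shows "f = g"
  by (rule linear_eq_on_basis[OF ob assms(1,2)]) (use assms(3) in \<open>auto simp: nth_bs Suc_in_I\<close>)

lemma linear_endoI: "(\<And>x y. f (x + y) = f x + f y) \<Longrightarrow> (\<And>c x. f (c *s x) = c *s f x) \<Longrightarrow> Vector_Spaces.linear scaleV scaleV f"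
  by (simp add: module_hom_iff_linear[symmetric] module_hom_iff module_axioms)

definition isometry :: "('v \<Rightarrow> 'v) \<Rightarrow> bool" where
  "isometry g \<longleftrightarrow> Vector_Spaces.linear scaleV scaleV g \<and> (\<forall>v w. \<beta> (g v) (g w) = \<beta> v w)"

lemma isometry_linear: "isometry g \<Longrightarrow> Vector_Spaces.linear scaleV scaleV g"
  and isometry_products: "isometry g \<Longrightarrow> \<beta> (g v) (g w) = \<beta> v w"
  by (auto simp: isometry_def)

lemma isometry_comp: "isometry g \<Longrightarrow> isometry h \<Longrightarrow> isometry (g \<circ> h)"
  by (auto simp: isometry_def intro: Vector_Spaces.linear_compose)

lemma isometryI:
  assumes lin: "Vector_Spaces.linear scaleV scaleV g"
    and "\<And>i j. i \<in> I \<Longrightarrow> j \<in> I \<Longrightarrow> \<beta> (g (e i)) (g (e j)) = \<beta> (e i) (e j)"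
  shows "isometry g"
proof -
  interpret g: Vector_Spaces.linear scaleV scaleV g by fact
  have 1: "\<beta> (g (e i)) (g w) = \<beta> (e i) w" if "i \<in> I" for i w
    by (subst (1 2) expansion[of w]) (simp add: g.sum g.scale bil assms(2) that cong: sum.cong)
  have "\<beta> (g v) (g w) = \<beta> v w" for v w
    by (subst (1 2) expansion[of v]) (simp add: g.sum g.scale bil 1)
  then show ?thesis using lin by (simp add: isometry_def)
qed

lemma isometry_inj: "isometry g \<Longrightarrow> inj g"
proof (rule injI)
  fix x y assume g: "isometry g" and xy: "g x = g y"
  show "x = y"
    by (rule eq_by_products) (use isometry_products[OF g] xy in metis)
qed

lemma isometry_surj: "isometry g \<Longrightarrow> surj g"
  using linear_inj_imp_surj[OF isometry_linear isometry_inj] by blast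

text \<open>Compare the determinants in \<open>J = M\<^sup>T J M\<close>, where the Gram matrix \<open>J\<close> is an involution.\<close>

lemma det_isometry:
  assumes "isometry g"
  shows "endo_det scaleV g ^ 2 = 1"
proof -
  let ?M = "mat_between scaleV bs bs g"
  define J where "J = mat n n (\<lambda>(i, j). \<beta> (e (Suc i)) (e (Suc j)))"
  have M: "?M \<in> carrier_mat n n" and J: "J \<in> carrier_mat n n"
    using mat_between_carrier[of bs bs g] by (auto simp: J_def)
  have ge: "g (e (Suc j)) = (\<Sum>i<n. ?M $$ (i, j) *s e (Suc i))" if "j < n" for j
    using mat_between_apply[OF ob, of j bs g] that by (simp add: nth_bs)
  have "J = transpose_mat ?M * J * ?M"
  proof (rule eq_matI)
    fix i j assume "i < dim_row (transpose_mat ?M * J * ?M)" "j < dim_col (transpose_mat ?M * J * ?M)"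
    then have ij: "i < n" "j < n" using M by auto
    have "J $$ (i, j) = \<beta> (g (e (Suc i))) (g (e (Suc j)))"
      using ij isometry_products[OF assms] by (simp add: J_def)
    also have "\<dots> = (\<Sum>b<n. \<Sum>a<n. ?M $$ (a, i) * J $$ (a, b) * ?M $$ (b, j))"
      using bil_double_sum[of "\<lambda>a. ?M $$ (a, i)" "\<lambda>a. e (Suc a)" "{..<n}" "\<lambda>b. ?M $$ (b, j)" "\<lambda>b. e (Suc b)" "{..<n}"]
      unfolding ge[OF ij(1), symmetric] ge[OF ij(2), symmetric] by (simp add: J_def)
    also have "\<dots> = (\<Sum>b<n. (\<Sum>a<n. ?M $$ (a, i) * J $$ (a, b)) * ?M $$ (b, j))"
      by (simp add: sum_distrib_right)
    also have "\<dots> = (\<Sum>b<n. (transpose_mat ?M * J) $$ (i, b) * ?M $$ (b, j))"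
      using ij M J by (intro sum.cong refl) (simp add: scalar_prod_def atLeast0LessThan)
    also have "\<dots> = (transpose_mat ?M * J * ?M) $$ (i, j)"
      using ij M J by (simp add: times_mat_def[of "transpose_mat ?M * J"] scalar_prod_def atLeast0LessThan)
    finally show "J $$ (i, j) = (transpose_mat ?M * J * ?M) $$ (i, j)" .
  qed (use M J in auto)
  then have "det J = det (transpose_mat ?M * J * ?M)" by simp
  also have "\<dots> = det J * det ?M ^ 2"
    using M J by (simp add: det_mult[of _ n] det_transpose power2_eq_square)
  finally have "det J = det J * det ?M ^ 2" .
  moreover have "det J \<noteq> 0"
  proof -
    have "J * J = 1\<^sub>m n"
    proof (rule eq_matI)
      fix i j assume "i < dim_row (1\<^sub>m n :: 'k mat)" "j < dim_col (1\<^sub>m n :: 'k mat)"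
      then have ij: "i < n" "j < n" by auto
      have "(J * J) $$ (i, j) = (\<Sum>k<n. J $$ (i, k) * J $$ (k, j))"
        using ij J by (auto intro!: sum.cong simp: scalar_prod_def atLeast0LessThan)
      also have "\<dots> = (\<Sum>k<n. if k = n - 1 - i then J $$ (k, j) else 0)"
        by (rule sum.cong) (use ij in \<open>auto simp: J_def gram Suc_in_I d_def\<close>)
      also have "\<dots> = 1\<^sub>m n $$ (i, j)"
        using ij by (auto simp: J_def gram Suc_in_I d_def)
      finally show "(J * J) $$ (i, j) = 1\<^sub>m n $$ (i, j)" .
    qed (use J in auto)
    then show ?thesis using det_mult[OF J J] by auto
  qed
  ultimately show ?thesis using endo_det_basis[OF ob isometry_linear[OF assms]] by simp
qed

abbreviation G where "G \<equiv> SO scaleV \<beta>"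

lemma G_isometry: "g \<in> G \<Longrightarrow> isometry g" by (simp add: SO_def isometry_def)
lemma G_iff: "g \<in> G \<longleftrightarrow> isometry g \<and> endo_det scaleV g = 1" by (auto simp: SO_def isometry_def)

lemma G_comp: "g \<in> G \<Longrightarrow> h \<in> G \<Longrightarrow> g \<circ> h \<in> G"
  by (simp add: G_iff isometry_comp endo_det_comp[OF ob] isometry_linear)

lemma G_id: "id \<in> G"
  using linear_id' by (simp add: G_iff isometry_def endo_det_id[OF ob])

text \<open>The determinant of an isometry is \<open>\<plusminus>1\<close>, which makes its square special orthogonal.\<close>

lemma square_in_G: "isometry g \<Longrightarrow> g \<circ> g \<in> G"
  using det_isometry by (simp add: G_iff isometry_comp endo_det_comp[OF ob] isometry_linear power2_eq_square)

subsection \<open>Diagonal maps\<close>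

definition tor :: "(nat \<Rightarrow> 'k) \<Rightarrow> 'v \<Rightarrow> 'v" where
  "tor c v = (\<Sum>i\<in>I. (c i * \<beta> v (e (d i))) *s e i)"

lemma linear_tor: "Vector_Spaces.linear scaleV scaleV (tor c)"
proof (rule linear_endoI)
  show "tor c (x + y) = tor c x + tor c y" for x y
    by (simp add: tor_def bil scale_left_distrib sum.distrib distrib_left)
  show "tor c (k *s x) = k *s tor c x" for k x
    unfolding tor_def scale_sum_right bil scale_scale by (simp only: mult.left_commute)
qed

lemma tor_e: "i \<in> I \<Longrightarrow> tor c (e i) = c i *s e i"
proof -
  assume i: "i \<in> I"
  have "tor c (e i) = (\<Sum>j\<in>I. if j = i then c j *s e j else 0)"
    unfolding tor_def by (rule sum.cong) (use i d_in d_inj in \<open>auto simp: gram\<close>)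
  then show ?thesis using i by simp
qed

lemma diagonal_eq_tor:
  assumes "Vector_Spaces.linear scaleV scaleV h" "\<And>i. i \<in> I \<Longrightarrow> h (e i) = c i *s e i"
  shows "h = tor c"
  by (rule linear_eq_on_e[OF assms(1) linear_tor]) (simp add: assms(2) tor_e)

lemma tor_comp: "tor a \<circ> tor b = tor (\<lambda>i. a i * b i)"
proof (rule diagonal_eq_tor)
  interpret a: Vector_Spaces.linear scaleV scaleV "tor a" by (rule linear_tor)
  show "(tor a \<circ> tor b) (e i) = (a i * b i) *s e i" if "i \<in> I" for i
    using that by (simp add: tor_e a.scale mult.commute)
qed (auto intro: Vector_Spaces.linear_compose linear_tor)

lemma tor_one: "(\<And>i. i \<in> I \<Longrightarrow> c i = 1) \<Longrightarrow> tor c = id"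
  by (rule diagonal_eq_tor[symmetric, OF linear_id']) simp

lemma tor_cong: "(\<And>i. i \<in> I \<Longrightarrow> a i = b i) \<Longrightarrow> tor a = tor b"
  by (rule diagonal_eq_tor[OF linear_tor]) (simp add: tor_e)

lemma isometry_tor: "(\<And>i. i \<in> I \<Longrightarrow> c i * c (d i) = 1) \<Longrightarrow> isometry (tor c)"
proof (rule isometryI[OF linear_tor])
  fix i j assume c: "\<And>i. i \<in> I \<Longrightarrow> c i * c (d i) = 1" and ij: "i \<in> I" "j \<in> I"
  show "\<beta> (tor c (e i)) (tor c (e j)) = \<beta> (e i) (e j)"
    using c[OF ij(1)] ij by (auto simp: tor_e bil gram mult.commute)
qed

lemma det_tor: "endo_det scaleV (tor c) = (\<Prod>i\<in>I. c i)"
proof -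
  let ?D = "mat n n (\<lambda>(i, j). if i = j then c (Suc j) else 0)"
  have "mat_between scaleV bs bs (tor c) = ?D"
  proof (rule mat_between_eqI[OF ob])
    fix j assume "j < length bs"
    then have j: "j < n" by simp
    have "(\<Sum>i<n. ?D $$ (i, j) *s bs ! i) = (\<Sum>i<n. if i = j then c (Suc j) *s e (Suc j) else 0)"
      by (rule sum.cong) (use j in \<open>auto simp: nth_bs\<close>)
    then show "tor c (bs ! j) = (\<Sum>i<length bs. ?D $$ (i, j) *s bs ! i)"
      using j by (simp add: nth_bs tor_e Suc_in_I)
  qed auto
  moreover have "det ?D = prod_list (diag_mat ?D)"
    by (rule det_upper_triangular[of _ n]) (auto intro!: upper_triangularI)
  moreover have "diag_mat ?D = map (\<lambda>i. c (Suc i)) [0..<n]"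
    by (auto simp: diag_mat_def)
  moreover have "prod_list (map (\<lambda>i. c (Suc i)) [0..<n]) = (\<Prod>i\<in>I. c i)"
    by (subst prod.distinct_set_conv_list[symmetric])
       (auto simp: atLeast0LessThan prod.atLeast1_atMost_eq I_def)
  ultimately show ?thesis using endo_det_basis[OF ob linear_tor] by simp
qed

definition torus_params :: "(nat \<Rightarrow> 'k) set" where
  "torus_params = {c. \<forall>i\<in>I. c i * c (d i) = 1 \<and> (2 * i = n + 1 \<longrightarrow> c i = 1)}"

text \<open>The field contains square roots of the diagonal entries, so the map is a square of an isometry. The roots are
  chosen on one half of the indices only, since the entries at \<open>i\<close> and \<open>d i\<close> have to stay inverse to each other.\<close>

lemma tor_in_torus:
  assumes c: "c \<in> torus_params"
  shows "tor c \<in> G" "tor c \<in> torus scaleV \<beta> n e"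
proof -
  have "\<exists>s. s ^ 2 = c i" for i using nth_root_exists[of 2 "c i"] by auto
  then obtain s where s: "\<And>i. s i ^ 2 = c i" by metis
  define r where "r i = (if 2 * i < n + 1 then s i else if 2 * i = n + 1 then 1 else inverse (s (d i)))" for i
  have par: "d i < n + 1" "2 * d i < n + 1 \<longleftrightarrow> 2 * i > n + 1" "2 * d i = n + 1 \<longleftrightarrow> 2 * i = n + 1" if "i \<in> I" for i
    using that by (auto simp: d_def I_def)
  have sn: "s i \<noteq> 0" if "i \<in> I" for i
    using c that s[of i] by (force simp: torus_params_def)
  have r1: "r i * r (d i) = 1" if "i \<in> I" for i
    using par[OF that] sn[OF that] sn[OF d_in[OF that]] d_d[OF that] by (auto simp: r_def)
  have r2: "r i * r i = c i" if i: "i \<in> I" for i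
  proof -
    have c1: "c i * c (d i) = 1" "2 * i = n + 1 \<longrightarrow> c i = 1" using c i by (auto simp: torus_params_def)
    consider "2 * i < n + 1" | "2 * i = n + 1" | "2 * i > n + 1" by linarith
    then show ?thesis
    proof cases
      case 3
      then have "r i * r i = inverse (c (d i))"
        by (simp add: r_def s[symmetric] power2_eq_square)
      also have "\<dots> = c i" using c1(1) by (metis inverse_unique mult.commute)
      finally show ?thesis .
    qed (use c1 in \<open>auto simp: r_def s[symmetric] power2_eq_square\<close>)
  qed
  have "tor c = tor r \<circ> tor r" unfolding tor_comp by (rule tor_cong) (simp add: r2)
  moreover have "isometry (tor r)" by (rule isometry_tor) (rule r1)
  ultimately show "tor c \<in> G" using square_in_G by simp
  then show "tor c \<in> torus scaleV \<beta> n e"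
    using tor_e[of _ c] unfolding torus_def I_def by blast
qed

lemma prod_paired:
  assumes "\<And>i. i \<in> I \<Longrightarrow> c i * c (d i) = 1"
  shows "(\<Prod>i\<in>I. c i) = (\<Prod>i\<in>{i\<in>I. 2 * i = n + 1}. c i)"
proof -
  let ?A = "{i\<in>I. 2 * i < n + 1}" and ?B = "{i\<in>I. 2 * i > n + 1}" and ?C = "{i\<in>I. 2 * i = n + 1}"
  have "I = (?A \<union> ?B) \<union> ?C" by auto
  then have "(\<Prod>i\<in>I. c i) = (\<Prod>i\<in>(?A \<union> ?B) \<union> ?C. c i)" by (rule arg_cong)
  also have "\<dots> = (\<Prod>i\<in>?A \<union> ?B. c i) * (\<Prod>i\<in>?C. c i)"
    by (rule prod.union_disjoint) auto
  also have "(\<Prod>i\<in>?A \<union> ?B. c i) = (\<Prod>i\<in>?A. c i) * (\<Prod>i\<in>?B. c i)"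
    by (rule prod.union_disjoint) auto
  also have "(\<Prod>i\<in>?B. c i) = (\<Prod>i\<in>?A. c (d i))"
    by (rule prod.reindex_bij_witness[of _ d d]) (auto simp: I_def d_def)
  also have "(\<Prod>i\<in>?A. c i) * (\<Prod>i\<in>?A. c (d i)) = 1"
    using assms by (simp flip: prod.distrib)
  finally show ?thesis by simp
qed

text \<open>For odd \<open>n\<close> the determinant excludes the diagonal isometries with middle entry \<open>-1\<close>.\<close>

lemma torus_eq_tor:
  assumes "h \<in> torus scaleV \<beta> n e"
  shows "\<exists>c\<in>torus_params. h = tor c"
proof -
  have h: "h \<in> G" using assms by (simp add: torus_def)
  obtain c where c: "\<And>i. i \<in> I \<Longrightarrow> h (e i) = c i *s e i"
  proof -
    have "\<forall>i\<in>I. \<exists>c. h (e i) = c *s e i" using assms by (simp add: torus_def I_def)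
    then show ?thesis using that by (metis bchoice)
  qed
  have htor: "h = tor c" by (rule diagonal_eq_tor[OF isometry_linear[OF G_isometry[OF h]] c])
  have c1: "c i * c (d i) = 1" if i: "i \<in> I" for i
    using isometry_products[OF G_isometry[OF h], of "e i" "e (d i)"] i d_in[OF i]
    by (simp add: c bil gram mult.commute)
  have "c i = 1" if i: "i \<in> I" "2 * i = n + 1" for i
  proof -
    have "{i\<in>I. 2 * i = n + 1} = {i}" using i by auto
    then have "endo_det scaleV h = c i" using htor det_tor prod_paired[of c, OF c1] by simp
    then show ?thesis using h by (simp add: G_iff)
  qed
  then have "c \<in> torus_params" using c1 by (auto simp: torus_params_def)
  then show ?thesis using htor by blast
qed

subsection \<open>Eichler transformations\<close>

text \<open>The Siegel-Eichler transformation for an isotropic vector \<open>a\<close> and a vector \<open>x\<close> orthogonal to it. For \<open>a = e i\<close>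
  and \<open>x\<close> a multiple of a basis vector these are root elements of the orthogonal group.\<close>

definition eichler :: "'v \<Rightarrow> 'v \<Rightarrow> 'v \<Rightarrow> 'v" where
  "eichler a x v = v + \<beta> v a *s x - (\<beta> v x + \<beta> x x / 2 * \<beta> v a) *s a"

lemma linear_eichler: "Vector_Spaces.linear scaleV scaleV (eichler a x)"
proof (rule linear_endoI)
  fix v w c
  have "eichler a x (v + w) = (v + w) + (\<beta> v a *s x + \<beta> w a *s x)
      - ((\<beta> v x + \<beta> x x / 2 * \<beta> v a) *s a + (\<beta> w x + \<beta> x x / 2 * \<beta> w a) *s a)"
    unfolding scale_left_distrib[symmetric] by (simp add: eichler_def bil distrib_left add_ac)
  then show "eichler a x (v + w) = eichler a x v + eichler a x w"
    by (simp add: eichler_def)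
  show "eichler a x (c *s v) = c *s eichler a x v"
    by (simp add: eichler_def bil scale_right_distrib scale_right_diff_distrib distrib_left mult.left_commute)
qed

lemma eichler_isometry:
  assumes "\<beta> a a = 0" "\<beta> a x = 0"
  shows "isometry (eichler a x)"
proof -
  define q where "q = \<beta> x x / 2"
  have xx: "\<beta> x x = 2 * q" using two by (simp add: q_def)
  have xa: "\<beta> x a = 0" using assms sym by metis
  have "\<beta> (eichler a x v) (eichler a x w) = \<beta> v w" for v w
  proof -
    have exp: "\<beta> (v + s *s x - r *s a) (w + s' *s x - r' *s a)
        = \<beta> v w + s' * \<beta> v x - r' * \<beta> v a + s * (\<beta> x w + s' * (2 * q)) - r * \<beta> a w" for s s' r r'
      using assms xa by (simp add: bil xx algebra_simps)
    have "\<beta> (eichler a x v) (eichler a x w) = \<beta> v w + \<beta> w a * \<beta> v x - (\<beta> w x + q * \<beta> w a) * \<beta> v a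
        + \<beta> v a * (\<beta> w x + \<beta> w a * (2 * q)) - (\<beta> v x + q * \<beta> v a) * \<beta> w a"
      unfolding eichler_def q_def[symmetric] exp sym[of x w] sym[of a w] ..
    also have "\<dots> = \<beta> v w" by (simp add: algebra_simps)
    finally show ?thesis .
  qed
  then show ?thesis using linear_eichler by (simp add: isometry_def)
qed

lemma eichler_add:
  assumes "\<beta> a a = 0" "\<beta> a x = 0" "\<beta> a y = 0"
  shows "eichler a x \<circ> eichler a y = eichler a (x + y)"
proof
  fix v
  define qx qy where "qx = \<beta> x x / 2" and "qy = \<beta> y y / 2"
  have xy: "\<beta> x a = 0" "\<beta> y a = 0" "\<beta> y x = \<beta> x y" using assms sym by metis+
  have q: "\<beta> (x + y) (x + y) / 2 = qx + qy + \<beta> x y"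
    using two xy by (simp add: qx_def qy_def bil field_simps)
  define s where "s = \<beta> v a"
  define w where "w = eichler a y v"
  have wa: "\<beta> w a = s" using assms xy by (simp add: w_def eichler_def bil s_def)
  have wx: "\<beta> w x = \<beta> v x + s * \<beta> x y" using assms xy by (simp add: w_def eichler_def bil s_def)
  have "(eichler a x \<circ> eichler a y) v = w + s *s x - (\<beta> w x + qx * s) *s a"
    by (simp add: eichler_def[of a x] wa qx_def flip: w_def)
  also have "\<dots> = v + (s *s x + s *s y) - ((\<beta> v y + qy * s) *s a + (\<beta> w x + qx * s) *s a)"
    by (simp add: w_def eichler_def qy_def s_def algebra_simps)
  also have "(\<beta> v y + qy * s) *s a + (\<beta> w x + qx * s) *s a = (\<beta> v (x + y) + (qx + qy + \<beta> x y) * s) *s a"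
    unfolding scale_left_distrib[symmetric] by (simp add: wx bil algebra_simps)
  also have "s *s x + s *s y = s *s (x + y)" by (simp add: scale_right_distrib)
  finally show "(eichler a x \<circ> eichler a y) v = eichler a (x + y) v"
    unfolding eichler_def[of a "x + y"] q s_def .
qed

lemma eichler_0: "eichler a 0 = id"
  by (auto simp: eichler_def bil)

text \<open>The transformation is the square of the one for \<open>x / 2\<close>.\<close>

lemma eichler_in_G:
  assumes "\<beta> a a = 0" "\<beta> a x = 0"
  shows "eichler a x \<in> G"
proof -
  let ?y = "(1 / 2) *s x"
  have y: "\<beta> a ?y = 0" using assms by (simp add: bil)
  have "eichler a x = eichler a ?y \<circ> eichler a ?y"
  proof -
    have "?y + ?y = x" using two by (simp flip: scale_left_distrib)
    then show ?thesis using eichler_add[OF assms(1) y y] by simp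
  qed
  then show ?thesis using square_in_G[OF eichler_isometry[OF assms(1) y]] by simp
qed

lemma eichler_fixes: "\<beta> v a = 0 \<Longrightarrow> \<beta> v x = 0 \<Longrightarrow> eichler a x v = v"
  by (simp add: eichler_def)

lemma eichler_scale: "eichler (k *s a) x = eichler a (k *s x)"
proof
  fix v
  have "(\<beta> v x + \<beta> x x / 2 * (k * \<beta> v a)) * k = k * \<beta> v x + (k * (k * \<beta> x x)) / 2 * \<beta> v a"
    by (simp add: algebra_simps)
  then show "eichler (k *s a) x v = eichler a (k *s x) v"
    unfolding eichler_def bil scale_scale by (simp add: mult.commute)
qed

lemma eichler_conj:
  assumes "isometry g"
  shows "g \<circ> eichler a x = eichler (g a) (g x) \<circ> g"
proof -
  interpret g: Vector_Spaces.linear scaleV scaleV g using assms by (rule isometry_linear)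
  show ?thesis using isometry_products[OF assms] by (auto simp: eichler_def g.add g.diff g.scale)
qed

text \<open>The vector \<open>x\<close> has to be the component of \<open>w\<close> orthogonal to \<open>a\<close> and \<open>b\<close>. The remaining coefficient,
  that of \<open>a\<close>, is then correct because \<open>w\<close> is isotropic.\<close>

lemma eichler_reach:
  assumes "\<beta> a a = 0" "\<beta> b b = 0" "\<beta> a b = 1" "\<beta> w w = 0" "\<beta> w a = 1"
  defines "x \<equiv> w - b - \<beta> w b *s a"
  shows "eichler a x b = w" "\<beta> a x = 0" "\<beta> b x = 0"
proof -
  have s: "\<beta> b a = 1" "\<beta> a w = 1" "\<beta> b w = \<beta> w b" using assms sym by metis+
  show ax: "\<beta> a x = 0" and bx: "\<beta> b x = 0" using assms s by (simp_all add: x_def bil)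
  have "\<beta> x x = - 2 * \<beta> w b" using assms s by (simp add: x_def bil algebra_simps)
  then have q: "\<beta> x x / 2 = - \<beta> w b" using two by simp
  show "eichler a x b = w" unfolding eichler_def q using s bx by (simp add: x_def)
qed


subsection \<open>Density of the big cell\<close>

text \<open>The indices of the first \<open>i\<close> and the last \<open>i\<close> vectors of the Witt basis. By duality, orthogonality to these vectors
  means lying in the span of \<open>e (i + 1), \<dots>, e (n - i)\<close>.\<close>

definition outside :: "nat \<Rightarrow> nat set" where "outside i = {j \<in> I. j \<le> i \<or> n + 1 \<le> i + j}"

definition inner :: "nat \<Rightarrow> 'v set" where "inner i = {x. \<forall>j\<in>outside i. \<beta> x (e j) = 0}"

definition fixes_upto :: "nat \<Rightarrow> ('v \<Rightarrow> 'v) \<Rightarrow> bool" where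
  "fixes_upto i g \<longleftrightarrow> (\<forall>j\<in>outside i. g (e j) = e j)"

definition polycurve :: "('k \<Rightarrow> 'v \<Rightarrow> 'v) \<Rightarrow> bool" where
  "polycurve \<gamma> \<longleftrightarrow> (\<forall>v w. polyfun (\<lambda>t. \<beta> (\<gamma> t v) w))"

lemma products_expansion: "\<beta> v w = (\<Sum>i\<in>I. \<beta> v (e (d i)) * \<beta> w (e i))"
  by (subst expansion[of v]) (simp add: bil sym[of w])

lemma polycurve_eichler:
  assumes "\<And>w. polyfun (\<lambda>t. \<beta> (x t) w)"
  shows "polycurve (\<lambda>t. eichler a (x t) \<circ> g)"
proof -
  have x2: "polyfun (\<lambda>t. \<beta> w (x t))" for w using assms sym by simp
  have x3: "polyfun (\<lambda>t. \<beta> (x t) (x t))"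
    unfolding products_expansion[of "x _" "x _"] by (intro polyfun_intros assms)
  show ?thesis
    unfolding polycurve_def comp_apply eichler_def bil divide_inverse
    by (intro allI polyfun_intros assms x2 x3)
qed

lemma innerD: "x \<in> inner i \<Longrightarrow> j \<in> outside i \<Longrightarrow> \<beta> x (e j) = 0" by (simp add: inner_def)

lemma inner_lin: "x \<in> inner i \<Longrightarrow> y \<in> inner i \<Longrightarrow> x + y \<in> inner i" "x \<in> inner i \<Longrightarrow> y \<in> inner i \<Longrightarrow> x - y \<in> inner i"
  "x \<in> inner i \<Longrightarrow> c *s x \<in> inner i" "x \<in> inner i \<Longrightarrow> - x \<in> inner i"
  by (simp_all add: inner_def bil)

lemma outside_Suc:
  assumes "2 * Suc i < n + 1"
  shows "outside (Suc i) = insert (Suc i) (insert (d (Suc i)) (outside i))"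
  using assms by (auto simp: outside_def I_def d_def)

lemma level_facts:
  assumes "2 * Suc i < n + 1"
  shows "Suc i \<in> I" "d (Suc i) \<in> I" "d (Suc i) \<noteq> Suc i" "Suc i \<notin> outside i" "d (Suc i) \<notin> outside i"
  using assms by (auto simp: outside_def I_def d_def)

lemma e_inner:
  assumes "j \<in> I" "j \<notin> outside i"
  shows "e j \<in> inner i"
  using assms by (auto simp: inner_def gram outside_def I_def d_def)

lemma inner_Suc:
  assumes "2 * Suc i < n + 1"
  shows "x \<in> inner (Suc i) \<longleftrightarrow> x \<in> inner i \<and> \<beta> x (e (Suc i)) = 0 \<and> \<beta> x (e (d (Suc i))) = 0"
  unfolding inner_def outside_Suc[OF assms] by auto

lemma hyperbolic_pair:
  assumes "2 * i < n + 1" "i \<in> I"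
  shows "\<beta> (e i) (e i) = 0" "\<beta> (e (d i)) (e (d i)) = 0" "\<beta> (e i) (e (d i)) = 1" "\<beta> (e (d i)) (e i) = 1"
  using assms by (auto simp: gram d_in d_d) (auto simp: d_def)

lemma inner_perp:
  assumes "2 * i < n + 1" "i \<in> I" "x \<in> inner i"
  shows "\<beta> (e i) x = 0" "\<beta> (e (d i)) x = 0"
proof -
  have "i \<in> outside i" "d i \<in> outside i" using assms(1,2) by (auto simp: outside_def d_def I_def)
  then show "\<beta> (e i) x = 0" "\<beta> (e (d i)) x = 0" using innerD[OF assms(3)] sym by simp_all
qed

lemma inner_eichler_G:
  assumes "2 * i < n + 1" "i \<in> I" "x \<in> inner i"
  shows "eichler (e i) x \<in> G" "eichler (e (d i)) x \<in> G"
  using eichler_in_G hyperbolic_pair[OF assms(1,2)] inner_perp[OF assms] by blast+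

lemma eichler_fixes_upto:
  assumes "2 * Suc i < n + 1" "x \<in> inner (Suc i)"
  shows "fixes_upto i (eichler (e (Suc i)) x)" "fixes_upto i (eichler (e (d (Suc i))) x)"
proof -
  have "eichler a x (e j) = e j" if "a \<in> inner i" "j \<in> outside i" for a j
  proof -
    have "\<beta> (e j) a = 0" "\<beta> (e j) x = 0"
      using innerD[OF that] innerD[OF assms(2), of j] that(2) outside_Suc[OF assms(1)] sym by simp_all
    then show ?thesis by (rule eichler_fixes)
  qed
  then show "fixes_upto i (eichler (e (Suc i)) x)" "fixes_upto i (eichler (e (d (Suc i))) x)"
    using e_inner level_facts[OF assms(1)] by (auto simp: fixes_upto_def)
qed

lemma fixes_upto_comp: "fixes_upto i g \<Longrightarrow> fixes_upto i h \<Longrightarrow> fixes_upto i (g \<circ> h)"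
  by (simp add: fixes_upto_def)

lemma reach_inner:
  assumes i: "2 * Suc i < n + 1"
    and ab: "a = e (Suc i) \<and> b = e (d (Suc i)) \<or> a = e (d (Suc i)) \<and> b = e (Suc i)"
    and w: "w \<in> inner i" "\<beta> w w = 0" "\<beta> w a = 1"
  shows "\<exists>x\<in>inner (Suc i). eichler a x b = w"
proof -
  note lf = level_facts[OF i]
  have hyp: "\<beta> a a = 0" "\<beta> b b = 0" "\<beta> a b = 1" using ab hyperbolic_pair[OF i lf(1)] by auto
  have ins: "a \<in> inner i" "b \<in> inner i" using ab e_inner lf by auto
  define x where "x = w - b - \<beta> w b *s a"
  note r = eichler_reach[OF hyp w(2,3), folded x_def]
  have "x \<in> inner i" unfolding x_def using w(1) ins by (intro inner_lin)
  moreover have "\<beta> x (e (Suc i)) = 0" "\<beta> x (e (d (Suc i))) = 0" using r(2,3) ab sym by auto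
  ultimately have "x \<in> inner (Suc i)" using inner_Suc[OF i] by blast
  then show ?thesis using r(1) by blast
qed

lemma eichler_cancel:
  assumes "\<beta> a a = 0" "\<beta> a x = 0"
  shows "eichler a (- x) (eichler a x v) = v"
proof -
  have "eichler a (- x) \<circ> eichler a x = id"
    using eichler_add[of a "- x" x] assms by (simp add: bil eichler_0)
  then show ?thesis by (metis comp_apply id_apply)
qed

text \<open>For even \<open>n\<close>, an isometry which fixes all basis vectors outside the middle hyperbolic plane and is not in the torus
  exchanges the two isotropic lines of this plane. Up to the torus it is the transposition excluded here, whose
  determinant is \<open>-1\<close>.\<close>

lemma not_swap:
  assumes g: "g \<in> G" and k: "2 * k = n" and fixed: "\<And>j. j \<in> I \<Longrightarrow> j \<noteq> k \<Longrightarrow> j \<noteq> Suc k \<Longrightarrow> g (e j) = e j"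
    and sw: "g (e k) = e (Suc k)" "g (e (Suc k)) = e k"
  shows False
proof -
  have kk: "k - 1 < n" "k < n" "k - 1 \<noteq> k" using k n5 by auto
  let ?S = "swaprows_mat n (k - 1) k :: 'k mat"
  have "mat_between scaleV bs bs g = ?S"
  proof (rule mat_between_eqI[OF ob])
    fix j assume "j < length bs"
    then have j: "j < n" by simp
    define j' where "j' = (if j = k - 1 then k else if j = k then k - 1 else j)"
    have j': "j' < n" using j kk by (auto simp: j'_def)
    have "(\<Sum>i<n. ?S $$ (i, j) *s bs ! i) = (\<Sum>i<n. if i = j' then e (Suc j') else 0)"
      by (rule sum.cong) (use j kk in \<open>auto simp: nth_bs j'_def swaprows_mat_def\<close>)
    also have "\<dots> = e (Suc j')" using j' by simp
    also have "\<dots> = g (e (Suc j))"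
      using sw fixed[of "Suc j"] j k n5 by (auto simp: j'_def Suc_in_I)
    finally show "g (bs ! j) = (\<Sum>i<length bs. ?S $$ (i, j) *s bs ! i)" using j by (simp add: nth_bs)
  qed (auto simp: swaprows_mat_def)
  then have "endo_det scaleV g = - 1"
    using endo_det_basis[OF ob isometry_linear[OF G_isometry[OF g]]] det_swaprows_mat[OF kk] by simp
  then show False using g two by (auto simp: G_iff)
qed

text \<open>The open cell is the product of the unipotent parts of two opposite Borel subgroups with the torus between
  them, so the hypotheses make \<open>D\<close> vanish on it. An
  element outside the open cell is the value at 0 of a polynomial curve which meets the open cell.
  The induction runs over the nested subspaces \<open>inner i\<close>: left and right multiplication by Eichler
  transformations for \<open>e (i + 1)\<close> and its dual vector reduces an element that acts on \<open>inner i\<close>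
  to one that acts on \<open>inner (i + 1)\<close>.\<close>

lemma big_cell_density:
  fixes D :: "('v \<Rightarrow> 'v) \<Rightarrow> 'k"
  assumes curve: "\<And>\<gamma>. (\<And>t. \<gamma> t \<in> G) \<Longrightarrow> polycurve \<gamma> \<Longrightarrow> polyfun (\<lambda>t. D (\<gamma> t))"
    and left: "\<And>i x g. i \<in> I \<Longrightarrow> 2 * i < n + 1 \<Longrightarrow> x \<in> inner i \<Longrightarrow> g \<in> G \<Longrightarrow> D (eichler (e (d i)) x \<circ> g) = D g"
    and right: "\<And>i x g. i \<in> I \<Longrightarrow> 2 * i < n + 1 \<Longrightarrow> x \<in> inner i \<Longrightarrow> g \<in> G \<Longrightarrow> D (g \<circ> eichler (e i) x) = D g"
    and tor: "\<And>c g. c \<in> torus_params \<Longrightarrow> g \<in> G \<Longrightarrow> D (g \<circ> tor c) = 0 \<Longrightarrow> D g = 0"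
    and one: "D id = 0"
    and g: "g \<in> G"
  shows "D g = 0"
proof -
  have torus: "D h = 0" if h: "h \<in> torus scaleV \<beta> n e" for h
  proof -
    obtain c where c: "c \<in> torus_params" "h = tor c" using torus_eq_tor[OF h] by blast
    let ?c' = "\<lambda>i. inverse (c i)"
    have "?c' \<in> torus_params"
      using c(1) by (auto simp: torus_params_def simp flip: inverse_mult_distrib)
    moreover have "h \<circ> tor ?c' = id"
    proof -
      have "c i \<noteq> 0" if "i \<in> I" for i using c(1) that by (auto simp: torus_params_def)
      then show ?thesis unfolding c(2) tor_comp by (intro tor_one) simp
    qed
    ultimately show ?thesis using tor[of ?c' h] one h by (simp add: torus_def)
  qed
  have "\<forall>g\<in>G. fixes_upto i g \<longrightarrow> D g = 0" if "i \<le> n div 2" for i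
    using that
  proof (induction rule: inc_induct)
    case base
    show ?case
    proof (intro ballI impI)
      fix g assume g: "g \<in> G" and fx: "fixes_upto (n div 2) g"
      have iso: "isometry g" using g by (rule G_isometry)
      have "\<exists>c. g (e j) = c *s e j" if j: "j \<in> I" for j
      proof (cases "j \<in> outside (n div 2)")
        case True
        then show ?thesis using fx by (intro exI[of _ 1]) (simp add: fixes_upto_def)
      next
        case False
        have "g (e j) = \<beta> (g (e j)) (e j) *s e j"
        proof (rule eq_by_products)
          fix k assume k: "k \<in> I"
          have dj: "d j = j" using False j by (auto simp: outside_def I_def d_def)
          show "\<beta> (g (e j)) (e k) = \<beta> (\<beta> (g (e j)) (e j) *s e j) (e k)"
          proof (cases "k = j")
            case True then show ?thesis using j dj by (simp add: bil gram)
          next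
            case ne: False
            then have "k \<in> outside (n div 2)" using k False j by (auto simp: outside_def I_def)
            then have "g (e k) = e k" using fx by (simp add: fixes_upto_def)
            then have "\<beta> (g (e j)) (e k) = \<beta> (e j) (e k)" using isometry_products[OF iso, of "e j" "e k"] by simp
            then show ?thesis using j k ne dj by (simp add: bil gram)
          qed
        qed
        then show ?thesis by blast
      qed
      then have "g \<in> torus scaleV \<beta> n e" using g by (auto simp: torus_def I_def)
      then show "D g = 0" by (rule torus)
    qed
  next
    case (step i)
    define k where "k = Suc i"
    have i: "2 * Suc i < n + 1" using step by simp
    note lf = level_facts[OF i, folded k_def]
    have k2: "2 * k < n + 1" using i k_def by simp
    note hyp = hyperbolic_pair[OF k2 lf(1)]
    have v_facts: "g (e k) \<in> inner i" "\<beta> (g (e k)) (g (e k)) = 0" if "g \<in> G" "fixes_upto i g" for g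
    proof -
      note iso = G_isometry[OF that(1)]
      show "\<beta> (g (e k)) (g (e k)) = 0" using isometry_products[OF iso] hyp by simp
      have "\<beta> (g (e k)) (e j) = \<beta> (e k) (e j)" if "j \<in> outside i" for j
        using isometry_products[OF iso, of "e k" "e j"] \<open>fixes_upto i g\<close> that by (simp add: fixes_upto_def)
      then show "g (e k) \<in> inner i" using e_inner[OF lf(1,4)] by (simp add: inner_def)
    qed
    \<comment> \<open>One elimination step in the open cell: an Eichler transformation on the left and a diagonal map on the right make
      \<open>g\<close> fix \<open>e k\<close>, and an Eichler transformation on the right then makes it fix the dual vector as well.\<close>
    have generic: "D g = 0" if g: "g \<in> G" and fx: "fixes_upto i g" and ne: "\<beta> (g (e k)) (e (d k)) \<noteq> 0" for g
    proof -
      define a where "a = \<beta> (g (e k)) (e (d k))"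
      define w where "w = (1 / a) *s g (e k)"
      have a: "a \<noteq> 0" using ne a_def by simp
      have w: "w \<in> inner i" "\<beta> w w = 0" "\<beta> w (e (d k)) = 1"
        using v_facts[OF g fx] a by (auto simp: w_def bil inner_lin a_def[symmetric])
      have gk: "g (e k) = a *s w" using a by (simp add: w_def)
      obtain x where x: "x \<in> inner k" "eichler (e (d k)) x (e k) = w"
        using reach_inner[OF i, of "e (d k)" "e k" w] w by (auto simp: k_def)
      note xp = inner_perp[OF k2 lf(1) x(1)]
      define g1 where "g1 = eichler (e (d k)) (- x) \<circ> g"
      have mx: "- x \<in> inner k" using x(1) by (rule inner_lin)
      have g1G: "g1 \<in> G" unfolding g1_def by (rule G_comp[OF inner_eichler_G(2)[OF k2 lf(1) mx] g])
      have fx1: "fixes_upto i g1" unfolding g1_def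
        by (rule fixes_upto_comp[OF _ fx]) (use eichler_fixes_upto(2)[OF i] mx k_def in auto)
      interpret E: Vector_Spaces.linear scaleV scaleV "eichler (e (d k)) (- x)" by (rule linear_eichler)
      have g1k: "g1 (e k) = a *s e k"
        using eichler_cancel[OF hyp(2) xp(2), of "e k"] by (simp add: g1_def gk E.scale x(2))
      have Dg1: "D g1 = D g" unfolding g1_def by (rule left[OF lf(1) k2 mx g])
      define c where "c j = (if j = k then 1 / a else if j = d k then a else 1)" for j
      have c: "c \<in> torus_params"
        using a k2 by (auto simp: torus_params_def c_def d_d d_eq lf d_inj) (auto simp: d_def)
      define g2 where "g2 = g1 \<circ> tor c"
      have g2G: "g2 \<in> G" unfolding g2_def by (rule G_comp[OF g1G tor_in_torus(1)[OF c]])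
      interpret g1: Vector_Spaces.linear scaleV scaleV g1 by (rule isometry_linear[OF G_isometry[OF g1G]])
      have g2k: "g2 (e k) = e k" using a lf by (simp add: g2_def tor_e c_def g1.scale g1k)
      have "tor c (e j) = e j" if "j \<in> outside i" for j
        using that lf by (subst tor_e) (auto simp: c_def outside_def)
      then have fx2: "fixes_upto i g2"
        unfolding g2_def by (intro fixes_upto_comp[OF fx1]) (simp add: fixes_upto_def)
      note iso2 = G_isometry[OF g2G]
      obtain u where u: "g2 u = e (d k)" using isometry_surj[OF iso2] by (metis surjD)
      have "u \<in> inner i"
      proof -
        have "\<beta> u (e j) = \<beta> (e (d k)) (e j)" if "j \<in> outside i" for j
          using isometry_products[OF iso2, of u "e j"] fx2 that u by (simp add: fixes_upto_def)
        then show ?thesis using e_inner[OF lf(2,5)] by (simp add: inner_def)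
      qed
      moreover have "\<beta> u u = 0" "\<beta> u (e k) = 1"
        using isometry_products[OF iso2, of u u] isometry_products[OF iso2, of u "e k"] u g2k hyp by simp_all
      ultimately obtain z where z: "z \<in> inner k" "eichler (e k) z (e (d k)) = u"
        using reach_inner[OF i, of "e k" "e (d k)" u] by (auto simp: k_def)
      note zp = inner_perp[OF k2 lf(1) z(1)]
      define g3 where "g3 = g2 \<circ> eichler (e k) z"
      have g3G: "g3 \<in> G" unfolding g3_def by (rule G_comp[OF g2G inner_eichler_G(1)[OF k2 lf(1) z(1)]])
      have "fixes_upto i g3" unfolding g3_def
        by (rule fixes_upto_comp[OF fx2]) (use eichler_fixes_upto(1)[OF i] z k_def in auto)
      moreover have "g3 (e (d k)) = e (d k)" by (simp add: g3_def z(2) u)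
      moreover have "g3 (e k) = e k" using eichler_fixes[OF hyp(1) zp(1)] by (simp add: g3_def g2k)
      ultimately have "fixes_upto (Suc i) g3"
        unfolding fixes_upto_def outside_Suc[OF i] by (simp add: k_def)
      then have "D g3 = 0" using step.IH g3G by blast
      then have "D g2 = 0" unfolding g3_def by (simp add: right[OF lf(1) k2 z(1) g2G])
      then have "D g1 = 0" unfolding g2_def by (rule tor[OF c g1G])
      then show ?thesis using Dg1 by simp
    qed
    show ?case
    proof (intro ballI impI)
      fix g assume g: "g \<in> G" and fx: "fixes_upto i g"
      note iso = G_isometry[OF g]
      define v where "v = g (e k)"
      have v: "v \<in> inner i" "\<beta> v v = 0" using v_facts[OF g fx] by (simp_all add: v_def)
      have vne: "v \<noteq> 0" using isometry_products[OF iso, of "e k" "e (d k)"] hyp by (auto simp: v_def bil)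
      show "D g = 0"
      proof (cases "\<beta> v (e (d k)) = 0")
        case False
        then show ?thesis using generic[OF g fx] by (simp add: v_def)
      next
        case v0: True
        show ?thesis
        proof (cases "2 * k < n")
          case k3: True
          \<comment> \<open>Along \<open>t \<mapsto> eichler (e k) (t *s y) \<circ> g\<close> the pivot \<open>\<beta> (g (e k)) (e (d k))\<close> is a polynomial in \<open>t\<close> with these
            two coefficients. It must not vanish identically.\<close>
          have "\<exists>y\<in>inner k. \<not> (\<beta> v y = 0 \<and> \<beta> y y / 2 * \<beta> v (e k) = 0)"
          proof (cases "\<beta> v (e k) = 0")
            case True
            then obtain j where j: "j \<in> I" "\<beta> v (e j) \<noteq> 0"
              using vne eq_by_products[of v 0] by (auto simp: bil)
            have "j \<notin> outside (Suc i)"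
              using j v0 True innerD[OF v(1)] outside_Suc[OF i] by (auto simp: k_def)
            then have "e j \<in> inner k" using e_inner[OF j(1)] by (simp add: k_def)
            then show ?thesis using j by blast
          next
            case False
            define j where "j = Suc k"
            have j: "j \<in> I" "d j \<in> I" "j \<notin> outside k" "d j \<notin> outside k"
              using k3 by (auto simp: j_def outside_def I_def d_def)
            have "\<beta> (e j + e (d j)) (e j + e (d j)) = (if d j = j then 2 * 2 else 2)"
              using j by (simp add: bil gram d_d)
            moreover have "(2::'k) * 2 \<noteq> 0" using two no_zero_divisors by blast
            ultimately have "\<beta> (e j + e (d j)) (e j + e (d j)) / 2 \<noteq> 0" using two by (auto split: if_splits)
            then have "\<not> (\<beta> (e j + e (d j)) (e j + e (d j)) / 2 * \<beta> v (e k) = 0)"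
              using False by simp
            moreover have "e j + e (d j) \<in> inner k" using j by (intro inner_lin e_inner)
            ultimately show ?thesis by blast
          qed
          then obtain y where y: "y \<in> inner k" "\<not> (\<beta> v y = 0 \<and> \<beta> y y / 2 * \<beta> v (e k) = 0)" by blast
          define P where "P = [:0, - \<beta> v y, - (\<beta> y y / 2 * \<beta> v (e k)):]"
          have P0: "P \<noteq> 0" using y(2) by (auto simp: P_def)
          define \<gamma> where "\<gamma> t = eichler (e k) (t *s y) \<circ> g" for t
          have ty: "t *s y \<in> inner k" for t using y(1) by (rule inner_lin)
          have \<gamma>G: "\<gamma> t \<in> G" for t
            unfolding \<gamma>_def by (rule G_comp[OF inner_eichler_G(1)[OF k2 lf(1) ty] g])
          have \<gamma>fx: "fixes_upto i (\<gamma> t)" for t unfolding \<gamma>_def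
            by (rule fixes_upto_comp[OF _ fx]) (use eichler_fixes_upto(1)[OF i] ty k_def in auto)
          have val: "\<beta> (\<gamma> t (e k)) (e (d k)) = poly P t" for t
          proof -
            have "\<beta> y (e (d k)) = 0" using inner_perp[OF k2 lf(1) y(1)] sym by simp
            then show ?thesis using v0 hyp
              by (simp add: \<gamma>_def eichler_def bil P_def v_def[symmetric] algebra_simps)
          qed
          have "polycurve \<gamma>"
            unfolding \<gamma>_def by (rule polycurve_eichler) (auto simp: bil intro!: polyfun_intros)
          then obtain R where R: "\<And>t. D (\<gamma> t) = poly R t"
            using curve[of \<gamma>, OF \<gamma>G] by (auto simp: polyfun_def)
          have "poly (R * P) t = 0" for t
            using generic[OF \<gamma>G \<gamma>fx, of t] val R by (cases "poly P t = 0") auto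
          then have "R * P = 0" using poly_eq_0_cofinite[of "{}" "R * P"] by simp
          then have "R = 0" using P0 by simp
          then have "D (\<gamma> 0) = 0" using R by simp
          then show ?thesis by (simp add: \<gamma>_def eichler_0)
        next
          case False
          \<comment> \<open>No room for a curve is left in the middle hyperbolic plane of an even-dimensional space, but there the pivot
            can only vanish for an isometry of determinant \<open>-1\<close>.\<close>
          then have nk: "2 * k = n" using k2 by simp
          have dk: "d k = Suc k" using nk by (simp add: d_def)
          define b where "b = \<beta> v (e k)"
          have out: "j \<in> outside i" if "j \<in> I" "j \<noteq> k" "j \<noteq> d k" for j
            using that nk by (auto simp: outside_def I_def d_def k_def)
          have two_terms: "x = \<beta> x (e (d k)) *s e k + \<beta> x (e k) *s e (d k)" if "x \<in> inner i" for x
          proof (rule eq_by_products)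
            fix j assume j: "j \<in> I"
            show "\<beta> x (e j) = \<beta> (\<beta> x (e (d k)) *s e k + \<beta> x (e k) *s e (d k)) (e j)"
            proof (cases "j = k \<or> j = d k")
              case True then show ?thesis using hyp by (auto simp: bil)
            next
              case False
              then have "j \<in> outside i" using out j by blast
              then show ?thesis using innerD that innerD[OF e_inner[OF lf(1,4)]] innerD[OF e_inner[OF lf(2,5)]]
                by (simp add: bil)
            qed
          qed
          have vb: "v = b *s e (d k)" using two_terms[OF v(1)] v0 by (simp add: b_def)
          have b0: "b \<noteq> 0" using vb vne by auto
          define w where "w = g (e (d k))"
          have "w \<in> inner i"
          proof -
            have "\<beta> w (e j) = \<beta> (e (d k)) (e j)" if "j \<in> outside i" for j
              using isometry_products[OF iso, of "e (d k)" "e j"] fx that by (simp add: fixes_upto_def w_def)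
            then show ?thesis using e_inner[OF lf(2,5)] by (simp add: inner_def)
          qed
          then have w: "w = \<beta> w (e (d k)) *s e k + \<beta> w (e k) *s e (d k)" by (rule two_terms)
          have "\<beta> w v = 1" using isometry_products[OF iso, of "e (d k)" "e k"] hyp by (simp add: w_def v_def)
          then have bw: "b * \<beta> w (e (d k)) = 1" by (simp add: vb bil)
          have "\<beta> w w = 0" using isometry_products[OF iso, of "e (d k)" "e (d k)"] hyp by (simp add: w_def)
          moreover have "\<beta> w w = 2 * (\<beta> w (e (d k)) * \<beta> w (e k))"
            by (subst (2) w) (simp add: bil mult.commute)
          ultimately have "\<beta> w (e k) = 0" using two bw by auto
          moreover have "\<beta> w (e (d k)) = 1 / b" using bw b0 by (simp add: field_simps)
          ultimately have wb: "w = (1 / b) *s e k" using w by simp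
          define c where "c j = (if j = k then 1 / b else if j = d k then b else 1)" for j
          have c: "c \<in> torus_params"
            using b0 k2 by (auto simp: torus_params_def c_def d_d d_eq lf d_inj) (auto simp: d_def)
          interpret g: Vector_Spaces.linear scaleV scaleV g by (rule isometry_linear[OF iso])
          have "False"
          proof (rule not_swap[OF G_comp[OF g tor_in_torus(1)[OF c]] nk])
            show "(g \<circ> tor c) (e k) = e (Suc k)"
              using lf b0 vb by (simp add: tor_e c_def g.scale v_def[symmetric] dk)
            show "(g \<circ> tor c) (e (Suc k)) = e k"
              using lf b0 wb unfolding dk[symmetric] by (simp add: tor_e c_def g.scale w_def[symmetric])
            show "(g \<circ> tor c) (e j) = e j" if "j \<in> I" "j \<noteq> k" "j \<noteq> Suc k" for j
              using that out[of j] fx dk by (simp add: tor_e c_def fixes_upto_def)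
          qed
          then show ?thesis ..
        qed
      qed
    qed
  qed
  from this[of 0] g show ?thesis by (auto simp: fixes_upto_def outside_def I_def)
qed

end

section \<open>Linear functionals\<close>

lemma vector_space_field: "vector_space ((*) :: 'k::field \<Rightarrow> 'k \<Rightarrow> 'k)"
  by unfold_locales (auto simp: algebra_simps)

abbreviation functional :: "('k::field \<Rightarrow> 'v::ab_group_add \<Rightarrow> 'v) \<Rightarrow> ('v \<Rightarrow> 'k) \<Rightarrow> bool" where
  "functional s \<psi> \<equiv> Vector_Spaces.linear s (*) \<psi>"

context vector_space
begin

lemma functional_iff: "functional scale \<psi> \<longleftrightarrow> (\<forall>x y. \<psi> (x + y) = \<psi> x + \<psi> y) \<and> (\<forall>c x. \<psi> (scale c x) = c * \<psi> x)"
  using vector_space_field[where 'k = 'a, folded module_iff_vector_space]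
  by (simp add: module_hom_iff_linear[symmetric] module_hom_iff module_axioms)

lemma functionalI: "(\<And>x y. \<psi> (x + y) = \<psi> x + \<psi> y) \<Longrightarrow> (\<And>c x. \<psi> (scale c x) = c * \<psi> x) \<Longrightarrow> functional scale \<psi>"
  by (simp add: functional_iff)

lemma functionalD:
  assumes "functional scale \<psi>"
  shows "\<psi> (x + y) = \<psi> x + \<psi> y" "\<psi> (x - y) = \<psi> x - \<psi> y" "\<psi> (scale c x) = c * \<psi> x" "\<psi> 0 = 0" 
    "\<psi> (sum f A) = (\<Sum>a\<in>A. \<psi> (f a))"
proof -
  interpret \<psi>: Vector_Spaces.linear scale "(*)" \<psi> by fact
  show "\<psi> (x + y) = \<psi> x + \<psi> y" "\<psi> (x - y) = \<psi> x - \<psi> y" "\<psi> (scale c x) = c * \<psi> x" "\<psi> 0 = 0" 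
    "\<psi> (sum f A) = (\<Sum>a\<in>A. \<psi> (f a))"
    by (rule \<psi>.add \<psi>.diff \<psi>.scale \<psi>.zero \<psi>.sum)+
qed

lemma functional_comp:
  assumes "functional scale \<psi>" "Vector_Spaces.linear scale scale f"
  shows "functional scale (\<lambda>x. \<psi> (f x))"
  using Vector_Spaces.linear_compose[OF assms(2,1)] by (simp add: o_def)

text \<open>Extend \<open>x\<close> and a basis of the span of \<open>S\<close> to a basis of the whole space.\<close>

lemma separating_functional:
  assumes "x \<notin> span S"
  shows "\<exists>\<psi>. functional scale \<psi> \<and> (\<forall>y\<in>S. \<psi> y = 0) \<and> \<psi> x = 1"
proof -
  interpret vector_space_pair scale "(*) :: 'a \<Rightarrow> 'a \<Rightarrow> 'a"
    by (intro vector_space_pair.intro vector_space_field vector_space_axioms)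
  obtain B where B: "B \<subseteq> S" "independent B" "S \<subseteq> span B"
    using maximal_independent_subset[of S] by blast
  have xB: "x \<notin> span B" using assms B(1) span_mono by blast
  have "independent (insert x B)" using B(2) xB by (simp add: independent_insert)
  then obtain \<psi> where \<psi>: "functional scale \<psi>" "\<forall>b\<in>insert x B. \<psi> b = (if b = x then 1 else 0)"
    using linear_independent_extend[of "insert x B" "\<lambda>b. if b = x then 1 else 0"] by blast
  interpret \<psi>: Vector_Spaces.linear scale "(*)" \<psi> by fact
  have "\<psi> y = 0" if "y \<in> S" for y
  proof (rule \<psi>.eq_0_on_span[of B])
    show "y \<in> span B" using that B(3) by blast
    show "\<psi> b = 0" if "b \<in> B" for b
      using \<psi>(2) that xB span_base[of b B] by force
  qed
  then show ?thesis using \<psi> by auto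
qed

lemma functionals_separate:
  assumes "\<And>\<psi>. functional scale \<psi> \<Longrightarrow> \<psi> x = \<psi> y"
  shows "x = y"
proof (rule ccontr)
  assume "x \<noteq> y"
  then have "x - y \<notin> span {}" by simp
  then obtain \<psi> where "functional scale \<psi>" "\<psi> (x - y) = 1" using separating_functional by blast
  then show False using assms[of \<psi>] functionalD(2)[of \<psi> x y] by simp
qed

end

section \<open>Rational functions of one variable\<close>

text \<open>Rational functions whose only pole is at 0. Matrix coefficients of a one-parameter subgroup are of this kind.\<close>

definition laurent :: "('k::field \<Rightarrow> 'k) \<Rightarrow> bool" where
  "laurent f \<longleftrightarrow> (\<exists>N P. \<forall>t. t \<noteq> 0 \<longrightarrow> t ^ N * f t = poly P t)"

lemma laurentI: "(\<And>t. t \<noteq> 0 \<Longrightarrow> t ^ N * f t = poly P t) \<Longrightarrow> laurent f"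
  unfolding laurent_def by blast

lemma laurent_const: "laurent (\<lambda>t. c)"
  by (rule laurentI[of 0 _ "[:c:]"]) simp

lemma laurent_add: "laurent f \<Longrightarrow> laurent g \<Longrightarrow> laurent (\<lambda>t. f t + g t)"
proof -
  assume "laurent f" "laurent g"
  then obtain M P N Q where *: "\<And>t. t \<noteq> 0 \<Longrightarrow> t ^ M * f t = poly P t" "\<And>t. t \<noteq> 0 \<Longrightarrow> t ^ N * g t = poly Q t"
    by (auto simp: laurent_def)
  show ?thesis
  proof (rule laurentI[of "M + N" _ "P * monom 1 N + Q * monom 1 M"])
    fix t :: 'a assume t: "t \<noteq> 0"
    show "t ^ (M + N) * (f t + g t) = poly (P * monom 1 N + Q * monom 1 M) t"
      using *[OF t] by (simp add: poly_monom algebra_simps power_add flip: *[OF t])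
  qed
qed

lemma laurent_mult: "laurent f \<Longrightarrow> laurent g \<Longrightarrow> laurent (\<lambda>t. f t * g t)"
proof -
  assume "laurent f" "laurent g"
  then obtain M P N Q where *: "\<And>t. t \<noteq> 0 \<Longrightarrow> t ^ M * f t = poly P t" "\<And>t. t \<noteq> 0 \<Longrightarrow> t ^ N * g t = poly Q t"
    by (auto simp: laurent_def)
  show ?thesis
  proof (rule laurentI[of "M + N" _ "P * Q"])
    fix t :: 'a assume t: "t \<noteq> 0"
    show "t ^ (M + N) * (f t * g t) = poly (P * Q) t"
      by (simp add: algebra_simps power_add flip: *[OF t])
  qed
qed

lemma laurent_sum: "(\<And>i. i \<in> A \<Longrightarrow> laurent (f i)) \<Longrightarrow> laurent (\<lambda>t. \<Sum>i\<in>A. f i t)"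
  by (induction A rule: infinite_finite_induct) (auto intro: laurent_const laurent_add)

lemma laurent_powi: "laurent (\<lambda>t. t powi m)"
proof (cases "m \<ge> 0")
  case True
  then show ?thesis by (intro laurentI[of 0 _ "monom 1 (nat m)"]) (simp add: poly_monom power_int_def)
next
  case False
  then show ?thesis by (intro laurentI[of "nat (- m)" _ 1]) (simp add: power_int_def flip: power_mult_distrib)
qed

text \<open>Distinct exponents would make a nonzero polynomial vanish at all nonzero elements of an infinite field.\<close>

lemma powi_eq_imp_eq:
  fixes a b :: int
  assumes "\<And>t :: 'k::alg_closed_field. t \<noteq> 0 \<Longrightarrow> t powi a = t powi b"
  shows "a = b"
proof -
  have *: "a \<le> b" if eq: "\<And>t :: 'k. t \<noteq> 0 \<Longrightarrow> t powi a = t powi b" for a b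
  proof (rule ccontr)
    assume "\<not> a \<le> b"
    then obtain k where k: "a - b = int k" "k > 0" by (metis pos_int_cases diff_gt_0_iff_gt not_le)
    have "t ^ k = 1" if "t \<noteq> 0" for t :: 'k
      using eq[OF that] that k(1) by (metis divide_self power_int_diff power_int_eq_0_iff power_int_of_nat)
    then have "poly (monom 1 k - 1) t = 0" if "t \<notin> {0}" for t :: 'k
      using that by (simp add: poly_monom)
    then have "monom 1 k - 1 = (0 :: 'k poly)" by (rule poly_eq_0_cofinite[rotated]) auto
    then have "coeff (monom 1 k - 1 :: 'k poly) k = 0" by simp
    then show False using k(2) by simp
  qed
  show ?thesis using *[of a b] *[of b a] assms by (simp add: order_antisym)
qed

lemma poly_eq_of_nonzero:
  fixes P Q :: "'k::alg_closed_field poly"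
  assumes "\<And>t. t \<noteq> 0 \<Longrightarrow> poly P t = poly Q t"
  shows "P = Q"
  using poly_eq_0_cofinite[of "{0}" "P - Q"] assms by simp

text \<open>Multiplication by \<open>t ^ degree Q\<close> turns the right-hand side into a polynomial of degree at most
  \<open>degree Q\<close>, so the degree of \<open>P\<close> is 0.\<close>

lemma poly_eq_poly_inverse:
  fixes P Q :: "'k::alg_closed_field poly"
  assumes "\<And>t. t \<noteq> 0 \<Longrightarrow> poly P t = poly Q (inverse t)"
  shows "poly P s = poly P 0"
proof -
  have "P * monom 1 (degree Q) = reflect_poly Q"
    by (rule poly_eq_of_nonzero) (simp add: assms poly_monom poly_reflect_poly_nz)
  then have "degree (P * monom 1 (degree Q)) \<le> degree Q"
    using degree_reflect_poly_le[of Q] by simp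
  then have "degree P = 0"
    by (cases "P = 0") (auto simp: degree_mult_eq degree_monom_eq)
  then obtain c where "P = [:c:]" by (metis degree_eq_zeroE)
  then show ?thesis by simp
qed

section \<open>The highest weight module\<close>


context witt_space
begin

lemma functional_expansion: "functional scaleV \<phi> \<Longrightarrow> \<phi> v = (\<Sum>i\<in>I. \<beta> v (e (d i)) * \<phi> (e i))"
  by (subst expansion[of v]) (simp add: functionalD)

lemma polynomial_function_on_curve:
  assumes "f \<in> polynomial_functions scaleV" "polycurve \<gamma>"
  shows "polyfun (\<lambda>t. f (\<gamma> t))"
  using assms(1)
proof induction
  case (coefficient \<phi> v)
  show ?case unfolding functional_expansion[OF coefficient, of "\<gamma> _ v"]
    using assms(2) by (intro polyfun_intros) (simp add: polycurve_def)
qed (auto intro: polyfun_intros)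

definition cochar :: "(nat \<Rightarrow> int) \<Rightarrow> 'k \<Rightarrow> 'v \<Rightarrow> 'v" where
  "cochar m t = tor (\<lambda>j. t powi m j)"

text \<open>The exponents for which the diagonal map preserves the form, as \<open>e i\<close> and \<open>e (d i)\<close> are dual.\<close>

definition antisym_weight :: "(nat \<Rightarrow> int) \<Rightarrow> bool" where
  "antisym_weight m \<longleftrightarrow> (\<forall>j\<in>I. m (d j) = - m j)"

lemma tor_product: "\<beta> (tor c v) (e (d i)) = c i * \<beta> v (e (d i))" if "i \<in> I"
proof -
  have "\<beta> (tor c v) (e (d i)) = (\<Sum>j\<in>I. c j * \<beta> v (e (d j)) * \<beta> (e j) (e (d i)))"
    by (simp add: tor_def bil)
  then show ?thesis using sum_gram[OF d_in[OF that], of "\<lambda>j. c j * \<beta> v (e (d j))"] that by (simp add: d_d)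
qed

lemma polynomial_function_on_cochar:
  assumes "f \<in> polynomial_functions scaleV"
  shows "laurent (\<lambda>t. f (cochar m t))"
  using assms
proof induction
  case (coefficient \<phi> v)
  have "\<phi> (cochar m t v) = (\<Sum>i\<in>I. t powi m i * (\<beta> v (e (d i)) * \<phi> (e i)))" for t
    unfolding functional_expansion[OF coefficient, of "cochar m t v"]
    by (rule sum.cong[OF refl]) (simp add: cochar_def tor_product)
  then show ?case by (auto intro!: laurent_sum laurent_mult laurent_powi laurent_const)
qed (auto intro: laurent_const laurent_add laurent_mult)

lemma cochar_params: "antisym_weight m \<Longrightarrow> t \<noteq> 0 \<Longrightarrow> (\<lambda>j. t powi m j) \<in> torus_params"
proof -
  assume m: "antisym_weight m" and t: "t \<noteq> 0"
  have "m i = 0" if "i \<in> I" "2 * i = n + 1" for i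
  proof -
    have "d i = i" using that by (simp add: d_def)
    then show ?thesis using m that(1) by (force simp: antisym_weight_def)
  qed
  then show ?thesis using m t by (simp add: torus_params_def antisym_weight_def power_int_minus)
qed

lemma cochar_G: "antisym_weight m \<Longrightarrow> t \<noteq> 0 \<Longrightarrow> cochar m t \<in> G"
  unfolding cochar_def by (intro tor_in_torus cochar_params)

lemma cochar_mult: "cochar m s \<circ> cochar m t = cochar m (s * t)"
  unfolding cochar_def tor_comp by (simp add: power_int_mult_distrib)

lemma cochar_one: "cochar m 1 = id"
  unfolding cochar_def by (rule tor_one) simp

lemma tor_commute: "tor a \<circ> tor b = tor b \<circ> tor a"
  unfolding tor_comp by (simp add: mult.commute)

end

locale highest_weight_module = witt_space scaleV \<beta> n e
  for scaleV :: "'k::alg_closed_field \<Rightarrow> 'v::ab_group_add \<Rightarrow> 'v" (infixr \<open>*s\<close> 75) and \<beta> n e +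
  fixes scaleW :: "'k \<Rightarrow> 'w::ab_group_add \<Rightarrow> 'w" (infixr \<open>*w\<close> 75) and \<rho> :: "('v \<Rightarrow> 'v) \<Rightarrow> 'w \<Rightarrow> 'w"
  assumes hw: "irreducible_highest_weight_module scaleV \<beta> n e scaleW \<rho> (\<lambda>i. 2 * fundamental_weight n 1 i)"
begin

lemma rat: "rational_representation scaleV G scaleW \<rho>"
  and irr: "irreducible_representation G scaleW \<rho>"
  and hwt: "has_highest_weight scaleV \<beta> n e scaleW \<rho> (\<lambda>i. 2 * eps 1 i)"
  using hw unfolding irreducible_highest_weight_module_def fundamental_weight_1[OF n5] by blast+

lemma fdW: "finite_dim scaleW" using rat by (simp add: rational_representation_def)

sublocale W: vector_space scaleW using fdW by (simp add: finite_dim_def)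

lemma \<rho>_linear: "g \<in> G \<Longrightarrow> Vector_Spaces.linear scaleW scaleW (\<rho> g)"
  and \<rho>_id: "\<rho> id = id"
  and \<rho>_comp: "g \<in> G \<Longrightarrow> h \<in> G \<Longrightarrow> \<rho> (g \<circ> h) = \<rho> g \<circ> \<rho> h"
  using rat by (auto simp: rational_representation_def)

lemma \<rho>_rational: "functional scaleW \<psi> \<Longrightarrow> \<exists>f\<in>polynomial_functions scaleV. \<forall>g\<in>G. \<psi> (\<rho> g w) = f g"
  using rat by (simp add: rational_representation_def)

lemma \<rho>_lin: assumes "g \<in> G" shows "\<rho> g (x + y) = \<rho> g x + \<rho> g y" "\<rho> g (c *w x) = c *w \<rho> g x" 
  "\<rho> g (sum f A) = (\<Sum>a\<in>A. \<rho> g (f a))" "\<rho> g 0 = 0"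
proof -
  interpret f: Vector_Spaces.linear scaleW scaleW "\<rho> g" by (rule \<rho>_linear[OF assms])
  show "\<rho> g (x + y) = \<rho> g x + \<rho> g y" "\<rho> g (c *w x) = c *w \<rho> g x" 
  "\<rho> g (sum f A) = (\<Sum>a\<in>A. \<rho> g (f a))" "\<rho> g 0 = 0" by (rule f.add f.scale f.sum f.zero)+
qed

lemma functional_\<rho>: "functional scaleW \<psi> \<Longrightarrow> g \<in> G \<Longrightarrow> functional scaleW (\<lambda>w. \<psi> (\<rho> g w))"
  by (rule W.functional_comp[OF _ \<rho>_linear])

lemma \<rho>_curve:
  assumes "functional scaleW \<psi>" "\<And>t. \<gamma> t \<in> G" "polycurve \<gamma>"
  shows "polyfun (\<lambda>t. \<psi> (\<rho> (\<gamma> t) w))"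
proof -
  obtain f where f: "f \<in> polynomial_functions scaleV" "\<And>g. g \<in> G \<Longrightarrow> \<psi> (\<rho> g w) = f g"
    using \<rho>_rational[OF assms(1)] by blast
  show ?thesis using polynomial_function_on_curve[OF f(1) assms(3)] f(2)[OF assms(2)] by simp
qed

subsection \<open>Weights of one-parameter subgroups\<close>

definition basisW where "basisW = (SOME bs. ordered_basis scaleW bs)"

lemma obW: "ordered_basis scaleW basisW"
  unfolding basisW_def by (rule someI_ex[OF W.finite_dim_ordered_basis[OF fdW]])

definition cf :: "nat \<Rightarrow> 'w \<Rightarrow> 'k" where "cf i w = coord scaleW basisW i w"

abbreviation r where "r \<equiv> length basisW"

lemma functional_cf: "functional scaleW (cf i)"
  using W.linear_coord[OF obW, of i] unfolding cf_def .

lemma W_expansion: "(\<Sum>i<r. cf i w *w basisW ! i) = w"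
  unfolding cf_def by (rule W.coord_expansion[OF obW])

lemma functional_W_expansion: "functional scaleW \<psi> \<Longrightarrow> \<psi> w = (\<Sum>i<r. cf i w * \<psi> (basisW ! i))"
  by (subst W_expansion[of w, symmetric]) (simp add: W.functionalD)

lemma \<rho>_expansion:
  assumes "g \<in> G" "functional scaleW \<psi>"
  shows "\<psi> (\<rho> g w) = (\<Sum>j<r. cf j w * \<psi> (\<rho> g (basisW ! j)))"
  by (rule functional_W_expansion[OF functional_\<rho>[OF assms(2,1)]])

text \<open>Only finitely many matrix entries are involved. A denominator that serves all functionals and vectors makes
  the coefficient of each power of \<open>t\<close> linear in both of them.\<close>

lemma common_denominator:
  assumes m: "antisym_weight m"
  shows "\<exists>N. \<forall>\<psi> w. functional scaleW \<psi> \<longrightarrow> (\<exists>P. \<forall>t. t \<noteq> 0 \<longrightarrow> t ^ N * \<psi> (\<rho> (cochar m t) w) = poly P t)"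
proof -
  have "laurent (\<lambda>t. cf i (\<rho> (cochar m t) (basisW ! j)))" for i j
  proof -
    obtain f where f: "f \<in> polynomial_functions scaleV" "\<And>g. g \<in> G \<Longrightarrow> cf i (\<rho> g (basisW ! j)) = f g"
      using \<rho>_rational[OF functional_cf] by blast
    obtain N P where "\<And>t. t \<noteq> 0 \<Longrightarrow> t ^ N * f (cochar m t) = poly P t"
      using polynomial_function_on_cochar[OF f(1), of m] by (auto simp: laurent_def)
    then show ?thesis using f(2)[OF cochar_G[OF m]] by (intro laurentI[of N _ P]) simp
  qed
  then obtain M Q where MQ: "\<And>i j t. t \<noteq> 0 \<Longrightarrow> t ^ M i j * cf i (\<rho> (cochar m t) (basisW ! j)) = poly (Q i j) t"
    unfolding laurent_def by metis
  define N where "N = (\<Sum>i<r. \<Sum>j<r. M i j)"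
  have MN: "M i j \<le> N" if "i < r" "j < r" for i j
  proof -
    have "M i j \<le> (\<Sum>j<r. M i j)" using that by (intro member_le_sum) auto
    also have "\<dots> \<le> N" unfolding N_def using that by (intro member_le_sum[of _ _ "\<lambda>i. \<Sum>j<r. M i j"]) auto
    finally show ?thesis .
  qed
  show ?thesis
  proof (intro exI[of _ N] allI impI)
    fix \<psi> w assume \<psi>: "functional scaleW \<psi>"
    define P where "P = (\<Sum>j<r. Polynomial.smult (cf j w) (\<Sum>i<r. Polynomial.smult (\<psi> (basisW ! i)) (monom 1 (N - M i j) * Q i j)))"
    show "\<exists>P. \<forall>t. t \<noteq> 0 \<longrightarrow> t ^ N * \<psi> (\<rho> (cochar m t) w) = poly P t"
    proof (intro exI[of _ P] allI impI)
      fix t :: 'k assume t: "t \<noteq> 0"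
      have "t ^ N * cf i (\<rho> (cochar m t) (basisW ! j)) = poly (monom 1 (N - M i j) * Q i j) t"
        if "i < r" "j < r" for i j
        using MN[OF that] by (simp add: poly_monom flip: MQ[OF t] mult.assoc power_add)
      moreover have "t ^ N * \<psi> (\<rho> (cochar m t) w) =
          (\<Sum>j<r. cf j w * (\<Sum>i<r. \<psi> (basisW ! i) * (t ^ N * cf i (\<rho> (cochar m t) (basisW ! j)))))"
        unfolding \<rho>_expansion[OF cochar_G[OF m t] \<psi>, of w]
        by (subst functional_W_expansion[OF \<psi>, of "\<rho> _ (basisW ! _)"])
           (simp add: sum_distrib_left mult_ac)
      ultimately show "t ^ N * \<psi> (\<rho> (cochar m t) w) = poly P t"
        by (simp add: P_def poly_sum)
    qed
  qed
qed

text \<open>The vector is the coefficient of a power of \<open>t\<close> in \<open>\<rho> (cochar m t) w\<close>. Comparing coefficients after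
  replacing \<open>t\<close> by \<open>s t\<close> shows that it is an eigenvector. Torus elements commute with the one-parameter subgroup and
  so act on all coefficients by the scalar by which they act on \<open>w\<close>.\<close>

lemma weight_component:
  assumes m: "antisym_weight m" and \<psi>0: "functional scaleW \<psi>0"
    and P0: "\<And>t. t \<noteq> 0 \<Longrightarrow> t ^ N0 * \<psi>0 (\<rho> (cochar m t) w) = poly P0 t" "coeff P0 k0 \<noteq> 0"
  shows "\<exists>w'. w' \<noteq> 0 \<and> (\<forall>t. t \<noteq> 0 \<longrightarrow> \<rho> (cochar m t) w' = t powi (int k0 - int N0) *w w') \<and>
     (\<forall>c\<in>torus_params. \<forall>a. \<rho> (tor c) w = a *w w \<longrightarrow> \<rho> (tor c) w' = a *w w')"
proof -
  obtain N1 where N1: "\<And>\<psi> w. functional scaleW \<psi> \<Longrightarrow> \<exists>P. \<forall>t. t \<noteq> 0 \<longrightarrow> t ^ N1 * \<psi> (\<rho> (cochar m t) w) = poly P t"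
    using common_denominator[OF m] by blast
  \<comment> \<open>The given exponent \<open>N0\<close> is tied to \<open>\<psi>0\<close> and the uniform one is \<open>N1\<close>. Their sum serves both purposes, at the price of
    shifting the index of the coefficient.\<close>
  define N where "N = N1 + N0"
  define k where "k = k0 + N1"
  have "\<exists>P. \<forall>t. t \<noteq> 0 \<longrightarrow> t ^ N * \<psi> (\<rho> (cochar m t) w) = poly P t" if \<psi>: "functional scaleW \<psi>" for \<psi>
  proof -
    obtain P where P: "\<And>t. t \<noteq> 0 \<Longrightarrow> t ^ N1 * \<psi> (\<rho> (cochar m t) w) = poly P t" using N1[OF \<psi>] by blast
    show ?thesis by (rule exI[of _ "monom 1 N0 * P"]) (simp add: N_def poly_monom power_add mult_ac flip: P)
  qed
  then obtain Pf where Pf: "\<And>\<psi> t. functional scaleW \<psi> \<Longrightarrow> t \<noteq> 0 \<Longrightarrow> t ^ N * \<psi> (\<rho> (cochar m t) w) = poly (Pf \<psi>) t"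
    by metis
  have PfI: "Pf \<psi> = P" if "functional scaleW \<psi>" "\<And>t. t \<noteq> 0 \<Longrightarrow> t ^ N * \<psi> (\<rho> (cochar m t) w) = poly P t" for \<psi> P
    by (rule poly_eq_of_nonzero) (use Pf that in metis)
  define w' where "w' = (\<Sum>i<r. coeff (Pf (cf i)) k *w basisW ! i)"
  have val: "\<psi> w' = coeff (Pf \<psi>) k" if \<psi>: "functional scaleW \<psi>" for \<psi>
  proof -
    have "Pf \<psi> = (\<Sum>i<r. Polynomial.smult (\<psi> (basisW ! i)) (Pf (cf i)))"
    proof (rule PfI[OF \<psi>])
      fix t :: 'k assume t: "t \<noteq> 0"
      show "t ^ N * \<psi> (\<rho> (cochar m t) w) = poly (\<Sum>i<r. Polynomial.smult (\<psi> (basisW ! i)) (Pf (cf i))) t"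
        by (subst functional_W_expansion[OF \<psi>])
           (simp add: sum_distrib_left poly_sum mult_ac flip: Pf[OF functional_cf t])
    qed
    then show ?thesis by (simp add: w'_def W.functionalD[OF \<psi>] coeff_sum mult.commute)
  qed
  have "Pf \<psi>0 = monom 1 N1 * P0"
    by (rule PfI[OF \<psi>0]) (simp add: N_def poly_monom power_add mult_ac flip: P0(1))
  then have "\<psi>0 w' \<noteq> 0" using P0(2) by (simp add: val[OF \<psi>0] coeff_monom_mult k_def)
  then have "w' \<noteq> 0" using W.functionalD(4)[OF \<psi>0] by auto
  moreover have "\<rho> (cochar m s) w' = s powi (int k0 - int N0) *w w'" if s: "s \<noteq> 0" for s
  proof (rule W.functionals_separate)
    fix \<psi> assume \<psi>: "functional scaleW \<psi>"
    note \<psi>' = functional_\<rho>[OF \<psi> cochar_G[OF m s]]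
    have "Pf (\<lambda>w. \<psi> (\<rho> (cochar m s) w)) = Polynomial.smult (inverse (s ^ N)) (pcompose (Pf \<psi>) [:0, s:])"
    proof (rule PfI[OF \<psi>'])
      fix t :: 'k assume t: "t \<noteq> 0"
      have "\<psi> (\<rho> (cochar m s) (\<rho> (cochar m t) w)) = \<psi> (\<rho> (cochar m (s * t)) w)"
        using \<rho>_comp[OF cochar_G[OF m s] cochar_G[OF m t]] by (simp add: cochar_mult fun_eq_iff)
      moreover have "poly (Pf \<psi>) (s * t) = (s * t) ^ N * \<psi> (\<rho> (cochar m (s * t)) w)"
        using Pf[OF \<psi>, of "s * t"] s t by simp
      ultimately show "t ^ N * \<psi> (\<rho> (cochar m s) (\<rho> (cochar m t) w))
          = poly (Polynomial.smult (inverse (s ^ N)) (pcompose (Pf \<psi>) [:0, s:])) t"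
        using s by (simp add: poly_pcompose power_mult_distrib mult.commute[of t s])
    qed
    then have "\<psi> (\<rho> (cochar m s) w') = inverse (s ^ N) * (s ^ k * \<psi> w')"
      using val[OF \<psi>'] by (simp add: val[OF \<psi>] coeff_pcompose_linear mult.commute)
    also have "\<dots> = s powi (int k0 - int N0) * \<psi> w'"
      using s by (simp add: power_int_diff k_def N_def power_add field_simps)
    finally show "\<psi> (\<rho> (cochar m s) w') = \<psi> (s powi (int k0 - int N0) *w w')"
      by (simp add: W.functionalD[OF \<psi>])
  qed
  moreover have "\<rho> (tor c) w' = a *w w'" if c: "c \<in> torus_params" and a: "\<rho> (tor c) w = a *w w" for c a
  proof (rule W.functionals_separate)
    fix \<psi> assume \<psi>: "functional scaleW \<psi>"
    have cG: "tor c \<in> G" using tor_in_torus(1)[OF c] .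
    note \<psi>' = functional_\<rho>[OF \<psi> cG]
    have "Pf (\<lambda>w. \<psi> (\<rho> (tor c) w)) = Polynomial.smult a (Pf \<psi>)"
    proof (rule PfI[OF \<psi>'])
      fix t :: 'k assume t: "t \<noteq> 0"
      have "\<rho> (tor c) (\<rho> (cochar m t) w) = \<rho> (cochar m t) (\<rho> (tor c) w)"
        using \<rho>_comp[OF cG cochar_G[OF m t]] \<rho>_comp[OF cochar_G[OF m t] cG]
          tor_commute[of c] unfolding cochar_def by (metis comp_apply)
      then show "t ^ N * \<psi> (\<rho> (tor c) (\<rho> (cochar m t) w)) = poly (Polynomial.smult a (Pf \<psi>)) t"
        by (simp add: a \<rho>_lin[OF cochar_G[OF m t]] W.functionalD[OF \<psi>] flip: Pf[OF \<psi> t])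
    qed
    then show "\<psi> (\<rho> (tor c) w') = \<psi> (a *w w')"
      using val[OF \<psi>'] by (simp add: val[OF \<psi>] W.functionalD[OF \<psi>])
  qed
  ultimately show ?thesis by blast
qed

lemma weight_component_exists:
  assumes m: "antisym_weight m" and w: "w \<noteq> 0"
  shows "\<exists>w' k. w' \<noteq> 0 \<and> (\<forall>t. t \<noteq> 0 \<longrightarrow> \<rho> (cochar m t) w' = t powi k *w w') \<and>
     (\<forall>c\<in>torus_params. \<forall>a. \<rho> (tor c) w = a *w w \<longrightarrow> \<rho> (tor c) w' = a *w w')"
proof -
  have "w \<notin> W.span {}" using w by simp
  then obtain \<psi> where \<psi>: "functional scaleW \<psi>" "\<psi> w = 1" using W.separating_functional by blast
  obtain N P where P: "\<And>t. t \<noteq> 0 \<Longrightarrow> t ^ N * \<psi> (\<rho> (cochar m t) w) = poly P t"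
    using common_denominator[OF m] \<psi>(1) by blast
  have "poly P 1 = 1" using P[of 1] \<psi>(2) by (simp add: cochar_one \<rho>_id)
  then have "P \<noteq> 0" by auto
  then have "coeff P (degree P) \<noteq> 0" by simp
  from weight_component[OF m \<psi>(1) P this] show ?thesis by blast
qed


subsection \<open>A bound for the weights\<close>

text \<open>The weight \<open>n + 1 - 2 j\<close> is strictly decreasing in \<open>j\<close> and changes sign at the middle, so this one-parameter subgroup is positive on all
  positive roots and singles out the highest weight.\<close>

definition wt :: "nat \<Rightarrow> int" where "wt j = int n + 1 - 2 * int j"

definition lam :: "'k \<Rightarrow> 'v \<Rightarrow> 'v" where "lam = cochar wt"

definition single :: "nat \<Rightarrow> nat \<Rightarrow> int" where
  "single i j = (if j = i then 1 else if j = d i then - 1 else 0)"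

lemma antisym_wt: "antisym_weight wt"
  by (auto simp: antisym_weight_def wt_def I_def d_def of_nat_diff)

lemma antisym_single: "i \<in> I \<Longrightarrow> 2 * i < n + 1 \<Longrightarrow> antisym_weight (single i)"
  unfolding antisym_weight_def
proof
  fix j assume "i \<in> I" "2 * i < n + 1" "j \<in> I"
  then show "single i (d j) = - single i j"
    using d_eq[of j i] d_inj[of j i] by (auto simp: single_def d_d) (auto simp: d_def)
qed

text \<open>Apply the one-parameter subgroups of the coordinates one after the other. They commute, so the eigenvalues
  obtained earlier persist.\<close>

lemma joint_weight_vector:
  assumes w: "w \<noteq> 0" and lamw: "\<And>t. t \<noteq> 0 \<Longrightarrow> \<rho> (lam t) w = t powi k *w w" and i: "2 * i < n + 1"
  shows "\<exists>w' \<mu>. w' \<noteq> 0 \<and> (\<forall>t. t \<noteq> 0 \<longrightarrow> \<rho> (lam t) w' = t powi k *w w') \<and>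
    (\<forall>j\<in>{1..i}. \<forall>t. t \<noteq> 0 \<longrightarrow> \<rho> (cochar (single j) t) w' = t powi (\<mu> j) *w w')"
  using i
proof (induction i)
  case 0
  then show ?case using w lamw by auto
next
  case (Suc i)
  then obtain w1 \<mu> where w1: "w1 \<noteq> 0" "\<And>t. t \<noteq> 0 \<Longrightarrow> \<rho> (lam t) w1 = t powi k *w w1"
    "\<And>j t. j \<in> {1..i} \<Longrightarrow> t \<noteq> 0 \<Longrightarrow> \<rho> (cochar (single j) t) w1 = t powi (\<mu> j) *w w1"
    by auto
  have SI: "Suc i \<in> I" using Suc.prems by (simp add: I_def)
  note as = antisym_single[OF SI Suc.prems]
  obtain w' l where w': "w' \<noteq> 0" "\<And>t. t \<noteq> 0 \<Longrightarrow> \<rho> (cochar (single (Suc i)) t) w' = t powi l *w w'"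
    "\<And>c a. c \<in> torus_params \<Longrightarrow> \<rho> (tor c) w1 = a *w w1 \<Longrightarrow> \<rho> (tor c) w' = a *w w'"
    using weight_component_exists[OF as w1(1)] by blast
  have "\<rho> (lam t) w' = t powi k *w w'" if "t \<noteq> 0" for t
    using w'(3)[OF cochar_params[OF antisym_wt that]] w1(2)[OF that] by (simp add: lam_def cochar_def)
  moreover have "\<rho> (cochar (single j) t) w' = t powi ((\<mu>(Suc i := l)) j) *w w'" if "j \<in> {1..Suc i}" "t \<noteq> 0" for j t
  proof (cases "j = Suc i")
    case True then show ?thesis using w'(2) that by simp
  next
    case False
    then have j: "j \<in> {1..i}" using that by auto
    have "antisym_weight (single j)" using j Suc.prems by (intro antisym_single) (auto simp: I_def)
    then show ?thesis using w'(3)[OF cochar_params[OF _ that(2)]] w1(3)[OF j that(2)] False by (simp add: cochar_def)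
  qed
  ultimately show ?case using w'(1) by blast
qed

abbreviation l where "l \<equiv> n div 2"

lemma torus_coordinate_tor: "i \<in> I \<Longrightarrow> torus_coordinate scaleV e i (tor c) = c i"
proof -
  assume i: "i \<in> I"
  have "e i \<noteq> 0" using gram[OF i d_in[OF i]] by (auto simp: bil)
  then show ?thesis unfolding torus_coordinate_def using i by (simp add: tor_e)
qed

lemma character_tor: "character scaleV n e \<mu> (tor c) = (\<Prod>i\<in>{1..l}. c i powi \<mu> i)"
  unfolding character_def by (rule prod.cong) (auto simp: torus_coordinate_tor I_def)

text \<open>The torus is the product of the one-parameter subgroups of the coordinates. The vectors \<open>pc i\<close> are the
  partial products.\<close>

lemma weight_space_of_singles:
  assumes "\<And>j t. j \<in> {1..l} \<Longrightarrow> t \<noteq> 0 \<Longrightarrow> \<rho> (cochar (single j) t) w = t powi (\<mu> j) *w w"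
  shows "w \<in> weight_space scaleV \<beta> n e scaleW \<rho> \<mu>"
  unfolding weight_space_def
proof (intro CollectI ballI)
  fix h assume "h \<in> torus scaleV \<beta> n e"
  then obtain c where c: "c \<in> torus_params" "h = tor c" using torus_eq_tor by blast
  define pc where "pc i j = (if min j (d j) \<le> i then c j else 1)" for i j
  have cn: "c j \<noteq> 0" "c j * c (d j) = 1" if "j \<in> I" for j using c that by (auto simp: torus_params_def)
  have pcp: "pc i \<in> torus_params" for i
    using c(1) d_d by (auto simp: torus_params_def pc_def min.commute)
  have partial: "\<rho> (tor (pc i)) w = (\<Prod>j\<in>{1..i}. c j powi \<mu> j) *w w" if "i \<le> l" for i
    using that
  proof (induction i)
    case 0
    have *: "tor (pc 0) = id" by (rule tor_one) (auto simp: pc_def I_def d_def)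
    show ?case unfolding * \<rho>_id by simp
  next
    case (Suc i)
    have SI: "Suc i \<in> I" "2 * Suc i < n + 1" using Suc.prems by (auto simp: I_def)
    have as: "antisym_weight (single (Suc i))" by (rule antisym_single[OF SI])
    have "tor (pc (Suc i)) = tor (pc i) \<circ> cochar (single (Suc i)) (c (Suc i))"
      unfolding cochar_def tor_comp
    proof (rule tor_cong)
      fix j assume j: "j \<in> I"
      have c': "inverse (c (Suc i)) = c (d (Suc i))" using cn(2)[OF SI(1)] by (rule inverse_unique)
      consider "j = Suc i" | "j = d (Suc i)" | "j \<noteq> Suc i" "j \<noteq> d (Suc i)" by blast
      then show "pc (Suc i) j = pc i j * c (Suc i) powi single (Suc i) j"
      proof cases
        case 1
        then show ?thesis using SI by (auto simp: pc_def single_def d_def)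
      next
        case 2
        then show ?thesis using SI c' d_d[OF SI(1)] by (auto simp: pc_def single_def) (auto simp: d_def)
      next
        case 3
        then have "min j (d j) \<le> Suc i \<longleftrightarrow> min j (d j) \<le> i" using j SI by (auto simp: d_def I_def)
        then show ?thesis using 3 by (simp add: pc_def single_def)
      qed
    qed
    then have "\<rho> (tor (pc (Suc i))) w = \<rho> (tor (pc i)) (\<rho> (cochar (single (Suc i)) (c (Suc i))) w)"
      using \<rho>_comp[OF tor_in_torus(1)[OF pcp] cochar_G[OF as cn(1)[OF SI(1)]]] by simp
    also have "\<dots> = \<rho> (tor (pc i)) (c (Suc i) powi \<mu> (Suc i) *w w)"
      using assms[of "Suc i" "c (Suc i)"] Suc.prems cn(1)[OF SI(1)] by simp
    also have "\<dots> = (\<Prod>j\<in>{1..Suc i}. c j powi \<mu> j) *w w"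
      using Suc by (simp add: \<rho>_lin[OF tor_in_torus(1)[OF pcp]])
    finally show ?case .
  qed
  have "tor (pc l) = h" unfolding c(2)
  proof (rule tor_cong)
    fix j assume j: "j \<in> I"
    then have "2 * j = n + 1" if "\<not> min j (d j) \<le> l" using that by (auto simp: d_def I_def)
    then show "pc l j = c j" using j c(1) by (auto simp: pc_def torus_params_def)
  qed
  then show "\<rho> h w = character scaleV n e \<mu> h *w w"
    using partial[of l] character_tor[of \<mu> c] c(2) by simp
qed

lemma pairing_simple_root:
  assumes "i \<in> {1..l}"
  shows "(\<Sum>j\<in>{1..l}. wt j * simple_root n i j) \<ge> 0"
proof -
  have l2: "l \<ge> 2" and l3: "even n \<Longrightarrow> l \<ge> 3" using n5 by auto
  have se: "(\<Sum>j\<in>{1..l}. wt j * eps i j) = wt i" if "1 \<le> i" "i \<le> l" for i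
    using that by (simp add: eps_def if_distrib cong: if_cong)
  consider "i < l" | "i = l" "odd n" | "i = l" "even n" using assms by force
  then show ?thesis
  proof cases
    case 1
    then show ?thesis using assms se[of i] se[of "Suc i"]
      by (simp add: simple_root_def Let_def right_diff_distrib sum_subtractf wt_def)
  next
    case 2
    then show ?thesis using assms se[of l] by (simp add: simple_root_def Let_def wt_def)
  next
    case 3
    then show ?thesis using se[of l] se[of "l - 1"] l3
      by (simp add: simple_root_def Let_def distrib_left sum.distrib wt_def)
  qed
qed

text \<open>The eigenvector can be refined to a weight vector of the whole torus, and its weight is at most \<open>2 \<epsilon>\<^sub>1\<close> by
  assumption. The simple roots pair nonnegatively with \<open>wt\<close>, and \<open>2 \<epsilon>\<^sub>1\<close> pairs to \<open>2 (n - 1)\<close>.\<close>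

lemma lam_weight_le:
  assumes w: "w \<noteq> 0" and lamw: "\<And>t. t \<noteq> 0 \<Longrightarrow> \<rho> (lam t) w = t powi k *w w"
  shows "k \<le> 2 * (int n - 1)"
proof -
  have l1: "1 \<in> {1..l}" "2 * l < n + 1" using n5 by auto
  obtain w' \<mu>' where w': "w' \<noteq> 0" "\<And>t. t \<noteq> 0 \<Longrightarrow> \<rho> (lam t) w' = t powi k *w w'"
    "\<And>j t. j \<in> {1..l} \<Longrightarrow> t \<noteq> 0 \<Longrightarrow> \<rho> (cochar (single j) t) w' = t powi (\<mu>' j) *w w'"
    using joint_weight_vector[OF w lamw l1(2)] by blast
  define \<mu> where "\<mu> j = (if j \<in> {1..l} then \<mu>' j else 0)" for j
  have ws: "w' \<in> weight_space scaleV \<beta> n e scaleW \<rho> \<mu>"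
    by (rule weight_space_of_singles) (simp add: w'(3) \<mu>_def)
  have "\<mu> \<in> weights n" by (auto simp: weights_def \<mu>_def)
  then have "weight_le n \<mu> (\<lambda>i. 2 * eps 1 i)"
    using hwt ws w'(1) unfolding has_highest_weight_def by blast
  then obtain c :: "nat \<Rightarrow> nat" where c: "\<And>j. 2 * eps 1 j - \<mu> j = (\<Sum>i\<in>{1..l}. int (c i) * simple_root n i j)"
    unfolding weight_le_def by blast
  have "(\<Sum>j\<in>{1..l}. wt j * (2 * eps 1 j - \<mu> j)) = (\<Sum>j\<in>{1..l}. \<Sum>i\<in>{1..l}. int (c i) * (wt j * simple_root n i j))"
    unfolding c sum_distrib_left by (intro sum.cong refl) (simp add: mult_ac)
  also have "\<dots> = (\<Sum>i\<in>{1..l}. int (c i) * (\<Sum>j\<in>{1..l}. wt j * simple_root n i j))"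
    by (subst sum.swap) (simp add: sum_distrib_left)
  also have "\<dots> \<ge> 0" by (rule sum_nonneg, rule mult_nonneg_nonneg) (simp, rule pairing_simple_root)
  finally have "(\<Sum>j\<in>{1..l}. wt j * \<mu> j) \<le> (\<Sum>j\<in>{1..l}. wt j * (2 * eps 1 j))"
    by (simp add: right_diff_distrib sum_subtractf)
  also have "(\<Sum>j\<in>{1..l}. wt j * (2 * eps 1 j)) = 2 * wt 1"
  proof -
    have "(\<Sum>j\<in>{1..l}. wt j * (2 * eps 1 j)) = (\<Sum>j\<in>{1..l}. if j = 1 then 2 * wt 1 else 0)"
      by (rule sum.cong) (auto simp: eps_def)
    then show ?thesis using l1 by simp
  qed
  also have "\<dots> = 2 * (int n - 1)" by (simp add: wt_def)
  finally have le: "(\<Sum>j\<in>{1..l}. wt j * \<mu> j) \<le> 2 * (int n - 1)" .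
  have "k = (\<Sum>j\<in>{1..l}. wt j * \<mu> j)"
  proof (rule powi_eq_imp_eq)
    fix t :: 'k assume t: "t \<noteq> 0"
    have "lam t \<in> torus scaleV \<beta> n e"
      unfolding lam_def cochar_def by (rule tor_in_torus(2)[OF cochar_params[OF antisym_wt t]])
    then have "\<rho> (lam t) w' = character scaleV n e \<mu> (lam t) *w w'"
      using ws by (simp add: weight_space_def)
    then have "t powi k = character scaleV n e \<mu> (lam t)"
      using w'(1) w'(2)[OF t] W.scale_cancel_right by metis
    also have "\<dots> = (\<Prod>j\<in>{1..l}. t powi (wt j * \<mu> j))"
      unfolding lam_def cochar_def character_tor by (simp add: power_int_mult)
    also have "\<dots> = t powi (\<Sum>j\<in>{1..l}. wt j * \<mu> j)"
    proof -
      have "(\<Prod>j\<in>A. t powi (wt j * \<mu> j)) = t powi (\<Sum>j\<in>A. wt j * \<mu> j)" if "finite A" for A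
        using that t by (induction A rule: finite_induct) (auto simp: power_int_add)
      then show ?thesis by simp
    qed
    finally show "t powi k = t powi (\<Sum>j\<in>{1..l}. wt j * \<mu> j)" .
  qed
  then show ?thesis using le by simp
qed

definition top_wt :: nat where "top_wt = 2 * (n - 1)"

lemma lam_G: "t \<noteq> 0 \<Longrightarrow> lam t \<in> G" unfolding lam_def by (rule cochar_G[OF antisym_wt])

lemma lam_inverse: "t \<noteq> 0 \<Longrightarrow> lam t \<circ> lam (inverse t) = id" "t \<noteq> 0 \<Longrightarrow> lam (inverse t) \<circ> lam t = id"
  by (simp_all add: lam_def cochar_mult cochar_one)

text \<open>A coefficient of a power of \<open>t\<close> above the bound would give an eigenvector of too large a weight, so that no
  negative power of \<open>s = 1 / t\<close> remains after multiplication by \<open>s ^ top_wt\<close>.\<close>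

lemma bounded_weights:
  assumes \<psi>: "functional scaleW \<psi>"
  shows "\<exists>Q. \<forall>s. s \<noteq> 0 \<longrightarrow> s ^ top_wt * \<psi> (\<rho> (lam (inverse s)) w) = poly Q s"
proof -
  obtain N P where P: "\<And>t. t \<noteq> 0 \<Longrightarrow> t ^ N * \<psi> (\<rho> (cochar wt t) w) = poly P t"
    using common_denominator[OF antisym_wt] \<psi> by blast
  have bound: "k \<le> top_wt + N" if ck: "coeff P k \<noteq> 0" for k
  proof -
    obtain w' where "w' \<noteq> 0" "\<And>t. t \<noteq> 0 \<Longrightarrow> \<rho> (lam t) w' = t powi (int k - int N) *w w'"
      using weight_component[OF antisym_wt \<psi> P ck] by (auto simp: lam_def)
    then have "int k - int N \<le> 2 * (int n - 1)" by (rule lam_weight_le)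
    then show ?thesis using n5 by (simp add: top_wt_def)
  qed
  define Q where "Q = (\<Sum>k\<le>degree P. monom (coeff P k) (top_wt + N - k))"
  show ?thesis
  proof (intro exI[of _ Q] allI impI)
    fix s :: 'k assume s: "s \<noteq> 0"
    have "inverse s ^ N * \<psi> (\<rho> (lam (inverse s)) w) = (\<Sum>k\<le>degree P. coeff P k * inverse s ^ k)"
      using P[of "inverse s"] s by (simp add: lam_def poly_altdef)
    then have "\<psi> (\<rho> (lam (inverse s)) w) = s ^ N * (\<Sum>k\<le>degree P. coeff P k * inverse s ^ k)"
      using s by (simp add: field_simps)
    then have "s ^ top_wt * \<psi> (\<rho> (lam (inverse s)) w) = (\<Sum>k\<le>degree P. coeff P k * (s ^ (top_wt + N) * inverse s ^ k))"
      by (simp add: sum_distrib_left power_add mult_ac)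
    also have "\<dots> = (\<Sum>k\<le>degree P. coeff P k * s ^ (top_wt + N - k))"
    proof (rule sum.cong[OF refl])
      fix k
      show "coeff P k * (s ^ (top_wt + N) * inverse s ^ k) = coeff P k * s ^ (top_wt + N - k)"
        using bound[of k] s by (cases "coeff P k = 0") (auto simp: power_diff power_inverse field_simps)
    qed
    also have "\<dots> = poly Q s" by (simp add: Q_def poly_sum poly_monom)
    finally show "s ^ top_wt * \<psi> (\<rho> (lam (inverse s)) w) = poly Q s" .
  qed
qed

definition topoly :: "('w \<Rightarrow> 'k) \<Rightarrow> 'w \<Rightarrow> 'k poly" where
  "topoly \<psi> w = (SOME Q. \<forall>s. s \<noteq> 0 \<longrightarrow> s ^ top_wt * \<psi> (\<rho> (lam (inverse s)) w) = poly Q s)"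

lemma topoly: "functional scaleW \<psi> \<Longrightarrow> s \<noteq> 0 \<Longrightarrow> s ^ top_wt * \<psi> (\<rho> (lam (inverse s)) w) = poly (topoly \<psi> w) s"
  using someI_ex[OF bounded_weights[of \<psi> w]] unfolding topoly_def by blast

lemma topoly_eqI:
  assumes "functional scaleW \<psi>" "\<And>s. s \<noteq> 0 \<Longrightarrow> s ^ top_wt * \<psi> (\<rho> (lam (inverse s)) w) = poly Q s"
  shows "topoly \<psi> w = Q"
  by (rule poly_eq_of_nonzero) (use assms topoly in metis)

subsection \<open>Contraction of unipotent elements\<close>

lemma tor_cong_inner:
  assumes "x \<in> inner i" "\<And>j. j \<in> I \<Longrightarrow> j \<notin> outside i \<Longrightarrow> a j = b j"
  shows "tor a x = tor b x"
  unfolding tor_def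
proof (rule sum.cong[OF refl])
  fix j assume j: "j \<in> I"
  show "(a j * \<beta> x (e (d j))) *s e j = (b j * \<beta> x (e (d j))) *s e j"
  proof (cases "j \<in> outside i")
    case True
    then have "d j \<in> outside i" using j by (auto simp: outside_def I_def d_def)
    then show ?thesis using innerD[OF assms(1)] by simp
  qed (use assms(2) j in simp)
qed

lemma tor_inner: "x \<in> inner i \<Longrightarrow> tor a x \<in> inner i"
proof -
  assume x: "x \<in> inner i"
  have "\<beta> (tor a x) (e j) = 0" if "j \<in> outside i" for j
  proof -
    have "j \<in> I" using that by (simp add: outside_def)
    then show ?thesis using tor_product[of "d j" a x] innerD[OF x that] by (simp add: d_in d_d)
  qed
  then show ?thesis by (simp add: inner_def)
qed

lemma tor_scale: "c *s tor a x = tor (\<lambda>j. c * a j) x"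
  by (simp add: tor_def scale_sum_right mult.assoc)

text \<open>A curve joining a root element to the identity. At nonzero parameters it is conjugation by the one-parameter
  subgroup \<open>lam\<close>, see the next two lemmas. The exponents are positive where \<open>x\<close> has components, which is why
  the curve extends to the parameter 0.\<close>

lemma contracting_curve:
  assumes "2 * i < n + 1" "i \<in> I" "x \<in> inner i" "a = e i \<or> a = e (d i)" "\<And>j. j \<in> I \<Longrightarrow> j \<notin> outside i \<Longrightarrow> m j > 0"
  defines "\<gamma> \<equiv> \<lambda>t. eichler a (tor (\<lambda>j. t ^ m j) x)"
  shows "\<gamma> t \<in> G" "polycurve \<gamma>" "\<gamma> 0 = id"
proof -
  show "\<gamma> t \<in> G" unfolding \<gamma>_def using inner_eichler_G[OF assms(1,2) tor_inner[OF assms(3)]] assms(4) by blast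
  have "polycurve (\<lambda>t. eichler a (tor (\<lambda>j. t ^ m j) x) \<circ> id)"
    by (rule polycurve_eichler) (simp add: tor_def bil, intro polyfun_intros)
  then show "polycurve \<gamma>" by (simp add: \<gamma>_def)
  have "tor (\<lambda>j. 0 ^ m j) x = tor (\<lambda>j. 0) x"
    by (rule tor_cong_inner[OF assms(3)]) (use assms(5) in simp)
  then show "\<gamma> 0 = id" by (simp add: \<gamma>_def tor_def eichler_0)
qed

lemma lam_isometry: "t \<noteq> 0 \<Longrightarrow> isometry (lam t)" using lam_G G_isometry by blast

lemma conj_raising:
  assumes "2 * i < n + 1" "i \<in> I" "x \<in> inner i" "t \<noteq> 0"
  shows "lam t \<circ> eichler (e i) x = eichler (e i) (tor (\<lambda>j. t ^ (2 * (d i - j))) x) \<circ> lam t"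
proof -
  have "lam t (e i) = t powi wt i *s e i" unfolding lam_def cochar_def using assms by (simp add: tor_e)
  moreover have "t powi wt i *s lam t x = tor (\<lambda>j. t ^ (2 * (d i - j))) x"
    unfolding lam_def cochar_def tor_scale
  proof (rule tor_cong_inner[OF assms(3)])
    fix j assume "j \<in> I" "j \<notin> outside i"
    then have "wt i + wt j = int (2 * (d i - j))"
      using assms(2) by (auto simp: wt_def d_def I_def outside_def)
    then show "t powi wt i * t powi wt j = t ^ (2 * (d i - j))"
      using assms(4) by (metis power_int_add power_int_of_nat)
  qed
  ultimately show ?thesis using eichler_conj[OF lam_isometry[OF assms(4)], of "e i" x] by (simp add: eichler_scale)
qed

lemma conj_lowering:
  assumes "2 * i < n + 1" "i \<in> I" "x \<in> inner i" "s \<noteq> 0"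
  shows "lam (inverse s) \<circ> eichler (e (d i)) x = eichler (e (d i)) (tor (\<lambda>j. s ^ (2 * (j - i))) x) \<circ> lam (inverse s)"
proof -
  have "wt (d i) = - wt i" using antisym_wt assms(2) by (simp add: antisym_weight_def)
  then have "lam (inverse s) (e (d i)) = s powi wt i *s e (d i)"
    unfolding lam_def cochar_def using assms d_in by (simp add: tor_e power_int_minus power_int_inverse)
  moreover have "s powi wt i *s lam (inverse s) x = tor (\<lambda>j. s ^ (2 * (j - i))) x"
    unfolding lam_def cochar_def tor_scale
  proof (rule tor_cong_inner[OF assms(3)])
    fix j assume "j \<in> I" "j \<notin> outside i"
    then have "wt i - wt j = int (2 * (j - i))"
      using assms(2) by (auto simp: wt_def d_def I_def outside_def)
    then have "s powi (wt i - wt j) = s ^ (2 * (j - i))" by (metis power_int_of_nat)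
    then show "s powi wt i * inverse s powi wt j = s ^ (2 * (j - i))"
      using assms(4) by (simp add: power_int_diff power_int_inverse divide_inverse)
  qed
  ultimately show ?thesis using eichler_conj[of "lam (inverse s)" "e (d i)" x] lam_isometry[of "inverse s"] assms(4)
    by (simp add: eichler_scale)
qed

definition wplus where "wplus = (SOME w. w \<noteq> 0 \<and> w \<in> weight_space scaleV \<beta> n e scaleW \<rho> (\<lambda>i. 2 * eps 1 i))"

lemma wplus_nonzero: "wplus \<noteq> 0" and wplus_torus: "c \<in> torus_params \<Longrightarrow> \<rho> (tor c) wplus = c 1 ^ 2 *w wplus"
proof -
  let ?U = "weight_space scaleV \<beta> n e scaleW \<rho> (\<lambda>i. 2 * eps 1 i)"
  have "0 \<in> ?U" using \<rho>_lin(4) by (auto simp: weight_space_def torus_def)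
  moreover have "?U \<noteq> {0}" using hwt by (simp add: has_highest_weight_def)
  ultimately have "\<exists>w. w \<noteq> 0 \<and> w \<in> ?U" by blast
  then have w: "wplus \<noteq> 0" "wplus \<in> ?U" unfolding wplus_def by (metis (mono_tags, lifting) someI_ex)+
  show "wplus \<noteq> 0" by fact
  assume c: "c \<in> torus_params"
  have "(\<Prod>i\<in>{1..l}. c i powi (2 * eps 1 i)) = (\<Prod>i\<in>{1..l}. if i = 1 then c 1 ^ 2 else 1)"
    by (rule prod.cong) (auto simp: eps_def)
  also have "\<dots> = c 1 ^ 2" using n5 by simp
  finally show "\<rho> (tor c) wplus = c 1 ^ 2 *w wplus"
    using w(2) tor_in_torus(2)[OF c] by (simp add: weight_space_def character_tor)
qed

lemma lam_wplus: "s \<noteq> 0 \<Longrightarrow> \<rho> (lam (inverse s)) wplus = inverse (s ^ top_wt) *w wplus"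
proof -
  assume s: "s \<noteq> 0"
  have "wt 1 = int (n - 1)" using n5 by (simp add: wt_def)
  then have "(inverse s powi wt 1) ^ 2 = inverse (s ^ top_wt)"
    by (simp add: top_wt_def power_inverse power_mult mult.commute[of 2])
  then show ?thesis
    using wplus_torus[OF cochar_params[OF antisym_wt, of "inverse s"]] s by (simp add: lam_def cochar_def)
qed

text \<open>Conjugation by \<open>lam t\<close> contracts a positive root element to the identity as \<open>t \<rightarrow> 0\<close>, so the
  coordinates of the image of \<open>wplus\<close> under the conjugate are polynomial in \<open>t\<close>. As \<open>wplus\<close> has the highest weight, they are
  polynomial in \<open>1 / t\<close> as well and therefore constant.\<close>

lemma raising_fixes_wplus:
  assumes i: "2 * i < n + 1" "i \<in> I" and x: "x \<in> inner i"
  shows "\<rho> (eichler (e i) x) wplus = wplus"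
proof (rule W.functionals_separate)
  fix \<psi> assume \<psi>: "functional scaleW \<psi>"
  define \<gamma> where "\<gamma> t = eichler (e i) (tor (\<lambda>j. t ^ (2 * (d i - j))) x)" for t
  have pos: "2 * (d i - j) > 0" if "j \<in> I" "j \<notin> outside i" for j
    using that i by (auto simp: outside_def I_def d_def)
  note \<gamma> = contracting_curve[OF i x disjI1[OF refl], of "\<lambda>j. 2 * (d i - j)", OF pos, folded \<gamma>_def]
  have EG: "eichler (e i) x \<in> G" using inner_eichler_G[OF i x] by blast
  obtain P where P: "\<And>t. \<psi> (\<rho> (\<gamma> t) wplus) = poly P t"
    using \<rho>_curve[of \<psi> \<gamma>, OF \<psi> \<gamma>(1,2)] by (auto simp: polyfun_def)
  let ?Q = "topoly \<psi> (\<rho> (eichler (e i) x) wplus)"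
  have "poly P t = poly ?Q (inverse t)" if t: "t \<noteq> 0" for t
  proof -
    let ?s = "inverse t"
    have s: "?s \<noteq> 0" using t by simp
    have "\<gamma> t = \<gamma> t \<circ> (lam t \<circ> lam ?s)" using lam_inverse(1)[OF t] by simp
    also have "\<dots> = lam t \<circ> eichler (e i) x \<circ> lam ?s"
      unfolding \<gamma>_def conj_raising[OF i x t] by (simp add: o_assoc)
    finally have "\<rho> (\<gamma> t) wplus = \<rho> (lam t) (\<rho> (eichler (e i) x) (\<rho> (lam ?s) wplus))"
      using \<rho>_comp[OF G_comp[OF lam_G[OF t] EG] lam_G[OF s]] \<rho>_comp[OF lam_G[OF t] EG] by simp
    also have "\<dots> = ?s ^ top_wt *w \<rho> (lam (inverse ?s)) (\<rho> (eichler (e i) x) wplus)"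
      using t by (simp add: lam_wplus \<rho>_lin[OF EG] \<rho>_lin[OF lam_G[OF t]] power_inverse)
    finally show ?thesis using topoly[OF \<psi> s] by (simp add: W.functionalD[OF \<psi>] flip: P)
  qed
  then have "poly P 1 = poly P 0" by (rule poly_eq_poly_inverse)
  moreover have "\<gamma> 1 = eichler (e i) x" by (simp add: \<gamma>_def tor_one)
  ultimately show "\<psi> (\<rho> (eichler (e i) x) wplus) = \<psi> wplus"
    using \<gamma>(3) by (simp add: \<rho>_id flip: P)
qed

definition \<xi>0 where "\<xi>0 = (SOME \<psi>. functional scaleW \<psi> \<and> \<psi> wplus = 1)"

lemma \<xi>0: "functional scaleW \<xi>0" "\<xi>0 wplus = 1"
proof -
  have "wplus \<notin> W.span {}" using wplus_nonzero by simp
  then have "\<exists>\<psi>. functional scaleW \<psi> \<and> \<psi> wplus = 1" using W.separating_functional by blast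
  from someI_ex[OF this] show "functional scaleW \<xi>0" "\<xi>0 wplus = 1" unfolding \<xi>0_def by blast+
qed

text \<open>The coefficient of the highest possible power of \<open>t\<close> in \<open>\<xi>0 (\<rho> (lam t) w)\<close>, written in terms of \<open>s = 1 / t\<close>. In
  other words, the functional \<open>\<xi>0\<close> is applied to the component of highest weight.\<close>

definition \<xi> where "\<xi> w = poly (topoly \<xi>0 w) 0"

lemma \<xi>_functional: "functional scaleW \<xi>"
proof (rule W.functionalI)
  have G': "lam (inverse s) \<in> G" if "s \<noteq> 0" for s using lam_G[of "inverse s"] that by simp
  note F = W.functionalD[OF \<xi>0(1)]
  fix x y c
  have "topoly \<xi>0 (x + y) = topoly \<xi>0 x + topoly \<xi>0 y"
    by (rule topoly_eqI[OF \<xi>0(1)]) (simp add: \<rho>_lin[OF G'] F distrib_left flip: topoly[OF \<xi>0(1)])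
  then show "\<xi> (x + y) = \<xi> x + \<xi> y" by (simp add: \<xi>_def)
  have "topoly \<xi>0 (c *w x) = Polynomial.smult c (topoly \<xi>0 x)"
    by (rule topoly_eqI[OF \<xi>0(1)]) (simp add: \<rho>_lin[OF G'] F flip: topoly[OF \<xi>0(1)])
  then show "\<xi> (c *w x) = c * \<xi> x" by (simp add: \<xi>_def)
qed

lemma \<xi>_wplus: "\<xi> wplus = 1"
proof -
  have "topoly \<xi>0 wplus = 1"
    by (rule topoly_eqI[OF \<xi>0(1)]) (simp add: lam_wplus W.functionalD[OF \<xi>0(1)] \<xi>0(2))
  then show ?thesis by (simp add: \<xi>_def)
qed

text \<open>Conjugation by \<open>lam (1 / s)\<close> contracts a negative root element to the identity as \<open>s \<rightarrow> 0\<close>, and \<open>\<xi>\<close> is a value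
  at \<open>s = 0\<close>.\<close>

lemma \<xi>_lowering_invariant:
  assumes i: "2 * i < n + 1" "i \<in> I" and x: "x \<in> inner i"
  shows "\<xi> (\<rho> (eichler (e (d i)) x) w) = \<xi> w"
proof -
  define \<gamma> where "\<gamma> t = eichler (e (d i)) (tor (\<lambda>j. t ^ (2 * (j - i))) x)" for t
  have pos: "2 * (j - i) > 0" if "j \<in> I" "j \<notin> outside i" for j
    using that i by (auto simp: outside_def I_def d_def)
  note \<gamma> = contracting_curve[OF i x disjI2[OF refl], of "\<lambda>j. 2 * (j - i)", OF pos, folded \<gamma>_def]
  have EG: "eichler (e (d i)) x \<in> G" using inner_eichler_G[OF i x] by blast
  have "polyfun (\<lambda>t. \<xi>0 (\<rho> (\<gamma> t) b))" for b by (rule \<rho>_curve[of \<xi>0 \<gamma>, OF \<xi>0(1) \<gamma>(1,2)])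
  then obtain B where B: "\<And>b t. \<xi>0 (\<rho> (\<gamma> t) b) = poly (B b) t" unfolding polyfun_def by metis
  define Q where "Q = (\<Sum>j<r. topoly (cf j) w * B (basisW ! j))"
  have "topoly \<xi>0 (\<rho> (eichler (e (d i)) x) w) = Q"
  proof (rule topoly_eqI[OF \<xi>0(1)])
    fix s :: 'k assume s: "s \<noteq> 0"
    have sG: "lam (inverse s) \<in> G" using s lam_G[of "inverse s"] by simp
    have "\<rho> (lam (inverse s)) (\<rho> (eichler (e (d i)) x) w) = \<rho> (lam (inverse s) \<circ> eichler (e (d i)) x) w"
      by (simp add: \<rho>_comp[OF sG EG])
    also have "\<dots> = \<rho> (\<gamma> s) (\<rho> (lam (inverse s)) w)"
      unfolding conj_lowering[OF i x s] by (simp add: \<rho>_comp[OF \<gamma>(1) sG, unfolded \<gamma>_def] \<gamma>_def)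
    finally have "s ^ top_wt * \<xi>0 (\<rho> (lam (inverse s)) (\<rho> (eichler (e (d i)) x) w))
        = (\<Sum>j<r. (s ^ top_wt * cf j (\<rho> (lam (inverse s)) w)) * \<xi>0 (\<rho> (\<gamma> s) (basisW ! j)))"
      by (simp add: \<rho>_expansion[OF \<gamma>(1) \<xi>0(1), of s "\<rho> _ w"] sum_distrib_left mult.assoc)
    also have "\<dots> = poly Q s"
      by (simp add: Q_def poly_sum B topoly[OF functional_cf s])
    finally show "s ^ top_wt * \<xi>0 (\<rho> (lam (inverse s)) (\<rho> (eichler (e (d i)) x) w)) = poly Q s" .
  qed
  then have "\<xi> (\<rho> (eichler (e (d i)) x) w) = (\<Sum>j<r. poly (topoly (cf j) w) 0 * \<xi>0 (basisW ! j))"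
    using \<gamma>(3) by (simp add: \<xi>_def Q_def poly_sum \<rho>_id flip: B)
  also have "topoly \<xi>0 w = (\<Sum>j<r. Polynomial.smult (\<xi>0 (basisW ! j)) (topoly (cf j) w))"
  proof (rule topoly_eqI[OF \<xi>0(1)])
    fix s :: 'k assume s: "s \<noteq> 0"
    show "s ^ top_wt * \<xi>0 (\<rho> (lam (inverse s)) w) = poly (\<Sum>j<r. Polynomial.smult (\<xi>0 (basisW ! j)) (topoly (cf j) w)) s"
      by (subst functional_W_expansion[OF \<xi>0(1)])
        (simp add: sum_distrib_left poly_sum mult_ac flip: topoly[OF functional_cf s])
  qed
  then have "(\<Sum>j<r. poly (topoly (cf j) w) 0 * \<xi>0 (basisW ! j)) = \<xi> w"
    by (simp add: \<xi>_def poly_sum mult.commute)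
  finally show ?thesis .
qed

subsection \<open>The extremal matrix coefficient\<close>

lemma one_in_I: "1 \<in> I" "d 1 \<in> I" using n5 by (auto simp: I_def d_def)

lemma outside_one: "i \<in> I \<Longrightarrow> 1 \<in> outside i" "i \<in> I \<Longrightarrow> d 1 \<in> outside i"
  using n5 by (auto simp: outside_def I_def d_def)

text \<open>Both sides are invariant under negative root elements from the left and positive ones from the right, and the torus
  acts on both by the character \<open>2 \<epsilon>\<^sub>1\<close> from the right. They agree at the identity, so the density of the big cell
  applies to their difference.\<close>

lemma extremal_coefficient:
  assumes "g \<in> G"
  shows "\<xi> (\<rho> g wplus) = \<beta> (g (e 1)) (e (d 1)) ^ 2"
proof -
  define D where "D g = \<xi> (\<rho> g wplus) - \<beta> (g (e 1)) (e (d 1)) ^ 2" for g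
  have "D g = 0"
  proof (rule big_cell_density[of D])
    show "polyfun (\<lambda>t. D (\<gamma> t))" if "\<And>t. \<gamma> t \<in> G" "polycurve \<gamma>" for \<gamma>
      unfolding D_def using \<rho>_curve[OF \<xi>_functional that] that(2)
      by (intro polyfun_intros) (auto simp: polycurve_def)
    show "D id = 0" using gram[OF one_in_I] by (simp add: D_def \<rho>_id \<xi>_wplus)
    show "g \<in> G" by fact
    fix i x g assume i: "i \<in> I" "2 * i < n + 1" and x: "x \<in> inner i" and g: "g \<in> G"
    note EG = inner_eichler_G[OF i(2,1) x]
    have "eichler (e (d i)) x (e (d 1)) = e (d 1)"
    proof (rule eichler_fixes)
      show "\<beta> (e (d 1)) x = 0" using innerD[OF x outside_one(2)[OF i(1)]] sym by simp
      have "d i \<noteq> 1" using i by (auto simp: d_def I_def)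
      then show "\<beta> (e (d 1)) (e (d i)) = 0" using gram[OF one_in_I(2) d_in[OF i(1)]] one_in_I by (simp add: d_d)
    qed
    then have "\<beta> (eichler (e (d i)) x v) (e (d 1)) = \<beta> v (e (d 1))" for v
      using isometry_products[OF G_isometry[OF EG(2)], of v "e (d 1)"] by simp
    then show "D (eichler (e (d i)) x \<circ> g) = D g"
      by (simp add: D_def \<rho>_comp[OF EG(2) g] \<xi>_lowering_invariant[OF i(2,1) x])
    have "eichler (e i) x (e 1) = e 1"
    proof (rule eichler_fixes)
      show "\<beta> (e 1) x = 0" using innerD[OF x outside_one(1)[OF i(1)]] sym by simp
      have "i \<noteq> d 1" using i n5 by (auto simp: d_def)
      then show "\<beta> (e 1) (e i) = 0" using gram[OF one_in_I(1) i(1)] by simp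
    qed
    then show "D (g \<circ> eichler (e i) x) = D g"
      by (simp add: D_def \<rho>_comp[OF g EG(1)] raising_fixes_wplus[OF i(2,1) x])
  next
    fix c g assume c: "c \<in> torus_params" and g: "g \<in> G" and D0: "D (g \<circ> tor c) = 0"
    interpret g: Vector_Spaces.linear scaleV scaleV g by (rule isometry_linear[OF G_isometry[OF g]])
    have "c 1 \<noteq> 0" using c one_in_I by (auto simp: torus_params_def)
    moreover have "\<beta> ((g \<circ> tor c) (e 1)) (e (d 1)) = c 1 * \<beta> (g (e 1)) (e (d 1))"
      by (simp only: comp_apply tor_e[OF one_in_I(1)] g.scale bil)
    moreover have "\<xi> (\<rho> (g \<circ> tor c) wplus) = c 1 ^ 2 * \<xi> (\<rho> g wplus)"
      by (simp add: \<rho>_comp[OF g tor_in_torus(1)[OF c]] wplus_torus[OF c] \<rho>_lin[OF g] W.functionalD[OF \<xi>_functional])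
    ultimately have "c 1 \<noteq> 0" "D (g \<circ> tor c) = c 1 ^ 2 * D g"
      unfolding D_def by (simp_all only: power_mult_distrib right_diff_distrib not_False_eq_True)
    then show "D g = 0" using D0 by simp
  qed
  then show ?thesis by (simp add: D_def)
qed

end

section \<open>The symmetric square\<close>

context witt_space
begin

lemma bilinear_formI:
  assumes "\<And>x y z. f (x + y) z = f x z + f y z" "\<And>c x z. f (c *s x) z = c * f x z" "\<And>v w. f v w = f w v"
  shows "bilinear_map scaleV (*) f" "symmetric_map f"
proof -
  have "functional scaleV (\<lambda>v. f v w)" for w using assms(1,2) by (simp add: functional_iff)
  moreover have "functional scaleV (f w)" for w using assms(1,2) by (simp add: functional_iff assms(3)[of w])
  ultimately show "bilinear_map scaleV (*) f" by (simp add: bilinear_map_def)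
  show "symmetric_map f" using assms(3) by (simp add: symmetric_map_def)
qed

text \<open>Up to scalars \<open>\<beta>\<close> is the only symmetric bilinear form which vanishes on the diagonal at the
  isotropic vectors of one affine chart: comparing coefficients of \<open>t\<close> at \<open>b + t x - t\<^sup>2 q(x) a\<close>
  determines all its values in terms of the one at \<open>(a, b)\<close>.\<close>

lemma form_zero_on_isotropic:
  fixes F :: "'v \<Rightarrow> 'v \<Rightarrow> 'k"
  assumes ab: "a = e 1 \<and> b = e (d 1) \<or> a = e (d 1) \<and> b = e 1"
    and F: "\<And>x y z. F (x + y) z = F x z + F y z" "\<And>c x z. F (c *s x) z = c * F x z" "\<And>v w. F v w = F w v"
    and zero: "\<And>x. x \<in> inner 1 \<Longrightarrow> F (eichler a x b) (eichler a x b) = 0"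
  shows "\<exists>c. \<forall>v w. F v w = c * \<beta> v w"
proof -
  have one: "2 * Suc 0 < n + 1" "1 \<in> I" using n5 by (auto simp: I_def)
  note hyp0 = hyperbolic_pair[of 1, OF _ one(2)]
  have hyp: "\<beta> a a = 0" "\<beta> b b = 0" "\<beta> a b = 1" "\<beta> b a = 1" using hyp0 ab n5 by auto
  have Fr: "F z (x + y) = F z x + F z y" "F z (c *s x) = c * F z x" for x y z c
    using F by metis+
  have Fm: "F (x - y) z = F x z - F y z" "F z (x - y) = F z x - F z y" for x y z
    using F(1)[of "x - y" y z] Fr(1)[of z "x - y" y] by (simp_all add: algebra_simps)
  have perp: "\<beta> a x = 0" "\<beta> b x = 0" if "x \<in> inner 1" for x
    using inner_perp[of 1 x] one that ab n5 by auto
  have coeffs: "F b b = 0" "2 * F b x = 0" "F x x - \<beta> x x * F a b = 0" "\<beta> x x * F x a = 0" "(\<beta> x x / 2) ^ 2 * F a a = 0"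
    if x: "x \<in> inner 1" for x
  proof -
    define q where "q = \<beta> x x / 2"
    have q2: "\<beta> x x = 2 * q" using two by (simp add: q_def)
    \<comment> \<open>The expansion of \<open>F\<close> on the diagonal at \<open>eichler a (t *s x) b = b + t x - t\<^sup>2 q a\<close>.\<close>
    define P where "P = [:F b b, 2 * F b x, F x x - 2 * q * F a b, - (2 * q * F x a), q ^ 2 * F a a:]"
    have "poly P t = 0" for t
    proof -
      have "eichler a (t *s x) b = b + t *s x - (t ^ 2 * q) *s a"
        using hyp perp[OF x] by (simp add: eichler_def bil q_def power2_eq_square)
      then have "F (b + t *s x - (t ^ 2 * q) *s a) (b + t *s x - (t ^ 2 * q) *s a) = 0"
        using zero[of "t *s x"] x inner_lin(3) by simp
      then show ?thesis
        by (simp add: P_def F(1,2) Fr Fm F(3)[of x b] F(3)[of a b] F(3)[of a x] algebra_simps power2_eq_square)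
    qed
    then have "P = 0" using poly_eq_0_cofinite[of "{}" P] by simp
    then show "F b b = 0" "2 * F b x = 0" "F x x - \<beta> x x * F a b = 0" "\<beta> x x * F x a = 0" "(\<beta> x x / 2) ^ 2 * F a a = 0"
      using two by (auto simp: P_def q2)
  qed
  define c where "c = F a b"
  have "2 \<in> I" "d 2 \<in> I" "2 \<notin> outside 1" "d 2 \<notin> outside 1" "d 2 \<noteq> 2"
    using n5 by (auto simp: I_def d_def outside_def)
  note two_in = this
  define x0 where "x0 = e 2 + e (d 2)"
  have x0: "x0 \<in> inner 1" unfolding x0_def using two_in by (intro inner_lin e_inner)
  have q0: "\<beta> x0 x0 \<noteq> 0" using two_in two by (simp add: x0_def bil gram d_d)
  have Faa: "F a a = 0" using coeffs(5)[OF x0] q0 two by simp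
  have Fbb: "F b b = 0" using coeffs(1)[OF x0] .
  have Fbx: "F b x = 0" "F x b = 0" if "x \<in> inner 1" for x using coeffs(2)[OF that] two F(3)[of x b] by auto
  have Fxx: "F x x = c * \<beta> x x" if "x \<in> inner 1" for x using coeffs(3)[OF that] by (simp add: c_def)
  have Fxy: "F x y = c * \<beta> x y" if "x \<in> inner 1" "y \<in> inner 1" for x y
  proof -
    have "2 * F x y = 2 * (c * \<beta> x y)"
      using Fxx[OF inner_lin(1)[OF that]] Fxx[OF that(1)] Fxx[OF that(2)]
      by (simp add: F(1) Fr(1) bil F(3)[of y x] sym[of y x] algebra_simps)
    then show ?thesis using two by simp
  qed
  have Fxa: "F x a = 0" if x: "x \<in> inner 1" for x
  proof -
    \<comment> \<open>The relation \<open>\<beta> x x * F x a = 0\<close> only helps for anisotropic \<open>x\<close>. Moving \<open>x\<close> in the direction of an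
      anisotropic vector makes the first factor a nonzero polynomial.\<close>
    define A where "A = [:\<beta> x x, 2 * \<beta> x x0, \<beta> x0 x0:]"
    define B where "B = [:F x a, F x0 a:]"
    have "poly (A * B) t = 0" for t
    proof -
      have "x + t *s x0 \<in> inner 1" using x x0 by (intro inner_lin)
      then have "\<beta> (x + t *s x0) (x + t *s x0) * F (x + t *s x0) a = 0" by (rule coeffs(4))
      moreover have "\<beta> (x + t *s x0) (x + t *s x0) = poly A t"
        by (simp add: bil A_def sym[of x0 x] algebra_simps)
      moreover have "F (x + t *s x0) a = poly B t" by (simp add: B_def F(1,2))
      ultimately show ?thesis by simp
    qed
    then have "A * B = 0" using poly_eq_0_cofinite[of "{}" "A * B"] by simp
    moreover have "A \<noteq> 0" using q0 by (simp add: A_def)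
    ultimately have "B = 0" by simp
    then show ?thesis by (simp add: B_def)
  qed
  have dec: "\<exists>x\<in>inner 1. v = \<beta> v b *s a + \<beta> v a *s b + x" for v
  proof
    let ?x = "v - \<beta> v b *s a - \<beta> v a *s b"
    have out: "outside 1 = {1, d 1}" using n5 by (auto simp: outside_def I_def d_def)
    have "\<beta> ?x a = 0" "\<beta> ?x b = 0" using hyp by (simp_all add: bil)
    then show "?x \<in> inner 1" unfolding inner_def out using ab by auto
    show "v = \<beta> v b *s a + \<beta> v a *s b + ?x" by simp
  qed
  have "F v w = c * \<beta> v w" for v w
  proof -
    obtain x where x: "x \<in> inner 1" "v = \<beta> v b *s a + \<beta> v a *s b + x" using dec by blast
    obtain y where y: "y \<in> inner 1" "w = \<beta> w b *s a + \<beta> w a *s b + y" using dec by blast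
    have ab': "F b a = c" "F a b = c" using F(3) by (auto simp: c_def)
    have xs: "\<beta> x a = 0" "\<beta> x b = 0" "F a y = 0" using perp[OF x(1)] sym Fxa[OF y(1)] F(3) by metis+
    have ev: "G' v w = \<beta> v b * \<beta> w b * G' a a + \<beta> v b * \<beta> w a * G' a b + \<beta> v b * G' a y
        + (\<beta> v a * \<beta> w b * G' b a + \<beta> v a * \<beta> w a * G' b b + \<beta> v a * G' b y)
        + (\<beta> w b * G' x a + \<beta> w a * G' x b + G' x y)"
      if "\<And>x y z. G' (x + y) z = G' x z + G' y z" "\<And>c x z. G' (c *s x) z = c * G' x z"
         "\<And>x y z. G' z (x + y) = G' z x + G' z y" "\<And>c x z. G' z (c *s x) = c * G' z x" for G' :: "'v \<Rightarrow> 'v \<Rightarrow> 'k"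
    proof -
      have "G' v w = G' (\<beta> v b *s a + \<beta> v a *s b + x) (\<beta> w b *s a + \<beta> w a *s b + y)" using x(2) y(2) by simp
      then show ?thesis unfolding that by (simp add: algebra_simps)
    qed
    show ?thesis
      using ev[of F, OF F(1,2) Fr] ev[of \<beta>, OF bil_left(1,4) bil_right(1,4)]
      by (simp add: Faa Fbb ab' xs Fbx[OF x(1)] Fbx[OF y(1)] Fxa[OF x(1)] Fxy[OF x(1) y(1)] hyp
          perp[OF y(1)] algebra_simps)
  qed
  then show ?thesis by blast
qed

end

locale witt_square = witt_space scaleV \<beta> n e
  for scaleV :: "'k::alg_closed_field \<Rightarrow> 'v::ab_group_add \<Rightarrow> 'v" (infixr \<open>*s\<close> 75) and \<beta> n e +
  fixes scaleS :: "'k \<Rightarrow> 's::ab_group_add \<Rightarrow> 's" (infixr \<open>*q\<close> 75) and \<sigma> :: "'v \<Rightarrow> 'v \<Rightarrow> 's"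
    and u :: "'v \<Rightarrow> 'v" and u0 :: "'s \<Rightarrow> 's"
  assumes sq: "symmetric_square scaleV scaleS \<sigma>"
    and uG: "u \<in> SO scaleV \<beta>"
    and u0_linear: "Vector_Spaces.linear scaleS scaleS u0" and u0_\<sigma>: "\<And>v w. u0 (\<sigma> v w) = \<sigma> (u v) (u w)"
begin

sublocale S: vector_space scaleS using sq by (simp add: symmetric_square_def)

lemma \<sigma>_sym: "\<sigma> v w = \<sigma> w v" using sq by (simp add: symmetric_square_def symmetric_map_def)

lemma \<sigma>_lin_right: "\<sigma> x (y + z) = \<sigma> x y + \<sigma> x z" "\<sigma> x (y - z) = \<sigma> x y - \<sigma> x z" "\<sigma> x (c *s y) = c *q \<sigma> x y" 
  "\<sigma> x (sum f A) = (\<Sum>a\<in>A. \<sigma> x (f a))"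
proof -
  interpret R: Vector_Spaces.linear scaleV scaleS "\<sigma> x"
    using sq by (simp add: symmetric_square_def bilinear_map_def)
  show "\<sigma> x (y + z) = \<sigma> x y + \<sigma> x z" "\<sigma> x (y - z) = \<sigma> x y - \<sigma> x z" "\<sigma> x (c *s y) = c *q \<sigma> x y" 
    "\<sigma> x (sum f A) = (\<Sum>a\<in>A. \<sigma> x (f a))"
    by (rule R.add R.diff R.scale R.sum)+
qed

lemma \<sigma>_lin_left: "\<sigma> (y + z) x = \<sigma> y x + \<sigma> z x" "\<sigma> (y - z) x = \<sigma> y x - \<sigma> z x" "\<sigma> (c *s y) x = c *q \<sigma> y x" 
  "\<sigma> (sum f A) x = (\<Sum>a\<in>A. \<sigma> (f a) x)"
  using \<sigma>_lin_right[of x] by (simp_all add: \<sigma>_sym[of _ x])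

lemmas \<sigma>_lin = \<sigma>_lin_left \<sigma>_lin_right

definition lift :: "('v \<Rightarrow> 'v \<Rightarrow> 'k) \<Rightarrow> 's \<Rightarrow> 'k" where
  "lift f = (THE \<phi>. functional scaleS \<phi> \<and> (\<forall>v w. \<phi> (\<sigma> v w) = f v w))"

lemma lift:
  assumes "\<And>x y z. f (x + y) z = f x z + f y z" "\<And>c x z. f (c *s x) z = c * f x z" "\<And>v w. f v w = f w v"
  shows "functional scaleS (lift f)" "lift f (\<sigma> v w) = f v w"
proof -
  note b = bilinear_formI[of f, OF assms]
  have "\<exists>!\<phi>. functional scaleS \<phi> \<and> (\<forall>v w. \<phi> (\<sigma> v w) = f v w)"
    using sq b by (simp add: symmetric_square_def)
  from theI'[OF this] show "functional scaleS (lift f)" "lift f (\<sigma> v w) = f v w" unfolding lift_def by blast+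
qed

lemma functional_S_eqI:
  assumes "functional scaleS \<phi>" "functional scaleS \<psi>" "\<And>v w. \<phi> (\<sigma> v w) = \<psi> (\<sigma> v w)"
  shows "\<phi> = \<psi>"
proof -
  let ?f = "\<lambda>v w. \<psi> (\<sigma> v w)"
  have "\<exists>!\<phi>. functional scaleS \<phi> \<and> (\<forall>v w. \<phi> (\<sigma> v w) = ?f v w)"
  proof -
    have "bilinear_map scaleV (*) ?f" "symmetric_map ?f"
      by (rule bilinear_formI; simp add: \<sigma>_lin S.functionalD[OF assms(2)] \<sigma>_sym)+
    then show ?thesis using sq by (simp add: symmetric_square_def)
  qed
  then show ?thesis using assms by blast
qed

lemma span_\<sigma>: "S.span {\<sigma> v w | v w. True} = UNIV"
proof (rule ccontr)
  assume "S.span {\<sigma> v w | v w. True} \<noteq> UNIV"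
  then obtain x where "x \<notin> S.span {\<sigma> v w | v w. True}" by blast
  then obtain \<psi> where \<psi>: "functional scaleS \<psi>" "\<forall>y\<in>{\<sigma> v w | v w. True}. \<psi> y = 0" "\<psi> x = 1"
    using S.separating_functional by blast
  have "functional scaleS (\<lambda>x. 0)" by (rule S.functionalI) simp_all
  then have "\<psi> = (\<lambda>x. 0)" using \<psi>(2) by (intro functional_S_eqI[OF \<psi>(1)]) auto
  then show False using \<psi>(3) by simp
qed

lemma linear_S_eqI:
  assumes "Vector_Spaces.linear scaleS scaleS f" "Vector_Spaces.linear scaleS scaleS g" "\<And>v w. f (\<sigma> v w) = g (\<sigma> v w)"
  shows "f = g"
proof
  fix x
  interpret vector_space_pair scaleS scaleS by unfold_locales
  show "f x = g x" by (rule linear_eq_on[OF assms(1,2), of x "{\<sigma> v w | v w. True}"]) (use span_\<sigma> assms(3) in auto)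
qed

lemma finite_dim_S: "finite_dim scaleS"
proof -
  let ?B = "(\<lambda>(i, j). \<sigma> (e i) (e j)) ` (I \<times> I)"
  have "\<sigma> v w \<in> S.span ?B" for v w
  proof -
    have ew: "\<sigma> (e i) w \<in> S.span ?B" if "i \<in> I" for i
      by (subst expansion[of w], unfold \<sigma>_lin) (use that in \<open>force intro: S.span_sum S.span_scale S.span_base\<close>)
    show ?thesis
      by (subst expansion[of v], unfold \<sigma>_lin) (use ew in \<open>force intro: S.span_sum S.span_scale\<close>)
  qed
  then have "UNIV \<subseteq> S.span ?B" using span_\<sigma> S.span_minimal[of "{\<sigma> v w | v w. True}" "S.span ?B"] by auto
  then have "S.span ?B = UNIV" by blast
  moreover have "finite ?B" by simp
  ultimately show ?thesis unfolding finite_dim_def using S.vector_space_axioms by blast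
qed

definition basisS where "basisS = (SOME bs. ordered_basis scaleS bs)"

lemma obS: "ordered_basis scaleS basisS"
  unfolding basisS_def by (rule someI_ex[OF S.finite_dim_ordered_basis[OF finite_dim_S]])

sublocale S: finite_dimensional_vector_space scaleS "set basisS"
  by (rule S.ordered_basis_finite_dim[OF obS])

lemma u_iso: "isometry u" using uG by (rule G_isometry)

definition \<tau> where "\<tau> = lift \<beta>"

lemma \<tau>: "functional scaleS \<tau>" "\<tau> (\<sigma> v w) = \<beta> v w"
  unfolding \<tau>_def using lift[of \<beta>] bil sym by blast+

text \<open>The natural bilinear form on the symmetric square, evaluated at the tensor \<open>v w\<close>.\<close>

definition T where "T v w = lift (\<lambda>a b. (\<beta> a v * \<beta> b w + \<beta> a w * \<beta> b v) / 2)"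

lemma T: "functional scaleS (T v w)" "T v w (\<sigma> a b) = (\<beta> a v * \<beta> b w + \<beta> a w * \<beta> b v) / 2"
  unfolding T_def by (rule lift; simp add: bil algebra_simps add_divide_distrib)+

lemma T_lin: "T (x + y) z s = T x z s + T y z s" "T (c *s x) z s = c * T x z s" "T v w s = T w v s"
proof -
  have "T (x + y) z = (\<lambda>s. T x z s + T y z s)"
    by (rule functional_S_eqI[OF T(1) S.functionalI])
       (simp_all add: T S.functionalD[OF T(1)] bil algebra_simps add_divide_distrib)
  then show "T (x + y) z s = T x z s + T y z s" by simp
  have "T (c *s x) z = (\<lambda>s. c * T x z s)"
    by (rule functional_S_eqI[OF T(1) S.functionalI])
       (simp_all add: T S.functionalD[OF T(1)] bil algebra_simps add_divide_distrib)
  then show "T (c *s x) z s = c * T x z s" by simp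
  have "T v w = T w v" by (rule functional_S_eqI[OF T(1) T(1)]) (simp add: T add.commute)
  then show "T v w s = T w v s" by simp
qed

subsection \<open>Symmetric tensors and endomorphisms\<close>

text \<open>Under the identification of \<open>V \<otimes> V\<close> with the endomorphisms of \<open>V\<close> by means of \<open>\<beta>\<close>, this is the projection to
  the symmetric square, and \<open>\<Theta>\<close> is the inclusion of the symmetric square as self-adjoint endomorphisms.\<close>

definition \<Psi> :: "('v \<Rightarrow> 'v) \<Rightarrow> 's" where "\<Psi> A = (\<Sum>i\<in>I. \<sigma> (A (e i)) (e (d i)))"

definition \<Theta> :: "'s \<Rightarrow> 'v \<Rightarrow> 'v" where "\<Theta> s v = (\<Sum>i\<in>I. T v (e (d i)) s *s e i)"

definition \<omega> where "\<omega> = \<Psi> id"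

lemma reindex_d: "(\<Sum>i\<in>I. f (d i)) = (\<Sum>i\<in>I. f i)"
  by (rule sum.reindex_bij_witness[of _ d d]) (auto simp: d_in d_d)

lemma expansion': "v = (\<Sum>i\<in>I. \<beta> v (e i) *s e (d i))"
proof -
  have "(\<Sum>i\<in>I. \<beta> v (e i) *s e (d i)) = (\<Sum>i\<in>I. (\<lambda>j. \<beta> v (e (d j)) *s e j) (d i))"
    by (rule sum.cong) (simp_all add: d_d)
  also have "\<dots> = v"
    using reindex_d[of "\<lambda>j. \<beta> v (e (d j)) *s e j"] expansion[of v] by metis
  finally show ?thesis by simp
qed

text \<open>Expand the dual vectors \<open>c' j\<close> in the Witt basis and collect terms. Independence of the basis makes \<open>\<Psi>\<close>
  equivariant, and it allows traces to be computed in a Jordan basis.\<close>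

lemma \<Psi>_dual_family:
  assumes A: "Vector_Spaces.linear scaleV scaleV A" and dual: "\<And>v. v = (\<Sum>j\<in>J. \<beta> v (c' j) *s c j)"
  shows "(\<Sum>j\<in>J. \<sigma> (A (c j)) (c' j)) = \<Psi> A"
proof -
  interpret A: Vector_Spaces.linear scaleV scaleV A by fact
  have "(\<Sum>j\<in>J. \<sigma> (A (c j)) (c' j)) = (\<Sum>j\<in>J. \<Sum>i\<in>I. \<beta> (c' j) (e i) *q \<sigma> (A (c j)) (e (d i)))"
    by (subst expansion'[of "c' _"]) (simp add: \<sigma>_lin)
  also have "\<dots> = (\<Sum>i\<in>I. \<Sum>j\<in>J. \<beta> (e i) (c' j) *q \<sigma> (A (c j)) (e (d i)))"
    by (subst sum.swap) (simp add: sym[of "c' _"])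
  also have "\<dots> = (\<Sum>i\<in>I. \<sigma> (A (\<Sum>j\<in>J. \<beta> (e i) (c' j) *s c j)) (e (d i)))"
    by (simp add: A.sum A.scale \<sigma>_lin)
  also have "\<dots> = \<Psi> A" by (simp add: \<Psi>_def flip: dual)
  finally show ?thesis .
qed

lemma u_linear: "Vector_Spaces.linear scaleV scaleV u" by (rule isometry_linear[OF u_iso])

lemma u_bij: "bij u" using isometry_inj[OF u_iso] isometry_surj[OF u_iso] by (simp add: bij_def)

definition ui where "ui = inv_into UNIV u"

lemma ui_u: "u (ui v) = v" "ui (u v) = v"
  using u_bij by (simp_all add: ui_def bij_is_surj surj_f_inv_f bij_is_inj)

lemma ui_linear: "Vector_Spaces.linear scaleV scaleV ui"
proof (rule linear_endoI)
  interpret u: Vector_Spaces.linear scaleV scaleV u by (rule u_linear)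
  show "ui (x + y) = ui x + ui y" for x y
    by (metis ui_u u.add)
  show "ui (c *s x) = c *s ui x" for c x
    by (metis ui_u u.scale)
qed

lemma u0_\<Psi>:
  assumes A: "Vector_Spaces.linear scaleV scaleV A"
  shows "u0 (\<Psi> A) = \<Psi> (u \<circ> A \<circ> ui)"
proof -
  interpret u0: Vector_Spaces.linear scaleS scaleS u0 by (rule u0_linear)
  interpret u: Vector_Spaces.linear scaleV scaleV u by (rule u_linear)
  have dual: "v = (\<Sum>j\<in>I. \<beta> v (u (e (d j))) *s u (e j))" for v
  proof -
    have "v = u (\<Sum>j\<in>I. \<beta> (ui v) (e (d j)) *s e j)" by (simp add: ui_u flip: expansion)
    also have "\<dots> = (\<Sum>j\<in>I. \<beta> (u (ui v)) (u (e (d j))) *s u (e j))"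
      by (simp add: u.sum u.scale isometry_products[OF u_iso])
    finally show ?thesis by (simp add: ui_u)
  qed
  have lin: "Vector_Spaces.linear scaleV scaleV (u \<circ> A \<circ> ui)"
    by (intro Vector_Spaces.linear_compose[of _ scaleV] ui_linear A u_linear)
  have "u0 (\<Psi> A) = (\<Sum>j\<in>I. \<sigma> ((u \<circ> A \<circ> ui) (u (e j))) (u (e (d j))))"
    by (simp add: \<Psi>_def u0.sum u0_\<sigma> ui_u)
  also have "\<dots> = \<Psi> (u \<circ> A \<circ> ui)" by (rule \<Psi>_dual_family[OF lin dual])
  finally show ?thesis .
qed

lemma u0_\<omega>: "u0 \<omega> = \<omega>"
proof -
  have "u \<circ> id \<circ> ui = id" by (auto simp: ui_u)
  then show ?thesis unfolding \<omega>_def using u0_\<Psi>[OF linear_id'] by simp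
qed

lemma linear_\<Theta>: "Vector_Spaces.linear scaleV scaleV (\<Theta> s)"
  by (rule linear_endoI) (simp_all add: \<Theta>_def T_lin scale_left_distrib sum.distrib scale_sum_right)

lemma \<Theta>_product: "\<beta> (\<Theta> s v) w = T v w s"
proof -
  have "\<beta> (\<Theta> s v) w = (\<Sum>i\<in>I. \<beta> w (e i) * T (e (d i)) v s)"
    by (simp add: \<Theta>_def bil sym[of "e _" w] T_lin(3)[of v] mult.commute)
  also have "\<dots> = T (\<Sum>i\<in>I. \<beta> w (e i) *s e (d i)) v s"
  proof -
    have T0: "T 0 v s = 0" using T_lin(2)[of 0 0 v s] by simp
    have "T (\<Sum>i\<in>A. \<beta> w (e i) *s e (d i)) v s = (\<Sum>i\<in>A. \<beta> w (e i) * T (e (d i)) v s)" for A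
      by (induction A rule: infinite_finite_induct) (simp_all add: T_lin(1,2) T0)
    then show ?thesis by simp
  qed
  also have "\<dots> = T v w s" using expansion'[of w] T_lin(3) by simp
  finally show ?thesis .
qed

lemma \<Psi>_\<Theta>: "\<Psi> (\<Theta> s) = s"
proof -
  have "(\<lambda>s. \<Psi> (\<Theta> s)) = (\<lambda>s. s)"
  proof (rule linear_S_eqI)
    show "Vector_Spaces.linear scaleS scaleS (\<lambda>s. \<Psi> (\<Theta> s))"
      by (simp add: module_hom_iff_linear[symmetric] module_hom_iff S.module_axioms \<Psi>_def \<Theta>_def S.functionalD[OF T(1)] \<sigma>_lin
          scale_left_distrib sum.distrib S.scale_left_distrib S.scale_sum_right)
    show "Vector_Spaces.linear scaleS scaleS (\<lambda>s. s)" by (rule S.linear_ident)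
    fix a b
    have \<Theta>ab: "\<Theta> (\<sigma> a b) v = (1 / 2) *s (\<beta> v a *s b + \<beta> v b *s a)" for v
      by (rule eq_by_products)
         (simp add: \<Theta>_product T bil sym[of a v] sym[of b v] algebra_simps add_divide_distrib)
    have "\<Psi> (\<Theta> (\<sigma> a b)) = (1 / 2) *q ((\<Sum>i\<in>I. \<beta> a (e i) *q \<sigma> b (e (d i))) + (\<Sum>i\<in>I. \<beta> b (e i) *q \<sigma> a (e (d i))))"
      by (simp add: \<Psi>_def \<Theta>ab \<sigma>_lin S.scale_sum_right sum.distrib S.scale_right_distrib sym[of _ a] sym[of _ b])
    also have "(\<Sum>i\<in>I. \<beta> a (e i) *q \<sigma> b (e (d i))) = \<sigma> b a"
      by (subst (2) expansion'[of a]) (simp add: \<sigma>_lin)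
    also have "(\<Sum>i\<in>I. \<beta> b (e i) *q \<sigma> a (e (d i))) = \<sigma> a b"
      by (subst (2) expansion'[of b]) (simp add: \<sigma>_lin)
    also have "(1 / 2) *q (\<sigma> b a + \<sigma> a b) = \<sigma> a b"
      using two by (simp add: \<sigma>_sym[of b a] S.scale_right_distrib flip: S.scale_left_distrib)
    finally show "\<Psi> (\<Theta> (\<sigma> a b)) = \<sigma> a b" .
  qed
  then show ?thesis by metis
qed

text \<open>The endomorphism \<open>\<Theta> s\<close> is then the scalar \<open>c\<close>.\<close>

lemma T_multiple_of_form:
  assumes "\<And>v w. T v w s = c * \<beta> v w"
  shows "s = c *q \<omega>"
proof -
  have "\<Theta> s v = c *s v" for v by (rule eq_by_products) (simp add: \<Theta>_product assms bil)
  then have "\<Psi> (\<Theta> s) = c *q \<omega>" by (simp add: \<Psi>_def \<omega>_def \<sigma>_lin S.scale_sum_right)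
  then show ?thesis by (simp add: \<Psi>_\<Theta>)
qed

definition tr :: "('v \<Rightarrow> 'v) \<Rightarrow> 'k" where "tr A = (\<Sum>i\<in>I. \<beta> (A (e i)) (e (d i)))"

lemma \<tau>_\<Psi>: "\<tau> (\<Psi> A) = tr A" by (simp add: \<Psi>_def tr_def S.functionalD[OF \<tau>(1)] \<tau>(2))

lemma \<tau>_\<omega>: "\<tau> \<omega> = of_nat n"
proof -
  have "tr id = (\<Sum>i\<in>I. 1)" unfolding tr_def by (rule sum.cong) (simp_all add: gram d_in)
  then show ?thesis by (simp add: \<omega>_def \<tau>_\<Psi> I_def)
qed

lemma \<tau>_u0: "\<tau> (u0 s) = \<tau> s"
proof -
  have "(\<lambda>s. \<tau> (u0 s)) = \<tau>"
    by (rule functional_S_eqI[OF S.functional_comp[OF \<tau>(1) u0_linear] \<tau>(1)])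
       (simp add: u0_\<sigma> \<tau>(2) isometry_products[OF u_iso])
  then show ?thesis by metis
qed

lemma T_\<omega>: "T v w \<omega> = \<beta> v w"
proof -
  have pe: "(\<Sum>i\<in>I. \<beta> (e i) x * \<beta> (e (d i)) y) = \<beta> y x" for x y
    unfolding products_expansion[of y x] by (rule sum.cong) (simp_all add: sym[of x] sym[of y] mult.commute)
  have "T v w \<omega> = ((\<Sum>i\<in>I. \<beta> (e i) v * \<beta> (e (d i)) w) + (\<Sum>i\<in>I. \<beta> (e i) w * \<beta> (e (d i)) v)) / 2"
    by (simp add: \<omega>_def \<Psi>_def S.functionalD[OF T(1)] T(2) sum.distrib flip: sum_divide_distrib)
  also have "\<dots> = \<beta> v w" unfolding pe using two by (simp add: sym[of w v])
  finally show ?thesis .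
qed

lemma \<Theta>_\<omega>: "\<Theta> \<omega> = id"
proof
  fix v show "\<Theta> \<omega> v = id v" by (rule eq_by_products) (simp add: \<Theta>_product T_\<omega>)
qed

lemma \<omega>_nonzero: "\<omega> \<noteq> 0"
proof
  assume "\<omega> = 0"
  then have "\<beta> (e 1) (e (d 1)) = 0" using T_\<omega>[of "e 1" "e (d 1)"] S.functionalD(4)[OF T(1)] by simp
  then show False using hyperbolic_pair[of 1] n5 by (auto simp: I_def)
qed

definition X where "X s = u0 s - s"

lemma X_linear: "Vector_Spaces.linear scaleS scaleS X"
  unfolding X_def by (rule S.linear_unipotent_part[OF u0_linear])

lemma X_\<omega>: "X \<omega> = 0" by (simp add: X_def u0_\<omega>)

lemma \<tau>_X: "\<tau> (X s) = 0" by (simp add: X_def S.functionalD[OF \<tau>(1)] \<tau>_u0)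

end

section \<open>The irreducible module as a subquotient of the symmetric square\<close>

locale highest_weight_square = highest_weight_module scaleV \<beta> n e scaleW \<rho> + witt_square scaleV \<beta> n e scaleS \<sigma> u u0
  for scaleV :: "'k::alg_closed_field \<Rightarrow> 'v::ab_group_add \<Rightarrow> 'v" (infixr \<open>*s\<close> 75) and \<beta> n e
    and scaleW :: "'k \<Rightarrow> 'w::ab_group_add \<Rightarrow> 'w" (infixr \<open>*w\<close> 75) and \<rho>
    and scaleS :: "'k \<Rightarrow> 's::ab_group_add \<Rightarrow> 's" (infixr \<open>*q\<close> 75) and \<sigma> u u0
begin

text \<open>The function on the group defined by a tensor, namely its pairing with the square of \<open>h\<inverse> (e (d 1))\<close>.\<close>

definition \<eta> where "\<eta> h = lift (\<lambda>a b. \<beta> (h a) (e (d 1)) * \<beta> (h b) (e (d 1)))"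

lemma \<eta>:
  assumes "h \<in> G"
  shows "functional scaleS (\<eta> h)" "\<eta> h (\<sigma> a b) = \<beta> (h a) (e (d 1)) * \<beta> (h b) (e (d 1))"
proof -
  interpret h: Vector_Spaces.linear scaleV scaleV h by (rule isometry_linear[OF G_isometry[OF assms]])
  show "functional scaleS (\<eta> h)" "\<eta> h (\<sigma> a b) = \<beta> (h a) (e (d 1)) * \<beta> (h b) (e (d 1))"
    unfolding \<eta>_def by (rule lift; simp add: h.add h.scale bil algebra_simps)+
qed

text \<open>Both a vector of the irreducible module and a symmetric tensor define a function on \<open>SO(V)\<close>;
  the relation \<open>rel\<close> identifies them if these functions agree.\<close>

definition rel :: "'s \<Rightarrow> 'w \<Rightarrow> bool" where "rel s w \<longleftrightarrow> (\<forall>h\<in>G. \<xi> (\<rho> h w) = \<eta> h s)"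

lemma rel_lin: "rel s w \<Longrightarrow> rel s' w' \<Longrightarrow> rel (s + s') (w + w')" "rel s w \<Longrightarrow> rel (c *q s) (c *w w)" "rel 0 0"
  by (simp_all add: rel_def \<eta> S.functionalD[OF \<eta>(1)] \<rho>_lin W.functionalD[OF \<xi>_functional])

lemma invariant_subspace_trivial:
  assumes "W.subspace U" "\<And>g w. g \<in> G \<Longrightarrow> w \<in> U \<Longrightarrow> \<rho> g w \<in> U"
  shows "U = {0} \<or> U = UNIV"
  using irr assms unfolding irreducible_representation_def by blast

text \<open>The vectors with zero function form an invariant subspace which does not contain \<open>wplus\<close>.\<close>

lemma rel_unique:
  assumes "rel s w" "rel s w'"
  shows "w = w'"
proof -
  let ?U = "{w. \<forall>h\<in>G. \<xi> (\<rho> h w) = 0}"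
  have "W.subspace ?U"
    by (simp add: W.subspace_def \<rho>_lin W.functionalD[OF \<xi>_functional])
  moreover have "\<rho> g w \<in> ?U" if "g \<in> G" "w \<in> ?U" for g w
  proof -
    have "\<xi> (\<rho> h (\<rho> g w)) = 0" if "h \<in> G" for h
      using \<open>w \<in> ?U\<close> G_comp[OF that \<open>g \<in> G\<close>] \<rho>_comp[OF that \<open>g \<in> G\<close>] by (metis (mono_tags, lifting) comp_apply mem_Collect_eq)
    then show ?thesis by simp
  qed
  ultimately have "?U = {0} \<or> ?U = UNIV" by (rule invariant_subspace_trivial)
  moreover have "wplus \<notin> ?U" using \<xi>_wplus G_id \<rho>_id by (auto intro!: bexI[of _ id])
  ultimately have U0: "?U = {0}" by blast
  have "w - w' \<in> ?U"
  proof -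
    have "\<xi> (\<rho> h (w - w')) = 0" if h: "h \<in> G" for h
    proof -
      interpret h: Vector_Spaces.linear scaleW scaleW "\<rho> h" by (rule \<rho>_linear[OF h])
      show ?thesis using assms h by (simp add: rel_def h.diff W.functionalD[OF \<xi>_functional])
    qed
    then show ?thesis by simp
  qed
  then show ?thesis using U0 by simp
qed

lemma rel_orbit: "g \<in> G \<Longrightarrow> rel (\<sigma> (g (e 1)) (g (e 1))) (\<rho> g wplus)"
  unfolding rel_def
proof
  fix h assume g: "g \<in> G" and h: "h \<in> G"
  show "\<xi> (\<rho> h (\<rho> g wplus)) = \<eta> h (\<sigma> (g (e 1)) (g (e 1)))"
    using extremal_coefficient[OF G_comp[OF h g]] \<rho>_comp[OF h g] by (simp add: \<eta>(2)[OF h] power2_eq_square)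
qed

definition Z where "Z = {s. \<tau> s = 0}"

lemma subspace_Z: "S.subspace Z"
  by (simp add: Z_def S.subspace_def S.functionalD[OF \<tau>(1)])

lemma two_le: "2 * 1 < n + 1" using n5 by simp

lemma \<omega>_span: "S.span {\<omega>} = range (\<lambda>c. c *q \<omega>)"
  by (rule S.span_singleton)

text \<open>The squares of the isotropic vectors in one orbit span the kernel of \<open>\<tau>\<close>, so the relation is
  everywhere defined there.\<close>

lemma rel_exists:
  assumes "s \<in> Z"
  shows "\<exists>w. rel s w"
proof -
  let ?O = "{\<sigma> (g (e 1)) (g (e 1)) | g. g \<in> G}"
  have "s \<in> S.span ?O"
  proof (rule ccontr)
    assume "s \<notin> S.span ?O"
    then obtain \<psi> where \<psi>: "functional scaleS \<psi>" "\<forall>y\<in>?O. \<psi> y = 0" "\<psi> s = 1"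
      using S.separating_functional by blast
    have "\<exists>c. \<forall>v w. \<psi> (\<sigma> v w) = c * \<beta> v w"
    proof (rule form_zero_on_isotropic[of "e (d 1)" "e 1"])
      fix x assume x: "x \<in> inner 1"
      have "eichler (e (d 1)) x \<in> G" by (rule inner_eichler_G(2)[OF two_le one_in_I(1) x])
      then show "\<psi> (\<sigma> (eichler (e (d 1)) x (e 1)) (eichler (e (d 1)) x (e 1))) = 0" using \<psi>(2) by blast
    qed (simp_all add: \<sigma>_lin S.functionalD[OF \<psi>(1)] \<sigma>_sym)
    then obtain c where c: "\<And>v w. \<psi> (\<sigma> v w) = c * \<beta> v w" by blast
    have "\<psi> = (\<lambda>s. c * \<tau> s)"
      by (rule functional_S_eqI[OF \<psi>(1) S.functionalI]) (simp_all add: c \<tau> S.functionalD[OF \<tau>(1)] algebra_simps)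
    then show False using \<psi>(3) assms by (simp add: Z_def)
  qed
  moreover have "S.subspace {s. \<exists>w. rel s w}"
    unfolding S.subspace_def using rel_lin by blast
  moreover have "?O \<subseteq> {s. \<exists>w. rel s w}" using rel_orbit by blast
  ultimately show ?thesis using S.span_minimal by blast
qed

text \<open>By irreducibility the orbit of \<open>wplus\<close> spans the module.\<close>

lemma rel_surj: "\<exists>s\<in>Z. rel s w"
proof -
  let ?U = "W.span {\<rho> g wplus | g. g \<in> G}"
  have "\<rho> g w \<in> ?U" if g: "g \<in> G" and w: "w \<in> ?U" for g w
  proof -
    interpret g: Vector_Spaces.linear scaleW scaleW "\<rho> g" by (rule \<rho>_linear[OF g])
    have "\<rho> g ` {\<rho> g wplus | g. g \<in> G} \<subseteq> {\<rho> g wplus | g. g \<in> G}"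
    proof
      fix y assume "y \<in> \<rho> g ` {\<rho> g wplus | g. g \<in> G}"
      then obtain h where h: "h \<in> G" "y = \<rho> g (\<rho> h wplus)" by blast
      then have "y = \<rho> (g \<circ> h) wplus" using \<rho>_comp[OF g h(1)] by simp
      then show "y \<in> {\<rho> g wplus | g. g \<in> G}" using G_comp[OF g h(1)] by blast
    qed
    then have "\<rho> g ` ?U \<subseteq> ?U" unfolding g.span_image[symmetric] by (rule W.span_mono)
    then show ?thesis using w by blast
  qed
  then have "?U = {0} \<or> ?U = UNIV" using W.subspace_span by (intro invariant_subspace_trivial) blast+
  moreover have "wplus \<in> ?U" using G_id \<rho>_id by (intro W.span_base) (force intro!: exI[of _ id])
  ultimately have "?U = UNIV" using wplus_nonzero by blast
  moreover have "W.subspace {w. \<exists>s\<in>Z. rel s w}"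
    unfolding W.subspace_def using rel_lin subspace_Z unfolding S.subspace_def by blast
  moreover have "{\<rho> g wplus | g. g \<in> G} \<subseteq> {w. \<exists>s\<in>Z. rel s w}"
  proof
    fix w assume "w \<in> {\<rho> g wplus | g. g \<in> G}"
    then obtain g where g: "g \<in> G" "w = \<rho> g wplus" by blast
    have "\<beta> (e 1) (e 1) = 0" using hyperbolic_pair(1)[OF two_le one_in_I(1)] .
    then have "\<sigma> (g (e 1)) (g (e 1)) \<in> Z" using isometry_products[OF G_isometry[OF g(1)]] by (simp add: Z_def \<tau>(2))
    then show "w \<in> {w. \<exists>s\<in>Z. rel s w}" using rel_orbit[OF g(1)] g(2) by blast
  qed
  ultimately show ?thesis using W.span_minimal by blast
qed

lemma rel_\<omega>: "rel \<omega> 0"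
  unfolding rel_def
proof
  fix h assume h: "h \<in> G"
  note iso = G_isometry[OF h]
  obtain y where y: "h y = e (d 1)" using isometry_surj[OF iso] by (metis surjD)
  have "\<eta> h \<omega> = (\<Sum>i\<in>I. \<beta> (e i) y * \<beta> (e (d i)) y)"
    using isometry_products[OF iso, of _ y]
    by (simp add: \<omega>_def \<Psi>_def S.functionalD[OF \<eta>(1)[OF h]] \<eta>(2)[OF h] y)
  also have "\<dots> = \<beta> y y"
    unfolding products_expansion[of y y] by (rule sum.cong) (simp_all add: sym[of y])
  also have "\<dots> = \<beta> (e (d 1)) (e (d 1))" using isometry_products[OF iso, of y y] y by simp
  also have "\<dots> = 0" by (rule hyperbolic_pair(2)[OF two_le one_in_I(1)])
  finally show "\<xi> (\<rho> h 0) = \<eta> h \<omega>" using \<rho>_lin(4)[OF h] W.functionalD(4)[OF \<xi>_functional] by simp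
qed

text \<open>The form \<open>(v, w) \<mapsto> T v w s\<close> vanishes on the diagonal at the isotropic vectors \<open>h\<inverse> (e (d 1))\<close>, so it is a
  multiple of \<open>\<beta>\<close>.\<close>

lemma rel_kernel:
  assumes "rel s 0"
  shows "s \<in> S.span {\<omega>}"
proof -
  have "\<exists>c. \<forall>v w. T v w s = c * \<beta> v w"
  proof (rule form_zero_on_isotropic[of "e 1" "e (d 1)"])
    fix x assume x: "x \<in> inner 1"
    let ?v = "eichler (e 1) x (e (d 1))" and ?h = "eichler (e 1) (- x)"
    have h: "?h \<in> G" by (rule inner_eichler_G(1)[OF two_le one_in_I(1) inner_lin(4)[OF x]])
    have "?h ?v = e (d 1)"
      using hyperbolic_pair(1)[OF two_le one_in_I(1)] inner_perp(1)[OF two_le one_in_I(1) x] by (rule eichler_cancel)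
    then have hv: "\<beta> (?h a) (e (d 1)) = \<beta> a ?v" for a
      using isometry_products[OF G_isometry[OF h], of a ?v] by simp
    have "\<eta> ?h = T ?v ?v"
      by (rule functional_S_eqI[OF \<eta>(1)[OF h] T(1)]) (simp only: \<eta>(2)[OF h] hv T(2), use two in simp)
    moreover have "\<eta> ?h s = 0"
      using assms h \<rho>_lin(4)[OF h] W.functionalD(4)[OF \<xi>_functional] by (metis rel_def)
    ultimately show "T ?v ?v s = 0" by simp
  qed (auto simp: T_lin(1,2) intro: T_lin(3))
  then obtain c where "\<And>v w. T v w s = c * \<beta> v w" by blast
  then have "s = c *q \<omega>" by (rule T_multiple_of_form)
  then show ?thesis unfolding \<omega>_span by blast
qed

lemma rel_equivariant: "rel s w \<Longrightarrow> rel (u0 s) (\<rho> u w)"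
  unfolding rel_def
proof
  fix h assume rel: "\<forall>h\<in>G. \<xi> (\<rho> h w) = \<eta> h s" and h: "h \<in> G"
  have hu: "h \<circ> u \<in> G" by (rule G_comp[OF h uG])
  have "(\<lambda>s. \<eta> h (u0 s)) = \<eta> (h \<circ> u)"
    by (rule functional_S_eqI[OF S.functional_comp[OF \<eta>(1)[OF h] u0_linear] \<eta>(1)[OF hu]])
       (simp add: u0_\<sigma> \<eta>(2)[OF h] \<eta>(2)[OF hu])
  then have "\<eta> h (u0 s) = \<eta> (h \<circ> u) s" by metis
  moreover have "\<rho> h (\<rho> u w) = \<rho> (h \<circ> u) w" using \<rho>_comp[OF h uG] by simp
  ultimately show "\<xi> (\<rho> h (\<rho> u w)) = \<eta> h (u0 s)" using rel hu by simp
qed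

subsection \<open>Kernel dimensions\<close>

definition Y where "Y w = \<rho> u w - w"

lemma rel_X_pow: "rel s w \<Longrightarrow> rel ((X ^^ m) s) ((Y ^^ m) w)"
proof (induction m)
  case (Suc m)
  have "rel (u0 ((X ^^ m) s) + (- 1) *q (X ^^ m) s) (\<rho> u ((Y ^^ m) w) + (- 1) *w (Y ^^ m) w)"
    by (intro rel_lin rel_equivariant Suc)
  then show ?case by (simp add: X_def[of "(X ^^ m) s"] Y_def[of "(Y ^^ m) w"])
qed simp

definition tensor1 where "tensor1 = \<sigma> (e 1) (e (d 1))"

text \<open>The relation \<open>rel\<close> is a map on \<open>Z\<close> only. It is extended to the whole symmetric square along the complement
  spanned by \<open>tensor1\<close>, which makes it a linear map of vector spaces.\<close>

definition \<theta> where "\<theta> s = (THE w. rel (s - \<tau> s *q tensor1) w)"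

lemma \<tau>_tensor1: "\<tau> tensor1 = 1"
  using hyperbolic_pair(3)[OF two_le one_in_I(1)] by (simp add: tensor1_def \<tau>(2))

lemma rel_\<theta>: "rel (s - \<tau> s *q tensor1) (\<theta> s)"
proof -
  have "s - \<tau> s *q tensor1 \<in> Z" by (simp add: Z_def S.functionalD[OF \<tau>(1)] \<tau>_tensor1)
  then have "\<exists>!w. rel (s - \<tau> s *q tensor1) w" using rel_exists rel_unique by blast
  then show ?thesis unfolding \<theta>_def by (rule theI')
qed

lemma \<theta>_Z: "s \<in> Z \<Longrightarrow> rel s w \<longleftrightarrow> \<theta> s = w"
  using rel_\<theta>[of s] rel_unique by (auto simp: Z_def)

lemma \<theta>_linear: "Vector_Spaces.linear scaleS scaleW \<theta>"
proof -
  have "\<theta> (x + y) = \<theta> x + \<theta> y" for x y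
    using rel_lin(1)[OF rel_\<theta>[of x] rel_\<theta>[of y]] rel_\<theta>[of "x + y"]
    by (intro rel_unique) (auto simp: S.functionalD[OF \<tau>(1)] S.scale_left_distrib algebra_simps)
  moreover have "\<theta> (c *q x) = c *w \<theta> x" for c x
    using rel_lin(2)[OF rel_\<theta>[of x], of c] rel_\<theta>[of "c *q x"]
    by (intro rel_unique) (auto simp: S.functionalD[OF \<tau>(1)] S.scale_right_diff_distrib)
  ultimately show ?thesis
    by (simp add: module_hom_iff_linear[symmetric] module_hom_iff S.module_axioms W.module_axioms)
qed

text \<open>The map \<open>\<theta>\<close> has kernel \<open>Z \<inter> K\<omega>\<close> on \<open>Z\<close> and is equivariant, so the preimage in \<open>Z\<close> of the kernel of \<open>Y ^^ m\<close> consists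
  of the tensors that \<open>X ^^ m\<close> maps to a multiple of \<open>\<omega>\<close>.\<close>

lemma dim_kernel_W:
  "W.dim {w. (Y ^^ m) w = 0} + S.dim (Z \<inter> S.span {\<omega>}) = S.dim {s \<in> Z. (X ^^ m) s \<in> S.span {\<omega>}}"
proof -
  let ?U = "{s \<in> Z. (X ^^ m) s \<in> S.span {\<omega>}}"
  interpret Xm: Vector_Spaces.linear scaleS scaleS "X ^^ m" by (rule S.linear_funpow[OF X_linear])
  have subU: "S.subspace ?U"
    using subspace_Z S.subspace_span[of "{\<omega>}"] by (auto simp: S.subspace_def Xm.add Xm.scale Xm.zero)
  have rel_span: "rel s 0 \<longleftrightarrow> s \<in> S.span {\<omega>}" for s
    using rel_kernel rel_lin(2)[OF rel_\<omega>] unfolding \<omega>_span by auto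
  have "\<theta> ` ?U = {w. (Y ^^ m) w = 0}"
  proof (intro subset_antisym subsetI)
    fix w assume "w \<in> \<theta> ` ?U"
    then obtain s where s: "s \<in> Z" "(X ^^ m) s \<in> S.span {\<omega>}" "rel s w" using \<theta>_Z by blast
    then have "(Y ^^ m) w = 0"
      using rel_X_pow[OF s(3), of m] rel_span rel_unique by blast
    then show "w \<in> {w. (Y ^^ m) w = 0}" by simp
  next
    fix w assume w: "w \<in> {w. (Y ^^ m) w = 0}"
    obtain s where s: "s \<in> Z" "rel s w" using rel_surj by blast
    then have "rel ((X ^^ m) s) 0" using rel_X_pow[OF s(2), of m] w by simp
    then have "s \<in> ?U" using s rel_span by simp
    then show "w \<in> \<theta> ` ?U" using s(2) \<theta>_Z[OF s(1)] by (intro image_eqI[of _ _ s]) auto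
  qed
  moreover have "{s \<in> ?U. \<theta> s = 0} = Z \<inter> S.span {\<omega>}"
  proof (intro subset_antisym subsetI)
    fix s assume "s \<in> {s \<in> ?U. \<theta> s = 0}"
    then show "s \<in> Z \<inter> S.span {\<omega>}" using \<theta>_Z rel_span by blast
  next
    fix s assume s: "s \<in> Z \<inter> S.span {\<omega>}"
    then obtain c where c: "s = c *q \<omega>" unfolding \<omega>_span by blast
    have "(X ^^ k) \<omega> \<in> S.span {\<omega>}" for k
    proof (induction k)
      case (Suc k)
      interpret X: Vector_Spaces.linear scaleS scaleS X by (rule X_linear)
      show ?case using Suc X_\<omega> unfolding \<omega>_span by (auto simp: X.scale)
    qed (simp add: S.span_base)
    then have "(X ^^ m) s \<in> S.span {\<omega>}" unfolding c Xm.scale by (rule S.span_scale)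
    then show "s \<in> {s \<in> ?U. \<theta> s = 0}" using s \<theta>_Z rel_span by auto
  qed
  ultimately show ?thesis
    using rank_nullity[OF S.finite_dimensional_vector_space_axioms W.vector_space_axioms \<theta>_linear subU] by simp
qed

end

section \<open>The unipotent action in a Jordan basis\<close>

text \<open>Compare coefficients in \<open>(1 + x) ^ q = 1 + x ^ q\<close>.\<close>

lemma choose_prime_power_zero:
  assumes "prime CHAR('k::field)" "q = CHAR('k) ^ a" "0 < i" "i < q"
  shows "of_nat (q choose i) = (0 :: 'k)"
proof -
  have p: "prime CHAR('k poly)" using assms(1) by simp
  have "([:1, 1:] :: 'k poly) ^ q = (1 + [:0, 1:]) ^ q" by (simp add: one_pCons)
  also have "\<dots> = 1 + [:0, 1:] ^ q"
    using freshmans_dream'[OF p, of q a "1 :: 'k poly" "[:0, 1:]"] assms(2) by simp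
  finally have "coeff (([:1, 1:] :: 'k poly) ^ q) i = coeff (1 + [:0, 1:] ^ q) i" by simp
  moreover have "[:0, 1:] ^ q = (monom 1 q :: 'k poly)" by (simp add: monom_altdef)
  ultimately show ?thesis using assms(3,4) by (simp add: coeff_linear_poly_power)
qed

lemma choose_pred_prime_power:
  assumes "prime CHAR('k::field)" "q = CHAR('k) ^ a" "i < q"
  shows "(- 1) ^ i * of_nat ((q - 1) choose i) = (1 :: 'k)"
  using assms(3)
proof (induction i)
  case (Suc i)
  have q: "q = Suc (q - 1)" using Suc.prems by simp
  have "(q choose Suc i) = ((q - 1) choose i) + ((q - 1) choose Suc i)"
    by (subst q) (rule binomial_Suc_Suc)
  moreover have "of_nat (q choose Suc i) = (0::'k)"
    by (rule choose_prime_power_zero[OF assms(1,2)]) (use Suc.prems in auto)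
  ultimately have "of_nat ((q - 1) choose i) + of_nat ((q - 1) choose Suc i) = (0::'k)"
    by (metis of_nat_add)
  then have "of_nat ((q - 1) choose Suc i) = - (of_nat ((q - 1) choose i) :: 'k)"
    by (simp add: add_eq_0_iff)
  then show ?case using Suc by simp
qed simp

lemma count_multiples: "(\<Sum>j<q * M. if q dvd Suc j then 1 else 0) = (M :: nat)" if "q > 0"
proof (induction M)
  case (Suc M)
  have "(\<Sum>j<q. if q dvd Suc (q * M + j) then 1 else 0) = (\<Sum>j<q. if j = q - 1 then 1 else (0::nat))"
  proof (rule sum.cong[OF refl])
    fix j assume j: "j \<in> {..<q}"
    have "q dvd Suc (q * M + j) \<longleftrightarrow> q dvd Suc j"
      using dvd_add_right_iff[of q "q * M" "Suc j"] by simp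
    also have "\<dots> \<longleftrightarrow> j = q - 1" using j by (auto dest: dvd_imp_le)
    finally show "(if q dvd Suc (q * M + j) then 1 else 0) = (if j = q - 1 then 1 else (0::nat))" by simp
  qed
  also have "\<dots> = 1" using that by simp
  finally have *: "(\<Sum>j<q. if q dvd Suc (q * M + j) then 1 else 0) = (1 :: nat)" .
  show ?case unfolding mult_Suc_right add.commute[of q] sum_lessThan_add * using Suc by simp
qed simp

locale jordan_square = witt_square scaleV \<beta> n e scaleS \<sigma> u u0
  for scaleV :: "'k::alg_closed_field \<Rightarrow> 'v::ab_group_add \<Rightarrow> 'v" (infixr \<open>*s\<close> 75) and \<beta> n e
    and scaleS :: "'k \<Rightarrow> 's::ab_group_add \<Rightarrow> 's" (infixr \<open>*q\<close> 75) and \<sigma> u u0 +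
  fixes css :: "'v list list" and q a :: nat
  assumes jb: "jordan_basis scaleV u css"
    and char_prime: "prime CHAR('k)" and q_def: "q = CHAR('k) ^ a"
    and q_dvd: "\<And>xs. xs \<in> set css \<Longrightarrow> q dvd length xs"
begin

lemma q_pos: "q > 0" using char_prime by (simp add: q_def prime_gt_0_nat)

definition q1 where "q1 = q - 1"

lemma q_Suc: "q = Suc q1" using q_pos by (simp add: q1_def)

lemma obc: "ordered_basis scaleV (concat css)" using jb by (simp add: jordan_basis_def)

definition CB where "CB = set (concat css)"

lemma in_CB: "xs \<in> set css \<Longrightarrow> j < length xs \<Longrightarrow> xs ! j \<in> CB" by (force simp: CB_def)

lemma CB: "independent CB" "span CB = UNIV" using ordered_basisD[OF obc] by (simp_all add: CB_def)

lemma chain: "xs \<in> set css \<Longrightarrow> j < length xs \<Longrightarrow> u (xs ! j) = xs ! j + (if j = 0 then 0 else xs ! (j - 1))"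
  using jb by (simp add: jordan_basis_def jordan_chain_def algebra_simps)

lemma nonempty: "xs \<in> set css \<Longrightarrow> xs \<noteq> []" using jb by (auto simp: jordan_basis_def)

lemma distinct_css: "distinct (concat css)" using ordered_basisD(1)[OF obc] .

lemma position_unique:
  assumes "xs \<in> set css" "ys \<in> set css" "j < length xs" "k < length ys" "xs ! j = ys ! k"
  shows "xs = ys \<and> j = k"
proof -
  have "xs = ys"
  proof (rule ccontr)
    assume "xs \<noteq> ys"
    then have "set xs \<inter> set ys = {}" using distinct_css assms(1,2) by (simp add: distinct_concat_iff)
    then show False using assms(3-5) by (metis disjoint_iff nth_mem)
  qed
  moreover have "distinct xs" using distinct_css assms(1) by (simp add: distinct_concat_iff)
  ultimately show ?thesis using assms by (simp add: nth_eq_iff_index_eq)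
qed

lemma operator_exists:
  "\<exists>A. Vector_Spaces.linear scaleV scaleV A \<and> (\<forall>xs\<in>set css. \<forall>j<length xs. A (xs ! j) = f xs j)"
proof -
  interpret VV: vector_space_pair scaleV scaleV by unfold_locales
  define g where "g b = (let z = (SOME z. fst z \<in> set css \<and> snd z < length (fst z) \<and> fst z ! snd z = b) in f (fst z) (snd z))" for b
  have g: "g (xs ! j) = f xs j" if "xs \<in> set css" "j < length xs" for xs j
  proof -
    let ?R = "\<lambda>z. fst z \<in> set css \<and> snd z < length (fst z) \<and> fst z ! snd z = xs ! j"
    have "?R (SOME z. ?R z)" by (rule someI[of ?R "(xs, j)"]) (use that in simp)
    then have "fst (SOME z. ?R z) = xs \<and> snd (SOME z. ?R z) = j"
      using position_unique that by blast
    then show ?thesis by (simp add: g_def Let_def)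
  qed
  note ind = CB(1)
  show ?thesis
  proof (intro exI conjI ballI allI impI)
    show "Vector_Spaces.linear scaleV scaleV (VV.construct (CB) g)" by (rule VV.linear_construct[OF ind])
    fix xs j assume "xs \<in> set css" "j < length xs"
    then show "VV.construct (CB) g (xs ! j) = f xs j"
      using VV.construct_basis[OF ind in_CB, of xs j g] g by simp
  qed
qed

lemma operator_eqI:
  assumes "Vector_Spaces.linear scaleV scaleV A" "Vector_Spaces.linear scaleV scaleV B"
    and "\<And>xs j. xs \<in> set css \<Longrightarrow> j < length xs \<Longrightarrow> A (xs ! j) = B (xs ! j)"
  shows "A = B"
proof (rule linear_eq_on_basis[OF obc assms(1,2)])
  fix i assume "i < length (concat css)"
  then have "concat css ! i \<in> set (concat css)" by (rule nth_mem)
  then obtain xs j where "xs \<in> set css" "j < length xs" "concat css ! i = xs ! j" by (auto simp: in_set_conv_nth)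
  then show "A (concat css ! i) = B (concat css ! i)" using assms(3) by simp
qed

definition conjugate :: "('v \<Rightarrow> 'v) \<Rightarrow> 'v \<Rightarrow> 'v" where "conjugate A v = u (A (ui v))"
text \<open>The action of \<open>u - 1\<close> on endomorphisms by conjugation.\<close>

definition \<Delta> :: "('v \<Rightarrow> 'v) \<Rightarrow> 'v \<Rightarrow> 'v" where "\<Delta> A v = u (A (ui v)) - A v"
text \<open>This is the commutator with the nilpotent map \<open>u - 1\<close>.\<close>

definition ad :: "('v \<Rightarrow> 'v) \<Rightarrow> 'v \<Rightarrow> 'v" where "ad B v = u (B v) - B (u v)"

abbreviation lin :: "('v \<Rightarrow> 'v) \<Rightarrow> bool" where "lin A \<equiv> Vector_Spaces.linear scaleV scaleV A"

lemma lin_iff: "lin A \<longleftrightarrow> (\<forall>x y. A (x + y) = A x + A y) \<and> (\<forall>c x. A (c *s x) = c *s A x)"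
  by (simp add: module_hom_iff_linear[symmetric] module_hom_iff module_axioms)

lemma lin_0: "lin A \<Longrightarrow> A 0 = 0" using lin_iff[of A] by (metis scale_zero_left)

lemma lin_diff: "lin A \<Longrightarrow> A (x - y) = A x - A y"
  using lin_iff[of A] by (metis add_diff_cancel diff_add_cancel)

lemma u_lin: "lin u" by (rule u_linear)
lemma ui_lin: "lin ui" by (rule ui_linear)

lemma lin_ops: "lin A \<Longrightarrow> lin (conjugate A)" "lin A \<Longrightarrow> lin (\<Delta> A)" "lin A \<Longrightarrow> lin (ad A)"
  using u_lin ui_lin unfolding lin_iff by (auto simp: conjugate_def \<Delta>_def ad_def algebra_simps)

lemma lin_pow: "lin A \<Longrightarrow> lin ((\<Delta> ^^ m) A)" "lin A \<Longrightarrow> lin ((ad ^^ m) A)"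
  by (induction m) (simp_all add: lin_ops)

lemma \<Psi>_diff: "\<Psi> (\<lambda>v. A v - B v) = \<Psi> A - \<Psi> B"
  by (simp add: \<Psi>_def \<sigma>_lin sum_subtractf)

lemma X_\<Psi>: "lin A \<Longrightarrow> X (\<Psi> A) = \<Psi> (\<Delta> A)"
proof -
  assume A: "lin A"
  have "\<Delta> A = (\<lambda>v. (u \<circ> A \<circ> ui) v - A v)" by (simp add: \<Delta>_def fun_eq_iff)
  then show ?thesis unfolding X_def u0_\<Psi>[OF A] using \<Psi>_diff[of "u \<circ> A \<circ> ui" A] by simp
qed

lemma X_pow_\<Psi>: "lin A \<Longrightarrow> (X ^^ m) (\<Psi> A) = \<Psi> ((\<Delta> ^^ m) A)"
  by (induction m) (simp_all add: X_\<Psi> lin_pow)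

lemma \<Theta>_u0: "\<Theta> (u0 s) = conjugate (\<Theta> s)"
proof
  fix v
  have ui_prod: "\<beta> (u x) y = \<beta> x (ui y)" for x y
    using isometry_products[OF u_iso, of x "ui y"] by (simp add: ui_u)
  show "\<Theta> (u0 s) v = conjugate (\<Theta> s) v"
  proof (rule eq_by_products)
    fix i
    have "(\<lambda>s. T v (e i) (u0 s)) = T (ui v) (ui (e i))"
      by (rule functional_S_eqI[OF S.functional_comp[OF T(1) u0_linear] T(1)])
         (simp add: u0_\<sigma> T(2) ui_prod)
    then have "T v (e i) (u0 s) = T (ui v) (ui (e i)) s" by metis
    then show "\<beta> (\<Theta> (u0 s) v) (e i) = \<beta> (conjugate (\<Theta> s) v) (e i)"
      by (simp add: \<Theta>_product conjugate_def ui_prod)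
  qed
qed

lemma \<Theta>_X: "\<Theta> (X s) = \<Delta> (\<Theta> s)"
proof
  fix v
  have "\<Theta> (u0 s - s) v = \<Theta> (u0 s) v - \<Theta> s v"
    by (rule eq_by_products) (simp add: \<Theta>_product bil S.functionalD[OF T(1)])
  then show "\<Theta> (X s) v = \<Delta> (\<Theta> s) v" by (simp add: X_def \<Theta>_u0 conjugate_def \<Delta>_def)
qed

lemma \<Theta>_X_pow: "\<Theta> ((X ^^ m) s) = (\<Delta> ^^ m) (\<Theta> s)"
  by (induction m) (simp_all add: \<Theta>_X)

lemma \<Theta>_0: "\<Theta> 0 = (\<lambda>v. 0)"
  by (rule ext, rule eq_by_products) (simp add: \<Theta>_product bil S.functionalD[OF T(1)])

subsection \<open>Traces\<close>

lemma tr_comm: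
  assumes "lin A" "lin B"
  shows "tr (A \<circ> B) = tr (B \<circ> A)"
proof -
  have *: "tr (A \<circ> B) = (\<Sum>i\<in>I. \<Sum>j\<in>I. \<beta> (B (e i)) (e (d j)) * \<beta> (A (e j)) (e (d i)))" if "lin A" for A B
  proof -
    interpret A: Vector_Spaces.linear scaleV scaleV A by fact
    have "A (B (e i)) = (\<Sum>j\<in>I. \<beta> (B (e i)) (e (d j)) *s A (e j))" for i
      by (subst expansion[of "B (e i)"]) (simp add: A.sum A.scale)
    then show ?thesis by (simp add: tr_def bil)
  qed
  show ?thesis unfolding *[OF assms(1)] *[OF assms(2)]
    by (subst sum.swap) (simp add: mult.commute)
qed

lemma tr_diff: "tr (\<lambda>v. A v - B v) = tr A - tr B"
  by (simp add: tr_def bil sum_subtractf)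

lemma tr_conjugate: "lin A \<Longrightarrow> tr (conjugate A) = tr A"
proof -
  assume A: "lin A"
  have l: "lin (A \<circ> ui)" using A ui_lin by (simp add: lin_iff)
  have c: "conjugate A = u \<circ> (A \<circ> ui)" by (simp add: conjugate_def fun_eq_iff)
  have "tr (conjugate A) = tr ((A \<circ> ui) \<circ> u)" unfolding c by (rule tr_comm[OF u_lin l])
  also have "(A \<circ> ui) \<circ> u = A" by (simp add: fun_eq_iff ui_u)
  finally show ?thesis .
qed

lemma \<Delta>_conjugate: "lin A \<Longrightarrow> \<Delta> (conjugate A) = conjugate (\<Delta> A)"
  using lin_diff[OF u_lin] by (simp add: \<Delta>_def conjugate_def fun_eq_iff)

lemma \<Delta>_pow_conjugate: "lin A \<Longrightarrow> (\<Delta> ^^ m) (conjugate A) = conjugate ((\<Delta> ^^ m) A)"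
  by (induction m) (simp_all add: \<Delta>_conjugate lin_pow)

lemma tr_zero: "tr (\<lambda>v. 0) = 0" by (simp add: tr_def bil)

text \<open>Up to sign and conjugation \<open>\<Delta>\<close> is self-adjoint for the trace form. It follows that the image of a power of \<open>\<Delta>\<close> is
  orthogonal to the kernel of that power.\<close>

lemma tr_adjoint:
  assumes "lin A" "lin B"
  shows "tr (A \<circ> \<Delta> B) = - tr (\<Delta> A \<circ> conjugate B)"
proof -
  note uu = lin_diff[OF u_lin] 
  have lAB: "lin (A \<circ> B)" using assms by (simp add: lin_iff)
  have 1: "A \<circ> \<Delta> B = (\<lambda>v. (A \<circ> conjugate B) v - (A \<circ> B) v)"
    by (simp add: \<Delta>_def conjugate_def fun_eq_iff lin_diff[OF assms(1)])
  have 2: "\<Delta> A \<circ> conjugate B = (\<lambda>v. conjugate (A \<circ> B) v - (A \<circ> conjugate B) v)"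
    by (simp add: \<Delta>_def conjugate_def fun_eq_iff ui_u)
  show ?thesis unfolding 1 2 tr_diff tr_conjugate[OF lAB] by (simp add: comp_def)
qed

lemma tr_orthogonal:
  assumes "lin A" "lin B" "(\<Delta> ^^ m) A = (\<lambda>v. 0)"
  shows "tr (A \<circ> (\<Delta> ^^ m) B) = 0"
  using assms
proof (induction m arbitrary: A B)
  case 0
  then show ?case by (simp add: comp_def tr_zero)
next
  case (Suc m)
  have "tr (A \<circ> (\<Delta> ^^ Suc m) B) = - tr (\<Delta> A \<circ> (\<Delta> ^^ m) (conjugate B))"
    using tr_adjoint[OF Suc.prems(1) lin_pow(1)[OF Suc.prems(2)]] by (simp add: \<Delta>_pow_conjugate[OF Suc.prems(2)])
  also have "tr (\<Delta> A \<circ> (\<Delta> ^^ m) (conjugate B)) = 0"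
    by (rule Suc.IH) (use Suc.prems lin_ops in \<open>auto simp: funpow_swap1\<close>)
  finally show ?case by simp
qed

text \<open>As \<open>\<omega>\<close> corresponds to the identity, \<open>\<tau>\<close> is the pairing with \<open>\<omega>\<close> for the trace form.\<close>

lemma \<omega>_image_orthogonal:
  assumes "(X ^^ m) s = 0" "(X ^^ m) s' = \<omega>"
  shows "\<tau> s = 0"
proof -
  have "(\<Delta> ^^ m) (\<Theta> s) = (\<lambda>v. 0)" using assms(1) by (simp add: \<Theta>_0 flip: \<Theta>_X_pow)
  moreover have "(\<Delta> ^^ m) (\<Theta> s') = id" using assms(2) by (simp add: \<Theta>_\<omega> flip: \<Theta>_X_pow)
  ultimately have "tr (\<Theta> s) = 0" using tr_orthogonal[OF linear_\<Theta> linear_\<Theta>, of m s s'] by simp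
  then show ?thesis using \<tau>_\<Psi>[of "\<Theta> s"] by (simp add: \<Psi>_\<Theta>)
qed

lemma tr_basis:
  assumes "lin A"
  shows "tr A = (\<Sum>xs\<leftarrow>css. \<Sum>j<length xs. representation (CB) (A (xs ! j)) (xs ! j))"
proof -
  let ?bs = "concat css"
  define c' where "c' j = (\<Sum>i\<in>I. coord scaleV ?bs j (e i) *s e (d i))" for j
  have dual: "\<beta> v (c' j) = coord scaleV ?bs j v" for v j
    unfolding functional_expansion[OF linear_coord[OF obc], of j v] by (simp add: c'_def bil mult.commute)
  have "v = (\<Sum>j<length ?bs. \<beta> v (c' j) *s ?bs ! j)" for v
    unfolding dual by (rule coord_expansion[OF obc, symmetric])
  then have "\<Psi> A = (\<Sum>j<length ?bs. \<sigma> (A (?bs ! j)) (c' j))" using \<Psi>_dual_family[OF assms] by metis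
  then have "tr A = (\<Sum>j<length ?bs. coord scaleV ?bs j (A (?bs ! j)))"
    using \<tau>_\<Psi>[of A] by (simp add: S.functionalD[OF \<tau>(1)] \<tau>(2) dual)
  also have "\<dots> = (\<Sum>b\<leftarrow>?bs. representation (set ?bs) (A b) b)"
    by (simp add: coord_def sum_list_sum_nth atLeast0LessThan)
  also have "\<dots> = (\<Sum>xs\<leftarrow>css. \<Sum>b\<leftarrow>xs. representation (set ?bs) (A b) b)"
  proof -
    have "sum_list (map g (concat yss)) = (\<Sum>xs\<leftarrow>yss. sum_list (map g xs))" for g :: "'v \<Rightarrow> 'k" and yss
      by (induction yss) auto
    then show ?thesis .
  qed
  also have "\<dots> = (\<Sum>xs\<leftarrow>css. \<Sum>j<length xs. representation (set ?bs) (A (xs ! j)) (xs ! j))"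
    by (simp add: sum_list_sum_nth atLeast0LessThan)
  finally show ?thesis unfolding CB_def .
qed

subsection \<open>A relative trace of the identity\<close>

text \<open>Since \<open>\<Delta> (B \<circ> u) = ad B\<close>, right multiplication by powers of \<open>u\<close> turns powers of \<open>\<Delta>\<close> into iterated commutators with
  \<open>u - 1\<close>, which are easy to evaluate on Jordan chains.\<close>

lemma \<Delta>_pow_shift: "(\<Delta> ^^ k) (B \<circ> (u ^^ k)) = (ad ^^ k) B"
proof (induction k arbitrary: B)
  case (Suc k)
  have "\<Delta> (B \<circ> (u ^^ Suc k)) = ad B \<circ> (u ^^ k)"
  proof
    fix v
    have "(u ^^ Suc k) (ui v) = (u ^^ k) v" by (simp add: funpow_swap1 ui_u)
    then show "\<Delta> (B \<circ> (u ^^ Suc k)) v = (ad B \<circ> (u ^^ k)) v"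
      by (simp add: \<Delta>_def ad_def)
  qed
  then have "(\<Delta> ^^ Suc k) (B \<circ> (u ^^ Suc k)) = (\<Delta> ^^ k) (ad B \<circ> (u ^^ k))"
    by (simp only: funpow_Suc_right comp_apply)
  also have "\<dots> = (ad ^^ k) (ad B)" by (rule Suc)
  also have "\<dots> = (ad ^^ Suc k) B" by (simp only: funpow_Suc_right comp_apply)
  finally show ?case .
qed simp

text \<open>Divide each chain into windows of length \<open>q\<close>. This map sends the bottom of a window to its top and kills the other
  basis vectors. The set \<open>Y\<close> selects the chains on which the map is nonzero.\<close>

definition shift :: "'v list set \<Rightarrow> 'v \<Rightarrow> 'v" where
  "shift Y = (SOME A. lin A \<and> (\<forall>xs\<in>set css. \<forall>j<length xs.
     A (xs ! j) = (if xs \<in> Y \<and> q dvd j then xs ! (j + q1) else 0)))"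

definition proj :: "'v list set \<Rightarrow> 'v \<Rightarrow> 'v" where
  "proj Y = (SOME A. lin A \<and> (\<forall>xs\<in>set css. \<forall>j<length xs. A (xs ! j) = (if xs \<in> Y then xs ! j else 0)))"

lemma shift: "lin (shift Y)"
  "xs \<in> set css \<Longrightarrow> j < length xs \<Longrightarrow> shift Y (xs ! j) = (if xs \<in> Y \<and> q dvd j then xs ! (j + q1) else 0)"
  using someI_ex[OF operator_exists[of "\<lambda>xs j. if xs \<in> Y \<and> q dvd j then xs ! (j + q1) else 0"]]
  unfolding shift_def[symmetric] by blast+

lemma proj: "lin (proj Y)"
  "xs \<in> set css \<Longrightarrow> j < length xs \<Longrightarrow> proj Y (xs ! j) = (if xs \<in> Y then xs ! j else 0)"
  using someI_ex[OF operator_exists[of "\<lambda>xs j. if xs \<in> Y then xs ! j else 0"]]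
  unfolding proj_def[symmetric] by blast+

lemma proj_all: "proj (set css) = id"
  by (rule operator_eqI[OF proj(1) linear_id']) (simp add: proj)

lemma \<Delta>_proj: "\<Delta> (proj Y) = (\<lambda>v. 0)"
proof -
  have "u \<circ> proj Y = proj Y \<circ> u"
  proof (rule operator_eqI)
    show "lin (u \<circ> proj Y)" "lin (proj Y \<circ> u)" using u_lin proj(1) by (simp_all add: lin_iff)
    fix xs j assume x: "xs \<in> set css" "j < length xs"
    have "proj Y (u (xs ! j)) = proj Y (xs ! j) + proj Y (if j = 0 then 0 else xs ! (j - 1))"
      using chain[OF x] proj(1)[of Y] by (simp add: lin_iff)
    also have "\<dots> = u (proj Y (xs ! j))"
      using x proj(2)[OF x, of Y] proj(2)[of xs "j - 1" Y] by (auto simp: chain lin_0[OF proj(1)] lin_0[OF u_lin])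
    finally show "(u \<circ> proj Y) (xs ! j) = (proj Y \<circ> u) (xs ! j)" by simp
  qed
  then have "u (proj Y (ui v)) = proj Y (u (ui v))" for v by (metis comp_apply)
  then show ?thesis by (simp add: \<Delta>_def fun_eq_iff ui_u)
qed

text \<open>The window which contains position \<open>j\<close> ends within the chain because \<open>q\<close> divides its length.\<close>

lemma window:
  assumes "xs \<in> set css" "j < length xs"
  shows "j - j mod q + q \<le> length xs"
proof -
  obtain M where M: "length xs = q * M" using q_dvd[OF assms(1)] by blast
  have "j div q < M" using assms(2) M q_pos by (simp add: less_mult_imp_div_less mult.commute)
  then have "q * (j div q) + q \<le> q * M" by (metis Suc_leI mult_Suc_right add.commute mult_le_mono2)
  then show ?thesis using M by (simp add: minus_mod_eq_mult_div)
qed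

text \<open>Of the terms \<open>N\<^bsup>m - i\<^esup> shift N\<^bsup>i\<^esup>\<close> of the iterated commutator only the one with \<open>i = j mod q\<close> is
  nonzero at the basis vector with number \<open>j\<close>.\<close>

lemma ad_pow_shift:
  assumes "m \<le> q1" "xs \<in> set css" "j < length xs"
  shows "(ad ^^ m) (shift Y) (xs ! j) =
    (if xs \<in> Y then ((- 1) ^ (j mod q) * of_nat (m choose (j mod q))) *s xs ! (j + q1 - m) else 0)"
  using assms
proof (induction m arbitrary: j)
  case 0
  have "(j mod q = 0) = (q dvd j)" by (simp add: dvd_eq_mod_eq_0)
  then show ?case using shift(2)[OF "0.prems"(2,3)] by (cases "j mod q") auto
next
  case (Suc m)
  let ?B = "(ad ^^ m) (shift Y)"
  have lB: "lin ?B" by (rule lin_pow(2)[OF shift(1)])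
  note x = Suc.prems(2,3)
  have m: "m \<le> q1" "Suc m < q" using Suc.prems(1) q_Suc by auto
  define i where "i = j mod q"
  define k where "k = j + q1 - Suc m"
  have k: "j + q1 - m = Suc k" using Suc.prems(1) unfolding k_def by linarith
  have B: "?B (xs ! j) = (if xs \<in> Y then ((- 1) ^ i * of_nat (m choose i)) *s xs ! Suc k else 0)"
    using Suc.IH[OF m(1) x] by (simp add: k i_def)
  have "u (?B (xs ! j)) - ?B (xs ! j) = (if xs \<in> Y then ((- 1) ^ i * of_nat (m choose i)) *s xs ! k else 0)"
  proof (cases "xs \<in> Y \<and> i \<le> m")
    case True
    have "Suc k < length xs"
      using window[OF x] True k q_Suc mod_less_eq_dividend[of j q] unfolding i_def by linarith
    then have "u (xs ! Suc k) = xs ! Suc k + xs ! k" using chain[OF x(1)] by simp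
    then show ?thesis using True u_lin by (simp add: B lin_iff scale_right_distrib)
  next
    case False
    then have "xs \<notin> Y \<or> m < i" by auto
    then show ?thesis by (auto simp: B lin_0[OF u_lin] binomial_eq_0)
  qed
  moreover have "?B (u (xs ! j)) = ?B (xs ! j) + (if j = 0 then 0 else ?B (xs ! (j - 1)))"
    using chain[OF x] lB lin_0[OF lB] by (simp add: lin_iff)
  ultimately have step: "(ad ^^ Suc m) (shift Y) (xs ! j) =
      (if xs \<in> Y then ((- 1) ^ i * of_nat (m choose i)) *s xs ! k else 0) - (if j = 0 then 0 else ?B (xs ! (j - 1)))"
    by (simp add: ad_def[of ?B] algebra_simps)
  show ?case
  proof (cases "i = 0")
    case True
    have "?B (xs ! (j - 1)) = 0" if "j \<noteq> 0"
    proof -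
      have "(j - 1) mod q = q1"
        using True that q_Suc unfolding i_def
        by (metis One_nat_def Suc_pred' diff_Suc_1 gr0I mod_Suc nat.distinct(1))
      then have "m < (j - 1) mod q" using m q_Suc by simp
      then have "(m choose ((j - 1) mod q)) = 0" by (rule binomial_eq_0)
      then show ?thesis using Suc.IH[OF m(1) x(1), of "j - 1"] x(2) by (simp add: binomial_eq_0 del: One_nat_def)
    qed
    then show ?thesis using step True by (simp add: i_def k_def)
  next
    case False
    then obtain i' where i': "i = Suc i'" by (cases i) auto
    have j0: "j \<noteq> 0" by (rule notI) (use False in \<open>simp add: i_def\<close>)
    have "(j - 1) mod q = i'"
      using i' j0 unfolding i_def by (metis One_nat_def Suc_pred' diff_Suc_1 gr0I mod_Suc nat.distinct(1) nat.inject)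
    moreover have "j - 1 + q1 - m = k" using j0 m by (simp add: k_def)
    ultimately have B': "?B (xs ! (j - 1)) = (if xs \<in> Y then ((- 1) ^ i' * of_nat (m choose i')) *s xs ! k else 0)"
      using Suc.IH[OF m(1) x(1), of "j - 1"] x(2) by (simp del: One_nat_def)
    have "(- 1) ^ i * of_nat (m choose i) - (- 1) ^ i' * of_nat (m choose i') = ((- 1) ^ i * of_nat (Suc m choose i) :: 'k)"
      by (simp add: i' algebra_simps)
    then have "((- 1) ^ i * of_nat (m choose i)) *s xs ! k - ((- 1) ^ i' * of_nat (m choose i')) *s xs ! k
        = ((- 1) ^ i * of_nat (Suc m choose i)) *s xs ! k"
      by (metis scale_left_diff_distrib)
    then show ?thesis using step B' j0 by (simp add: i_def[symmetric] k_def[symmetric])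
  qed
qed

text \<open>In characteristic \<open>p\<close> the binomial coefficients of \<open>q - 1\<close> are \<open>\<plusminus>1\<close> and cancel the signs.\<close>

lemma ad_top_shift: "(ad ^^ q1) (shift Y) = proj Y"
proof (rule operator_eqI[OF lin_pow(2)[OF shift(1)] proj(1)])
  fix xs j assume x: "xs \<in> set css" "j < length xs"
  have "(- 1) ^ (j mod q) * of_nat (q1 choose (j mod q)) = (1 :: 'k)"
    unfolding q1_def by (rule choose_pred_prime_power[OF char_prime q_def mod_less_divisor[OF q_pos]])
  then show "(ad ^^ q1) (shift Y) (xs ! j) = proj Y (xs ! j)"
    by (simp add: ad_pow_shift[OF order_refl x] proj(2)[OF x])
qed

text \<open>An endomorphism whose relative trace from the subgroup generated by \<open>u ^ q\<close> is the projection to the chains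
  in \<open>Y\<close>. The relative trace is \<open>\<Delta> ^^ (q - 1)\<close>, because \<open>(x - 1) ^ (q - 1) = 1 + x + \<dots> + x ^ (q - 1)\<close> in characteristic \<open>p\<close>.\<close>

definition R where "R Y = shift Y \<circ> (u ^^ q1)"

lemma lin_u_pow: "lin (u ^^ m)" by (rule linear_funpow[OF u_lin])

lemma lin_R: "lin (R Y)" unfolding R_def using shift(1) lin_u_pow by (simp add: lin_iff)

lemma \<Delta>_R: "(\<Delta> ^^ q1) (R Y) = proj Y"
  unfolding R_def \<Delta>_pow_shift by (rule ad_top_shift)

lemma u_pow_basis:
  assumes "xs \<in> set css" "j < length xs"
  shows "(u ^^ m) (xs ! j) = (\<Sum>k\<le>j. of_nat (m choose k) *s xs ! (j - k))"
  using assms(2)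
proof (induction m arbitrary: j)
  case 0
  have "(\<Sum>k\<le>j. of_nat (0 choose k) *s xs ! (j - k)) = (\<Sum>k\<le>j. if k = 0 then xs ! j else 0)"
    by (rule sum.cong) (auto split: nat.splits simp: gr0_conv_Suc)
  then show ?case by simp
next
  case (Suc m)
  have "(u ^^ Suc m) (xs ! j) = (u ^^ m) (xs ! j) + (if j = 0 then 0 else (u ^^ m) (xs ! (j - 1)))"
    using chain[OF assms(1) Suc.prems] lin_u_pow[of m] lin_0[OF lin_u_pow[of m]]
    by (simp add: funpow_swap1 lin_iff)
  also have "\<dots> = (\<Sum>k\<le>j. of_nat (Suc m choose k) *s xs ! (j - k))"
  proof (cases j)
    case 0
    then show ?thesis using Suc by simp
  next
    case (Suc j')
    have "(\<Sum>k\<le>Suc j'. of_nat (Suc m choose k) *s xs ! (Suc j' - k))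
       = xs ! Suc j' + (\<Sum>k\<le>j'. of_nat (m choose Suc k) *s xs ! (j' - k)) + (\<Sum>k\<le>j'. of_nat (m choose k) *s xs ! (j' - k))"
      by (subst sum.atMost_Suc_shift) (simp add: scale_left_distrib sum.distrib algebra_simps)
    moreover have "(\<Sum>k\<le>Suc j'. of_nat (m choose k) *s xs ! (Suc j' - k)) = xs ! Suc j' + (\<Sum>k\<le>j'. of_nat (m choose Suc k) *s xs ! (j' - k))"
      by (subst sum.atMost_Suc_shift) simp
    ultimately show ?thesis using Suc.IH[of j] Suc.IH[of j'] Suc.prems \<open>j = Suc j'\<close> by simp
  qed
  finally show ?case .
qed

text \<open>In the binomial expansion of \<open>u ^ (q - 1)\<close> only the power \<open>(u - 1) ^ (q - 1)\<close>, which maps the top of a window to its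
  bottom, contributes to the diagonal. Each window contributes 1.\<close>

lemma tr_R: "tr (R Y) = (\<Sum>xs\<leftarrow>css. if xs \<in> Y then of_nat (length xs div q) else 0)"
proof -
  let ?B = CB
  note bas = CB
  have rep: "representation ?B (xs ! i) (xs ! j) = (if i = j then 1 else 0)"
    if "xs \<in> set css" "i < length xs" "j < length xs" for xs i j
  proof -
    have "xs ! i \<in> ?B" by (rule in_CB[OF that(1,2)])
    then have "representation ?B (xs ! i) (xs ! j) = (if xs ! j = xs ! i then 1 else 0)"
      using representation_basis[OF bas(1)] by simp
    then show ?thesis using position_unique[OF that(1,1) that(2,3)] by auto
  qed
  have dvd_iff: "q1 \<le> j \<and> q dvd (j - q1) \<longleftrightarrow> q dvd Suc j" for j
  proof
    assume "q dvd Suc j"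
    then have "q \<le> Suc j" by (auto dest: dvd_imp_le)
    then have "j - q1 = Suc j - q" using q_Suc by simp
    then show "q1 \<le> j \<and> q dvd (j - q1)" using \<open>q dvd Suc j\<close> \<open>q \<le> Suc j\<close> q_Suc by (metis Suc_le_mono dvd_diff_nat dvd_refl)
  next
    assume *: "q1 \<le> j \<and> q dvd (j - q1)"
    then have "Suc j = (j - q1) + q" using q_Suc by simp
    then show "q dvd Suc j" using * by (metis dvd_add dvd_refl)
  qed
  have val: "representation ?B (R Y (xs ! j)) (xs ! j) = (if xs \<in> Y \<and> q dvd Suc j then 1 else 0)"
    if x: "xs \<in> set css" "j < length xs" for xs j
  proof -
    interpret sh: Vector_Spaces.linear scaleV scaleV "shift Y" by (rule shift(1))
    have "R Y (xs ! j) = (\<Sum>k\<le>j. of_nat (q1 choose k) *s (if xs \<in> Y \<and> q dvd (j - k) then xs ! (j - k + q1) else 0))"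
      using x by (simp add: R_def u_pow_basis sh.sum sh.scale shift(2))
    then have "representation ?B (R Y (xs ! j)) (xs ! j) =
        (\<Sum>k\<le>j. of_nat (q1 choose k) * (if xs \<in> Y \<and> q dvd (j - k) then representation ?B (xs ! (j - k + q1)) (xs ! j) else 0))"
      by (simp add: representation_sum representation_scale bas)
        (rule sum.cong, auto simp: representation_zero)
    also have "\<dots> = (\<Sum>k\<le>j. if k = q1 \<and> xs \<in> Y \<and> q dvd (j - k) then 1 else 0)"
    proof (rule sum.cong[OF refl])
      fix k assume k: "k \<in> {..j}"
      show "of_nat (q1 choose k) * (if xs \<in> Y \<and> q dvd (j - k) then representation ?B (xs ! (j - k + q1)) (xs ! j) else 0)
        = (if k = q1 \<and> xs \<in> Y \<and> q dvd (j - k) then 1 else 0 :: 'k)"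
      proof (cases "xs \<in> Y \<and> q dvd (j - k)")
        case True
        have "(j - k) mod q = 0" "j - k < length xs" using True x(2) by simp_all
        then have "j - k + q1 < length xs" using window[OF x(1), of "j - k"] x(2) q_Suc by simp
        then have "representation ?B (xs ! (j - k + q1)) (xs ! j) = (if j - k + q1 = j then 1 else 0)"
          using rep[OF x(1) _ x(2)] by blast
        moreover have "j - k + q1 = j \<longleftrightarrow> k = q1" using k by auto
        ultimately show ?thesis using True by simp
      next
        case False
        then show ?thesis by auto
      qed
    qed
    also have "\<dots> = (\<Sum>k\<le>j. if k = q1 then (if xs \<in> Y \<and> q dvd (j - q1) then 1 else 0) else 0)"
      by (rule sum.cong) auto
    also have "\<dots> = (if q1 \<le> j \<and> xs \<in> Y \<and> q dvd (j - q1) then 1 else 0)"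
      by simp
    also have "\<dots> = (if xs \<in> Y \<and> q dvd Suc j then 1 else 0)" using dvd_iff[of j] by auto
    finally show ?thesis .
  qed
  have "(\<Sum>j<length xs. representation ?B (R Y (xs ! j)) (xs ! j)) = (if xs \<in> Y then of_nat (length xs div q) else 0)"
    if x: "xs \<in> set css" for xs
  proof -
    have "(\<Sum>j<length xs. representation ?B (R Y (xs ! j)) (xs ! j)) = (\<Sum>j<length xs. if xs \<in> Y \<and> q dvd Suc j then 1 else 0)"
      by (rule sum.cong) (simp_all add: val[OF x])
    also have "\<dots> = (if xs \<in> Y then of_nat (\<Sum>j<length xs. if q dvd Suc j then 1 else 0) else 0)"
      by (simp add: of_nat_sum if_distrib cong: if_cong)
    also have "(\<Sum>j<length xs. if q dvd Suc j then 1 else 0) = length xs div q"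
      using count_multiples[OF q_pos, of "length xs div q"] q_dvd[OF x] by simp
    finally show ?thesis .
  qed
  then show ?thesis unfolding tr_basis[OF lin_R] by (intro arg_cong[of _ _ sum_list] map_cong refl) auto
qed

lemma n_eq: "n = (\<Sum>xs\<leftarrow>css. length xs)"
  using ordered_basis_length[OF obc] ordered_basis_length[OF ob] by (simp add: length_concat)

lemma n_div_q: "n div q = (\<Sum>xs\<leftarrow>css. length xs div q)" "q dvd n"
proof -
  have "q * (\<Sum>xs\<leftarrow>yss. length xs div q) = (\<Sum>xs\<leftarrow>yss. length xs)" if "set yss \<subseteq> set css" for yss :: "'v list list"
    using that by (induction yss) (auto simp: distrib_left q_dvd)
  then have "n = q * (\<Sum>xs\<leftarrow>css. length xs div q)" using n_eq by simp
  then show "n div q = (\<Sum>xs\<leftarrow>css. length xs div q)" "q dvd n" using q_pos by (metis nonzero_mult_div_cancel_left less_numeral_extra(3), simp)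
qed

subsection \<open>The position of \<open>\<omega>\<close> in the Jordan filtration\<close>

lemma \<omega>_depth: "(X ^^ q1) (\<Psi> (R (set css))) = \<omega>" "\<tau> (\<Psi> (R (set css))) = of_nat (n div q)"
proof -
  show "(X ^^ q1) (\<Psi> (R (set css))) = \<omega>" by (simp add: X_pow_\<Psi>[OF lin_R] \<Delta>_R proj_all \<omega>_def)
  have "(\<Sum>xs\<leftarrow>yss. if xs \<in> set css then of_nat (length xs div q) else 0) = (of_nat (\<Sum>xs\<leftarrow>yss. length xs div q) :: 'k)"
    if "set yss \<subseteq> set css" for yss
    using that by (induction yss) auto
  then show "\<tau> (\<Psi> (R (set css))) = of_nat (n div q)" by (simp add: \<tau>_\<Psi> tr_R n_div_q)
qed

text \<open>Use the summand of the relative trace of the identity that belongs to the chain \<open>xs\<close>. Its relative trace is a projection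
  commuting with \<open>u\<close>, so one further application of \<open>\<Delta>\<close> gives 0.\<close>

lemma block_tensor:
  assumes xs: "xs \<in> set css" and nd: "\<not> CHAR('k) dvd length xs div q"
  shows "\<exists>z. (X ^^ q) z = 0 \<and> \<tau> z \<noteq> 0"
proof -
  have "distinct css"
  proof -
    have "distinct (removeAll [] css)" using distinct_css by (simp add: distinct_concat_iff)
    moreover have "removeAll [] css = css" using nonempty by (intro removeAll_id) blast
    ultimately show ?thesis by simp
  qed
  have "tr (R {xs}) = (\<Sum>ys\<leftarrow>css. if ys = xs then of_nat (length xs div q) else 0)"
    unfolding tr_R by (intro arg_cong[of _ _ sum_list] map_cong refl) auto
  also have "\<dots> = (\<Sum>ys\<in>set css. if ys = xs then of_nat (length xs div q) else 0)"
    by (rule sum_list_distinct_conv_sum_set[OF \<open>distinct css\<close>])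
  also have "\<dots> = of_nat (length xs div q)" using xs by simp
  finally have "\<tau> (\<Psi> (R {xs})) \<noteq> 0" using nd by (simp add: \<tau>_\<Psi> of_nat_eq_0_iff_char_dvd)
  moreover have "(X ^^ q) (\<Psi> (R {xs})) = 0"
  proof -
    have "(\<Delta> ^^ Suc q1) (R {xs}) = (\<lambda>v. 0)" by (simp add: \<Delta>_R \<Delta>_proj)
    then show ?thesis using X_pow_\<Psi>[OF lin_R, of q "{xs}"] q_Suc by (simp add: \<Psi>_def \<sigma>_lin(7)[of _ 0 0, simplified] \<sigma>_lin_left(2)[of 0 0, simplified])
  qed
  ultimately show ?thesis by blast
qed

text \<open>Every \<open>u\<close>-invariant tensor is a relative trace: multiply the relative trace of the identity by
  the corresponding endomorphism, which commutes with \<open>u\<close>.\<close>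

lemma kernel_in_image: "X s = 0 \<Longrightarrow> \<exists>s'. (X ^^ q1) s' = s"
proof -
  assume s: "X s = 0"
  define B where "B = \<Theta> s"
  have lB: "lin B" unfolding B_def by (rule linear_\<Theta>)
  have "\<Delta> B = (\<lambda>v. 0)" using s \<Theta>_X[of s] by (simp add: \<Theta>_0 B_def)
  then have "u (B (ui v)) = B v" for v by (metis \<Delta>_def eq_iff_diff_eq_0)
  then have comm: "u (B v) = B (u v)" for v by (metis ui_u(2))
  have \<Delta>B: "\<Delta> (B \<circ> A) = B \<circ> \<Delta> A" for A
    by (simp add: \<Delta>_def fun_eq_iff comm lin_diff[OF lB])
  have "(\<Delta> ^^ m) (B \<circ> A) = B \<circ> (\<Delta> ^^ m) A" for m A
  proof (induction m)
    case (Suc m)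
    show ?case by (simp only: funpow.simps comp_apply[of \<Delta>] Suc \<Delta>B)
  qed simp
  from this[of q1 "R (set css)"] have "(\<Delta> ^^ q1) (B \<circ> R (set css)) = B" unfolding \<Delta>_R proj_all by simp
  moreover have "lin (B \<circ> R (set css))" using lB lin_R by (simp add: lin_iff)
  ultimately have "(X ^^ q1) (\<Psi> (B \<circ> R (set css))) = \<Psi> B" by (simp add: X_pow_\<Psi>)
  then show ?thesis unfolding B_def \<Psi>_\<Theta> by blast
qed

end

section \<open>Kernel dimensions on the irreducible module\<close>

lemma dim_functional_kernel:
  assumes V: "finite_dimensional_vector_space s1 B1" and f: "functional s1 \<phi>" and U: "module.subspace s1 U"
  shows "vector_space.dim s1 U = (if \<forall>x\<in>U. \<phi> x = 0 then 0 else 1) + vector_space.dim s1 {x \<in> U. \<phi> x = 0}"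
proof -
  interpret V: finite_dimensional_vector_space s1 B1 by fact
  interpret K: vector_space "(*) :: 'a \<Rightarrow> 'a \<Rightarrow> 'a" by (rule vector_space_field)
  have sp: "K.span {1} = UNIV"
  proof -
    have "x \<in> K.span {1}" for x using K.span_scale[OF K.span_base[of 1 "{1}"], of x] by simp
    then show ?thesis by blast
  qed
  interpret K: finite_dimensional_vector_space "(*) :: 'a \<Rightarrow> 'a \<Rightarrow> 'a" "{1}"
    by unfold_locales (use sp in auto)
  have "K.dim (\<phi> ` U) = (if \<forall>x\<in>U. \<phi> x = 0 then 0 else 1)"
  proof (cases "\<forall>x\<in>U. \<phi> x = 0")
    case True
    then have "\<phi> ` U \<subseteq> {0}" by auto
    then show ?thesis using True by (simp add: K.dim_eq_0)
  next
    case False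
    then obtain x where x: "x \<in> U" "\<phi> x \<noteq> 0" by blast
    have "y \<in> \<phi> ` U" for y
    proof
      show "s1 (y / \<phi> x) x \<in> U" using U x(1) by (rule V.subspace_scale)
      show "y = \<phi> (s1 (y / \<phi> x) x)" using x(2) by (simp add: V.functionalD[OF f])
    qed
    then have "\<phi> ` U = UNIV" by blast
    moreover have "K.dim UNIV = 1" by (simp add: K.dim_UNIV)
    ultimately show ?thesis using False by auto
  qed
  then show ?thesis using rank_nullity[OF V K.vector_space_axioms f U] by simp
qed

context witt_square
begin

text \<open>With \<open>N = u - 1\<close>, a product \<open>v w\<close> is mapped to \<open>N v N w + N v w + v N w\<close>, which raises the total number of factors \<open>N\<close>.\<close>

lemma X_nilpotent:
  assumes nil: "(\<lambda>v. u v - v) ^^ M = (\<lambda>v. 0)"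
  shows "(X ^^ (2 * M)) s = 0"
proof -
  define N where "N v = u v - v" for v
  define F where "F m = {\<sigma> ((N ^^ i) v) ((N ^^ j) w) | i j v w. m \<le> i + j}" for m
  interpret X: Vector_Spaces.linear scaleS scaleS X by (rule X_linear)
  have X\<sigma>: "X (\<sigma> v w) = \<sigma> (N v) (N w) + \<sigma> (N v) w + \<sigma> v (N w)" for v w
    by (simp add: X_def u0_\<sigma> N_def \<sigma>_lin)
  have mem: "\<sigma> ((N ^^ i) v) ((N ^^ j) w) \<in> F m" if "m \<le> i + j" for m i j v w
    using that unfolding F_def by blast
  have step: "X ` S.span (F m) \<subseteq> S.span (F (Suc m))" for m
  proof -
    have "X y \<in> S.span (F (Suc m))" if y: "y \<in> F m" for y
    proof -
      obtain i j v w where y: "y = \<sigma> ((N ^^ i) v) ((N ^^ j) w)" "m \<le> i + j"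
        using y unfolding F_def by blast
      have "\<sigma> ((N ^^ Suc i) v) ((N ^^ Suc j) w) \<in> F (Suc m)" "\<sigma> ((N ^^ Suc i) v) ((N ^^ j) w) \<in> F (Suc m)"
        "\<sigma> ((N ^^ i) v) ((N ^^ Suc j) w) \<in> F (Suc m)"
        by (rule mem, use y(2) in simp)+
      then show ?thesis unfolding y(1) X\<sigma> by (intro S.span_add S.span_base) simp_all
    qed
    then have "X ` F m \<subseteq> S.span (F (Suc m))" by blast
    then have "S.span (X ` F m) \<subseteq> S.span (F (Suc m))" by (rule S.span_minimal) simp
    then show ?thesis by (simp add: X.span_image)
  qed
  have "{\<sigma> v w | v w. True} \<subseteq> F 0"
  proof
    fix y assume "y \<in> {\<sigma> v w | v w. True}"
    then obtain v w where "y = \<sigma> ((N ^^ 0) v) ((N ^^ 0) w)" by auto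
    then show "y \<in> F 0" unfolding F_def by blast
  qed
  then have F0: "S.span (F 0) = UNIV" using span_\<sigma> S.span_mono[of _ "F 0"] by blast
  have "(X ^^ m) s \<in> S.span (F m)" for m
    by (induction m) (use F0 step in auto)
  moreover have "S.span (F (2 * M)) \<subseteq> {0}"
  proof (rule S.span_minimal)
    have zero: "(N ^^ i) v = 0" if "M \<le> i" for i v
    proof -
      have "(N ^^ i) v = (N ^^ M) ((N ^^ (i - M)) v)"
        using that by (simp flip: funpow_add comp_apply[of "N ^^ M"])
      moreover have "N ^^ M = (\<lambda>v. 0)" using nil by (simp add: N_def[abs_def])
      ultimately show ?thesis by simp
    qed
    have \<sigma>0: "\<sigma> 0 w = 0" "\<sigma> v 0 = 0" for v w using \<sigma>_lin_left(2)[of 0 0] \<sigma>_lin_right(2)[of _ 0 0] by simp_all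
    show "F (2 * M) \<subseteq> {0}"
    proof
      fix y assume "y \<in> F (2 * M)"
      then obtain i j v w where y: "y = \<sigma> ((N ^^ i) v) ((N ^^ j) w)" "2 * M \<le> i + j" by (auto simp: F_def)
      then have "M \<le> i \<or> M \<le> j" by linarith
      then show "y \<in> {0}" using y(1) zero \<sigma>0 by auto
    qed
  qed simp
  ultimately show ?thesis by blast
qed

end

locale jordan_highest_weight = highest_weight_square scaleV \<beta> n e scaleW \<rho> scaleS \<sigma> u u0 +
    jordan_square scaleV \<beta> n e scaleS \<sigma> u u0 css q a
  for scaleV :: "'k::alg_closed_field \<Rightarrow> 'v::ab_group_add \<Rightarrow> 'v" (infixr \<open>*s\<close> 75) and \<beta> n e
    and scaleW :: "'k \<Rightarrow> 'w::ab_group_add \<Rightarrow> 'w" (infixr \<open>*w\<close> 75) and \<rho>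
    and scaleS :: "'k \<Rightarrow> 's::ab_group_add \<Rightarrow> 's" (infixr \<open>*q\<close> 75) and \<sigma> u u0 and css q a
begin

definition ker where "ker m = {s. (X ^^ m) s = 0}"

definition \<kappa> where "\<kappa> m = S.dim (ker m)"

definition \<kappa>' where "\<kappa>' m = W.dim {w. (Y ^^ m) w = 0}"

lemma Xm_linear: "Vector_Spaces.linear scaleS scaleS (X ^^ m)"
  by (rule S.linear_funpow[OF X_linear])

lemma subspace_ker: "S.subspace (ker m)"
proof -
  interpret Xm: Vector_Spaces.linear scaleS scaleS "X ^^ m" by (rule Xm_linear)
  show ?thesis unfolding ker_def by (rule Xm.subspace_kernel)
qed

lemma ker_mono: "k \<le> m \<Longrightarrow> ker k \<subseteq> ker m"
proof
  fix s assume km: "k \<le> m" and s: "s \<in> ker k"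
  interpret Xm: Vector_Spaces.linear scaleS scaleS "X ^^ (m - k)" by (rule Xm_linear)
  have "(X ^^ m) s = (X ^^ (m - k)) ((X ^^ k) s)" using km by (simp flip: funpow_add comp_apply[of "X ^^ (m - k)"])
  then show "s \<in> ker m" using s by (simp add: ker_def Xm.zero)
qed

lemma dim_span_\<omega>: "S.dim (S.span {\<omega>}) = 1"
  using \<omega>_nonzero by (simp add: S.dim_span S.dim_singleton)

definition pre where "pre m = {s. (X ^^ m) s \<in> S.span {\<omega>}}"

lemma subspace_pre: "S.subspace (pre m)"
proof -
  interpret Xm: Vector_Spaces.linear scaleS scaleS "X ^^ m" by (rule Xm_linear)
  show ?thesis using S.subspace_span[of "{\<omega>}"] by (auto simp: pre_def S.subspace_def Xm.add Xm.scale Xm.zero)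
qed

lemma dim_pre: "S.dim (pre m) = (if \<exists>s. (X ^^ m) s = \<omega> then 1 else 0) + \<kappa> m"
proof -
  interpret Xm: Vector_Spaces.linear scaleS scaleS "X ^^ m" by (rule Xm_linear)
  have "{s \<in> pre m. (X ^^ m) s = 0} = ker m" by (auto simp: pre_def ker_def S.span_zero)
  moreover have "S.dim ((X ^^ m) ` pre m) = (if \<exists>s. (X ^^ m) s = \<omega> then 1 else 0)"
  proof (cases "\<exists>s. (X ^^ m) s = \<omega>")
    case True
    then obtain s where s: "(X ^^ m) s = \<omega>" by blast
    have "(X ^^ m) ` pre m = S.span {\<omega>}"
    proof (intro subset_antisym subsetI)
      fix y assume "y \<in> S.span {\<omega>}"
      then obtain c where c: "y = c *q \<omega>" unfolding \<omega>_span by blast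
      then have "(X ^^ m) (c *q s) = y" by (simp add: Xm.scale s)
      then show "y \<in> (X ^^ m) ` pre m" using \<open>y \<in> S.span {\<omega>}\<close> by (intro image_eqI[of _ _ "c *q s"]) (auto simp: pre_def)
    qed (auto simp: pre_def)
    then show ?thesis using True dim_span_\<omega> by simp
  next
    case False
    have "(X ^^ m) ` pre m \<subseteq> {0}"
    proof
      fix y assume "y \<in> (X ^^ m) ` pre m"
      then obtain s c where s: "y = (X ^^ m) s" "(X ^^ m) s = c *q \<omega>" unfolding pre_def \<omega>_span by blast
      have "c = 0"
      proof (rule ccontr)
        assume "c \<noteq> 0"
        then have "(X ^^ m) (inverse c *q s) = \<omega>" by (simp add: Xm.scale s(2))
        then show False using False by blast
      qed
      then show "y \<in> {0}" using s by simp
    qed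
    then show ?thesis using False by (simp add: S.dim_eq_0)
  qed
  ultimately show ?thesis
    using rank_nullity[OF S.finite_dimensional_vector_space_axioms S.vector_space_axioms Xm_linear subspace_pre, of m m]
    by (simp add: \<kappa>_def)
qed

lemma dim_pre_Z: "S.dim (pre m) = (if pre m \<subseteq> Z then 0 else 1) + S.dim {s \<in> Z. (X ^^ m) s \<in> S.span {\<omega>}}"
proof -
  have "{s \<in> pre m. \<tau> s = 0} = {s \<in> Z. (X ^^ m) s \<in> S.span {\<omega>}}" by (auto simp: pre_def Z_def)
  moreover have "(\<forall>x\<in>pre m. \<tau> x = 0) \<longleftrightarrow> pre m \<subseteq> Z" by (auto simp: Z_def)
  ultimately show ?thesis
    using dim_functional_kernel[OF S.finite_dimensional_vector_space_axioms \<tau>(1) subspace_pre[of m]] by simp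
qed

text \<open>Apply the rank formula to \<open>X ^^ m\<close> and to \<open>\<tau>\<close> on the preimage of \<open>K\<omega>\<close>.\<close>

lemma dim_balance:
  "\<kappa>' m + S.dim (Z \<inter> S.span {\<omega>}) + (if pre m \<subseteq> Z then 0 else 1) = \<kappa> m + (if \<exists>s. (X ^^ m) s = \<omega> then 1 else 0)"
  using dim_kernel_W[of m] dim_pre[of m] dim_pre_Z[of m] by (simp add: \<kappa>'_def)

lemma \<omega>_in_ker: "m \<ge> 1 \<Longrightarrow> \<omega> \<in> ker m"
  using ker_mono[of 1 m] X_\<omega> by (auto simp: ker_def)

lemma n_zero_iff: "(of_nat n = (0::'k)) \<longleftrightarrow> CHAR('k) dvd n" by (rule of_nat_eq_0_iff_char_dvd)

text \<open>Here the symmetric square is the direct sum of \<open>Z\<close> and \<open>K\<omega>\<close>.\<close>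

lemma kernel_dims_not_dvd:
  assumes "\<not> CHAR('k) dvd n"
  shows "\<kappa>' 0 = 0" "m \<ge> 1 \<Longrightarrow> \<kappa>' m + 1 = \<kappa> m"
proof -
  have \<tau>\<omega>: "\<tau> \<omega> \<noteq> 0" using assms n_zero_iff by (simp add: \<tau>_\<omega>)
  have "Z \<inter> S.span {\<omega>} \<subseteq> {0}"
    using \<tau>\<omega> unfolding \<omega>_span by (auto simp: Z_def S.functionalD[OF \<tau>(1)])
  then have Z0: "S.dim (Z \<inter> S.span {\<omega>}) = 0" by (simp add: S.dim_eq_0)
  have "\<omega> \<in> pre m" for m using \<omega>_in_ker[of m] by (cases m) (auto simp: pre_def ker_def S.span_base S.span_zero)
  then have nZ: "\<not> pre m \<subseteq> Z" for m using \<tau>\<omega> by (auto simp: Z_def)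
  have "ker 0 \<subseteq> {0}" by (auto simp: ker_def)
  then have "\<kappa> 0 = 0" by (simp add: \<kappa>_def S.dim_eq_0)
  then show "\<kappa>' 0 = 0" using dim_balance[of 0] Z0 nZ by (auto split: if_splits)
  have "\<nexists>s. (X ^^ m) s = \<omega>" if m: "m \<ge> 1" for m
  proof
    assume "\<exists>s. (X ^^ m) s = \<omega>"
    then obtain s where s: "(X ^^ m) s = \<omega>" by blast
    obtain k where "m = Suc k" using m by (cases m) auto
    then have "\<tau> \<omega> = 0" using \<tau>_X[of "(X ^^ k) s"] s by simp
    then show False using \<tau>\<omega> by simp
  qed
  then show "m \<ge> 1 \<Longrightarrow> \<kappa>' m + 1 = \<kappa> m" using dim_balance[of m] Z0 nZ[of m] by simp
qed

lemma \<omega>_image: "m \<le> q1 \<Longrightarrow> \<exists>y. (X ^^ m) y = \<omega> \<and> (m < q1 \<longrightarrow> \<tau> y = 0) \<and> (m = q1 \<longrightarrow> \<tau> y = of_nat (n div q))"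
proof -
  assume m: "m \<le> q1"
  let ?y = "\<Psi> (R (set css))"
  have "(X ^^ m) ((X ^^ (q1 - m)) ?y) = \<omega>"
    using \<omega>_depth(1) m by (simp flip: funpow_add comp_apply[of "X ^^ m"])
  moreover have "\<tau> ((X ^^ (q1 - m)) ?y) = 0" if lt: "m < q1"
  proof -
    obtain k where "q1 - m = Suc k" using lt by (cases "q1 - m") auto
    then show ?thesis by (simp add: \<tau>_X)
  qed
  moreover have "\<tau> ((X ^^ (q1 - m)) ?y) = of_nat (n div q)" if "m = q1" using that \<omega>_depth(2) by simp
  ultimately show ?thesis by blast
qed

text \<open>Now \<open>\<omega>\<close> is in \<open>Z\<close> and is contained in the image of \<open>X ^^ m\<close> if and only if \<open>m < q\<close>. For such \<open>m\<close> the functional \<open>\<tau>\<close>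
  vanishes on the kernel of \<open>X ^^ m\<close> by orthogonality, and on the preimage of \<open>\<omega>\<close> unless \<open>m = q - 1\<close> and \<open>n / q\<close> is
  prime to \<open>p\<close>. For \<open>m \<ge> q\<close> it does not vanish on the kernel.\<close>

lemma kernel_dims_dvd:
  assumes n: "CHAR('k) dvd n" and block: "\<exists>xs\<in>set css. \<not> CHAR('k) dvd length xs div q"
  shows "m < q1 \<Longrightarrow> \<kappa>' m = \<kappa> m"
    "\<kappa>' q1 + (if CHAR('k) dvd n div q then 0 else 1) = \<kappa> q1"
    "m \<ge> q \<Longrightarrow> \<kappa>' m + 2 = \<kappa> m"
proof -
  have \<tau>\<omega>: "\<tau> \<omega> = 0" using n n_zero_iff by (simp add: \<tau>_\<omega>)
  have "S.span {\<omega>} \<subseteq> Z" using \<tau>\<omega> unfolding \<omega>_span by (auto simp: Z_def S.functionalD[OF \<tau>(1)])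
  then have Z1: "S.dim (Z \<inter> S.span {\<omega>}) = 1" using dim_span_\<omega> by (simp add: Int_absorb1)
  have pre: "pre m \<subseteq> Z \<longleftrightarrow> \<tau> y = 0" if y: "(X ^^ m) y = \<omega>" for m y
  proof
    assume "pre m \<subseteq> Z"
    moreover have "y \<in> pre m" using y by (simp add: pre_def S.span_base)
    ultimately show "\<tau> y = 0" by (auto simp: Z_def)
  next
    assume ty: "\<tau> y = 0"
    interpret Xm: Vector_Spaces.linear scaleS scaleS "X ^^ m" by (rule Xm_linear)
    show "pre m \<subseteq> Z"
    proof
      fix s assume "s \<in> pre m"
      then obtain c where c: "(X ^^ m) s = c *q \<omega>" unfolding pre_def \<omega>_span by blast
      have "(X ^^ m) (s - c *q y) = 0" by (simp add: Xm.diff Xm.scale c y)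
      then have "\<tau> (s - c *q y) = 0" using y by (rule \<omega>_image_orthogonal)
      then show "s \<in> Z" using ty by (simp add: Z_def S.functionalD[OF \<tau>(1)])
    qed
  qed
  show "\<kappa>' m = \<kappa> m" if m: "m < q1"
  proof -
    obtain y where y: "(X ^^ m) y = \<omega>" "\<tau> y = 0" using \<omega>_image[of m] m by auto
    then have "\<exists>s. (X ^^ m) s = \<omega>" "pre m \<subseteq> Z" using pre[OF y(1)] by blast+
    then show ?thesis using dim_balance[of m] Z1 by simp
  qed
  show "\<kappa>' q1 + (if CHAR('k) dvd n div q then 0 else 1) = \<kappa> q1"
  proof -
    obtain y where y: "(X ^^ q1) y = \<omega>" "\<tau> y = of_nat (n div q)" using \<omega>_image[of q1] by auto
    then have "pre q1 \<subseteq> Z \<longleftrightarrow> CHAR('k) dvd n div q" using pre[OF y(1)] by (simp add: of_nat_eq_0_iff_char_dvd)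
    moreover have "\<exists>s. (X ^^ q1) s = \<omega>" using y(1) by blast
    ultimately show ?thesis using dim_balance[of q1] Z1 by (simp split: if_splits)
  qed
  show "\<kappa>' m + 2 = \<kappa> m" if m: "m \<ge> q"
  proof -
    obtain z where z: "(X ^^ q) z = 0" "\<tau> z \<noteq> 0" using block block_tensor by blast
    have zm: "(X ^^ m) z = 0" using z(1) ker_mono[OF m] by (auto simp: ker_def)
    then have "\<nexists>s. (X ^^ m) s = \<omega>" using \<omega>_image_orthogonal z(2) by blast
    moreover have "z \<in> pre m" using zm by (simp add: pre_def S.span_zero)
    then have "\<not> pre m \<subseteq> Z" using z(2) by (auto simp: Z_def)
    ultimately show ?thesis using dim_balance[of m] Z1 by simp
  qed
qed

text \<open>Invariant tensors lie in the image of \<open>X ^^ (q - 1)\<close>, so \<open>X ^^ m\<close> maps the kernel of the next power onto the kernel of \<open>X\<close>.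
  Hence all Jordan blocks on the symmetric square have size at least \<open>q\<close>.\<close>

lemma kernel_dims_below_q: "m \<le> q \<Longrightarrow> \<kappa> m = m * \<kappa> 1"
proof (induction m)
  case 0
  have "ker 0 \<subseteq> {0}" by (auto simp: ker_def)
  then show ?case by (simp add: \<kappa>_def S.dim_eq_0)
next
  case (Suc m)
  then have m: "m \<le> q1" using q_Suc by simp
  have "{s \<in> ker (Suc m). (X ^^ m) s = 0} = ker m"
    using ker_mono[of m "Suc m"] by (auto simp: ker_def)
  moreover have "(X ^^ m) ` ker (Suc m) = ker 1"
  proof (intro subset_antisym subsetI)
    fix y assume "y \<in> ker 1"
    then have y: "X y = 0" by (simp add: ker_def)
    then obtain s' where s': "(X ^^ q1) s' = y" using kernel_in_image by blast
    let ?s = "(X ^^ (q1 - m)) s'"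
    have "(X ^^ m) ?s = y" using s' m by (simp flip: funpow_add comp_apply[of "X ^^ m"])
    then show "y \<in> (X ^^ m) ` ker (Suc m)" using y by (intro image_eqI[of _ _ ?s]) (auto simp: ker_def)
  qed (auto simp: ker_def)
  ultimately have "\<kappa> (Suc m) = \<kappa> 1 + \<kappa> m"
    using rank_nullity[OF S.finite_dimensional_vector_space_axioms S.vector_space_axioms Xm_linear subspace_ker, of "Suc m" m]
    by (simp add: \<kappa>_def)
  then show ?case using Suc by simp
qed

lemma num_blocks_S:
  assumes "unipotent u" "m \<ge> 1"
  shows "int (num_blocks scaleS u0 m) = 2 * int (\<kappa> m) - int (\<kappa> (m - 1)) - int (\<kappa> (m + 1))"
proof -
  obtain M where "(\<lambda>v. u v - v) ^^ M = (\<lambda>v. 0)" using assms(1) by (auto simp: unipotent_def)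
  then have "(X ^^ (2 * M)) = (\<lambda>s. 0)" using X_nilpotent by blast
  then have un: "unipotent u0" unfolding unipotent_def X_def[abs_def] by blast
  show ?thesis
    using num_blocks_kernel_dims[OF S.vector_space_axioms finite_dim_S u0_linear un assms(2)]
    by (simp add: \<kappa>_def ker_def X_def[abs_def])
qed

lemma num_blocks_W:
  assumes "unipotent u" "m \<ge> 1"
  shows "int (num_blocks scaleW (\<rho> u) m) = 2 * int (\<kappa>' m) - int (\<kappa>' (m - 1)) - int (\<kappa>' (m + 1))"
proof -
  obtain M where M: "(\<lambda>v. u v - v) ^^ M = (\<lambda>v. 0)" using assms(1) by (auto simp: unipotent_def)
  have "(Y ^^ (2 * M)) w = 0" for w
  proof -
    obtain s where "rel s w" using rel_surj by blast
    then have "rel 0 ((Y ^^ (2 * M)) w)" using rel_X_pow[of s w "2 * M"] X_nilpotent[OF M] by simp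
    then show ?thesis using rel_unique rel_lin(3) by blast
  qed
  then have un: "unipotent (\<rho> u)" unfolding unipotent_def Y_def[abs_def] by blast
  show ?thesis
    using num_blocks_kernel_dims[OF W.vector_space_axioms fdW \<rho>_linear[OF uG] un assms(2)]
    by (simp add: \<kappa>'_def Y_def[abs_def])
qed

end

section \<open>The Jordan blocks on the irreducible module\<close>

text \<open>The numbers \<open>A\<close>, \<open>B\<close>, \<open>C\<close> stand for the kernel dimensions at \<open>m\<close>, \<open>m - 1\<close>, \<open>m + 1\<close> on the symmetric square, from which
  those on the irreducible module arise by subtracting 0, \<open>\<epsilon>\<close> or 2.\<close>

lemma second_difference_shift:
  fixes A B C \<epsilon> :: int
  assumes "m \<ge> 1"
  shows "2 * (A - (if m < k then 0 else if m = k then \<epsilon> else 2)) - (B - (if m - 1 < k then 0 else if m - 1 = k then \<epsilon> else 2))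
      - (C - (if m + 1 < k then 0 else if m + 1 = k then \<epsilon> else 2))
    = 2 * A - B - C + (if m = Suc k then \<epsilon> - 2 else if m = k then 2 - 2 * \<epsilon> else if m + 1 = k then \<epsilon> else 0)"
proof -
  consider "m + 1 < k" | "m + 1 = k" | "m = k" | "m = Suc k" | "m > Suc k" by linarith
  then show ?thesis by cases (use assms in auto)
qed

theorem corollary6p3:
  fixes scaleV :: "'k::alg_closed_field \<Rightarrow> 'v::ab_group_add \<Rightarrow> 'v"
    and \<beta> :: "'v \<Rightarrow> 'v \<Rightarrow> 'k"
    and u :: "'v \<Rightarrow> 'v"
    and e :: "nat \<Rightarrow> 'v"
    and scaleS :: "'k \<Rightarrow> 's::ab_group_add \<Rightarrow> 's"
    and \<sigma> :: "'v \<Rightarrow> 'v \<Rightarrow> 's"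
    and u0 :: "'s \<Rightarrow> 's"
    and scaleW :: "'k \<Rightarrow> 'w::ab_group_add \<Rightarrow> 'w"
    and \<rho> :: "('v \<Rightarrow> 'v) \<Rightarrow> 'w \<Rightarrow> 'w"
    and p n \<alpha> :: nat
    and ds :: "nat list"
  assumes "CHAR('k) = p" and "p > 2"
    and "vector_space scaleV" and "vector_space.dim scaleV (UNIV :: 'v set) = n" and "n \<ge> 5"
    and "bilinear_map scaleV (*) \<beta>" and "symmetric_map \<beta>" and "nondegenerate \<beta>"
    and "u \<in> SO scaleV \<beta>" and "unipotent u"
    and "unipotent_block_sizes scaleV u ds" and "length ds \<ge> 1" and "\<forall>d\<in>set ds. d \<ge> 1"
    and "\<alpha> = multiplicity p (Gcd (set ds))"
    and "symmetric_square scaleV scaleS \<sigma>"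
    and "Vector_Spaces.linear scaleS scaleS u0" and "\<forall>v w. u0 (\<sigma> v w) = \<sigma> (u v) (u w)"
    and "witt_basis scaleV \<beta> n e"
    and "irreducible_highest_weight_module scaleV \<beta> n e scaleW \<rho> (\<lambda>i. 2 * fundamental_weight n 1 i)"
  shows
    "let r0 = (\<lambda>m. int (num_blocks scaleS u0 m));
         r'' = (\<lambda>m. int (num_blocks scaleW (\<rho> u) m))
     in
     (\<not> p dvd n \<longrightarrow>
        r'' 1 = r0 1 - 1 \<and> (\<forall>m\<ge>1. m \<noteq> 1 \<longrightarrow> r'' m = r0 m)) \<and>
     (p dvd n \<and> \<alpha> = 0 \<longrightarrow>
        r'' 1 = r0 1 - 2 \<and> (\<forall>m\<ge>1. m \<noteq> 1 \<longrightarrow> r'' m = r0 m)) \<and>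
     (p dvd n \<and> \<alpha> > 0 \<longrightarrow>
        (p dvd n div p ^ \<alpha> \<longrightarrow>
           r'' (p ^ \<alpha>) = r0 (p ^ \<alpha>) - 2 \<and> r'' (p ^ \<alpha> - 1) = 2 \<and>
           (\<forall>m\<ge>1. m \<noteq> p ^ \<alpha> \<and> m \<noteq> p ^ \<alpha> - 1 \<longrightarrow> r'' m = r0 m)) \<and>
        (\<not> p dvd n div p ^ \<alpha> \<and> p ^ \<alpha> > 2 \<longrightarrow>
           r'' (p ^ \<alpha>) = r0 (p ^ \<alpha>) - 1 \<and> r'' (p ^ \<alpha> - 2) = 1 \<and>
           (\<forall>m\<ge>1. m \<noteq> p ^ \<alpha> \<and> m \<noteq> p ^ \<alpha> - 2 \<longrightarrow> r'' m = r0 m)) \<and>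
        (\<not> p dvd n div p ^ \<alpha> \<and> p ^ \<alpha> = 2 \<longrightarrow>
           r'' 2 = r0 2 - 1 \<and> (\<forall>m\<ge>1. m \<noteq> 2 \<longrightarrow> r'' m = r0 m)))"
proof -
  have pp: "prime p" using prime_CHAR_semidom[where 'a = 'k] assms(1,2) by simp
  have two: "(2::'k) \<noteq> 0"
  proof
    assume "(2::'k) = 0"
    then have "of_nat 2 = (0::'k)" by simp
    then have "p dvd 2" using assms(1) of_nat_eq_0_iff_char_dvd by blast
    then show False using assms(2) by (auto dest: dvd_imp_le)
  qed
  interpret V: vector_space scaleV by fact
  interpret V: witt_space scaleV \<beta> n e
    by unfold_locales (use two assms(5-7,18) in auto)
  have lu: "Vector_Spaces.linear scaleV scaleV u" using assms(9) by (simp add: SO_def)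
  obtain css where css: "jordan_basis scaleV u css" "map length css = ds"
    using V.block_sizes_iff_jordan_basis[OF V.ob lu] assms(11) by blast
  define qq where "qq = p ^ \<alpha>"
  have Gcd0: "Gcd (set ds) \<noteq> 0" using assms(12,13) by (auto simp: Gcd_0_iff) (metis One_nat_def length_0_conv list.set_sel(1) not_one_le_zero subsetD singletonD length_greater_0_conv)
  have qG: "qq dvd Gcd (set ds)" unfolding qq_def assms(14) by (rule multiplicity_dvd)
  have qq_dvd: "qq dvd length xs" if "xs \<in> set css" for xs
  proof -
    have "length xs \<in> set ds" using that by (simp flip: css(2))
    then show ?thesis using qG Gcd_dvd dvd_trans by blast
  qed
  have ppC: "prime CHAR('k)" and qqC: "qq = CHAR('k) ^ \<alpha>" using pp assms(1) by (simp_all add: qq_def)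
  interpret jordan_highest_weight scaleV \<beta> n e scaleW \<rho> scaleS \<sigma> u u0 css qq \<alpha>
  proof -
    have w: "witt_square scaleV \<beta> n e scaleS \<sigma> u u0"
      using assms(9,15-17) by (intro witt_square.intro V.witt_space_axioms witt_square_axioms.intro) auto
    have h: "highest_weight_module scaleV \<beta> n e scaleW \<rho>"
      by (intro highest_weight_module.intro V.witt_space_axioms highest_weight_module_axioms.intro assms(19))
    have j: "jordan_square scaleV \<beta> n e scaleS \<sigma> u u0 css qq \<alpha>"
      by (intro jordan_square.intro w jordan_square_axioms.intro css(1) ppC qqC qq_dvd)
    show "jordan_highest_weight scaleV \<beta> n e scaleW \<rho> scaleS \<sigma> u u0 css qq \<alpha>"
      by (intro jordan_highest_weight.intro highest_weight_square.intro h w j)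
  qed
  have block: "\<exists>xs\<in>set css. \<not> CHAR('k) dvd length xs div qq"
  proof (rule ccontr)
    assume no: "\<not> ?thesis"
    have "p ^ Suc \<alpha> dvd d" if d: "d \<in> set ds" for d
    proof -
      have "d \<in> length ` set css" using d by (simp flip: css(2))
      then obtain xs where xs: "xs \<in> set css" "d = length xs" by blast
      then have "p dvd d div qq" using no assms(1) by blast
      then have "qq * p dvd qq * (d div qq)" by (rule mult_dvd_mono[OF dvd_refl])
      moreover have "qq * (d div qq) = d" using qq_dvd[OF xs(1)] xs(2) by simp
      moreover have "p ^ Suc \<alpha> = qq * p" by (simp add: qq_def)
      ultimately show ?thesis by metis
    qed
    then have "p ^ Suc \<alpha> dvd Gcd (set ds)" by (rule Gcd_greatest)
    moreover have "\<not> is_unit p" using pp by auto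
    ultimately have "Suc \<alpha> \<le> multiplicity p (Gcd (set ds))"
      using Gcd0 by (intro multiplicity_geI)
    then show False using assms(14) by simp
  qed
  have r0: "int (num_blocks scaleS u0 m) = 2 * int (\<kappa> m) - int (\<kappa> (m - 1)) - int (\<kappa> (m + 1))"
    and r1: "int (num_blocks scaleW (\<rho> u) m) = 2 * int (\<kappa>' m) - int (\<kappa>' (m - 1)) - int (\<kappa>' (m + 1))"
    if "m \<ge> 1" for m
    using num_blocks_S num_blocks_W assms(10) that by blast+
  have \<kappa>0: "\<kappa> 0 = 0" using kernel_dims_below_q[of 0] by simp
  have case1: "int (num_blocks scaleW (\<rho> u) m) = int (num_blocks scaleS u0 m) - (if m = 1 then 1 else 0)"
    if "\<not> p dvd n" "m \<ge> 1" for m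
  proof -
    have nd: "\<not> CHAR('k) dvd n" using that(1) assms(1) by simp
    have k: "int (\<kappa>' m) = int (\<kappa> m) - (if m = 0 then 0 else 1)" for m
      using kernel_dims_not_dvd(2)[OF nd, of m] kernel_dims_not_dvd(1)[OF nd] \<kappa>0 by (cases m) auto
    show ?thesis unfolding r0[OF that(2)] r1[OF that(2)] k using that(2) by auto
  qed
  define \<epsilon> :: int where "\<epsilon> = (if p dvd n div qq then 0 else 1)"
  have case2: "int (num_blocks scaleW (\<rho> u) m) = int (num_blocks scaleS u0 m)
      + (if m = qq then \<epsilon> - 2 else if m = qq - 1 then 2 - 2 * \<epsilon> else if m + 1 = qq - 1 then \<epsilon> else 0)"
    if "p dvd n" and m: "m \<ge> 1" for m
  proof -
    have nd: "CHAR('k) dvd n" using that(1) assms(1) by simp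
    have k: "int (\<kappa>' m) = int (\<kappa> m) - (if m < q1 then 0 else if m = q1 then \<epsilon> else 2)" for m
      using kernel_dims_dvd(1)[OF nd block, of m] kernel_dims_dvd(2)[OF nd block] kernel_dims_dvd(3)[OF nd block, of m]
        q_Suc assms(1) by (auto simp: \<epsilon>_def split: if_splits)
    have "qq - 1 = q1" using q_Suc by simp
    then show ?thesis unfolding r0[OF m] r1[OF m] k
      using second_difference_shift[OF m, of "int (\<kappa> m)" q1 \<epsilon> "int (\<kappa> (m - 1))" "int (\<kappa> (m + 1))"] q_Suc by simp
  qed
  have small: "int (num_blocks scaleS u0 m) = 0" if "m \<ge> 1" "m < qq" for m
    using r0[OF that(1)] kernel_dims_below_q[of m] kernel_dims_below_q[of "m - 1"] kernel_dims_below_q[of "m + 1"] that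
    by (cases m) (auto simp: algebra_simps)
  have q1: "qq = 1" if "\<alpha> = 0" using that by (simp add: qq_def)
  have two_below: "int (num_blocks scaleW (\<rho> u) (qq - 2)) = \<epsilon>" if "p dvd n" "qq > 2"
  proof -
    have "qq - 2 \<ge> 1" "qq - 2 < qq" "qq - 2 \<noteq> qq" "qq - 2 \<noteq> qq - 1" "qq - 2 + 1 = qq - 1" using that(2) by auto
    then show ?thesis using case2[OF that(1), of "qq - 2"] small[of "qq - 2"] by simp
  qed
  have q3: "qq > 2" if "\<alpha> > 0"
  proof -
    have "p ^ 1 \<le> p ^ \<alpha>" using that assms(2) by (intro power_increasing) auto
    then show ?thesis using assms(2) by (simp add: qq_def)
  qed
  show ?thesis unfolding Let_def qq_def[symmetric]
  proof (intro conjI impI)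
    assume "\<not> p dvd n"
    then show "int (num_blocks scaleW (\<rho> u) 1) = int (num_blocks scaleS u0 1) - 1"
      "\<forall>m\<ge>1. m \<noteq> 1 \<longrightarrow> int (num_blocks scaleW (\<rho> u) m) = int (num_blocks scaleS u0 m)"
      using case1 by auto
  next
    assume *: "p dvd n \<and> \<alpha> = 0"
    then have "\<epsilon> = 0" using q1 by (simp add: \<epsilon>_def)
    then show "int (num_blocks scaleW (\<rho> u) 1) = int (num_blocks scaleS u0 1) - 2"
      "\<forall>m\<ge>1. m \<noteq> 1 \<longrightarrow> int (num_blocks scaleW (\<rho> u) m) = int (num_blocks scaleS u0 m)"
      using case2 q1 * by auto
  next
    assume *: "p dvd n \<and> \<alpha> > 0" "p dvd n div qq"
    then have "\<epsilon> = 0" by (simp add: \<epsilon>_def)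
    then show "int (num_blocks scaleW (\<rho> u) qq) = int (num_blocks scaleS u0 qq) - 2"
      "int (num_blocks scaleW (\<rho> u) (qq - 1)) = 2"
      "\<forall>m\<ge>1. m \<noteq> qq \<and> m \<noteq> qq - 1 \<longrightarrow> int (num_blocks scaleW (\<rho> u) m) = int (num_blocks scaleS u0 m)"
      using case2 q3 * small[of "qq - 1"] by auto
  next
    assume *: "p dvd n \<and> \<alpha> > 0" "\<not> p dvd n div qq \<and> qq > 2"
    then have "\<epsilon> = 1" by (simp add: \<epsilon>_def)
    then show "int (num_blocks scaleW (\<rho> u) qq) = int (num_blocks scaleS u0 qq) - 1"
      "int (num_blocks scaleW (\<rho> u) (qq - 2)) = 1"
      "\<forall>m\<ge>1. m \<noteq> qq \<and> m \<noteq> qq - 2 \<longrightarrow> int (num_blocks scaleW (\<rho> u) m) = int (num_blocks scaleS u0 m)"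
      using case2 q3 * two_below by auto
  next
    assume "p dvd n \<and> \<alpha> > 0" "\<not> p dvd n div qq \<and> qq = 2"
    then have False using q3 by auto
    then show "int (num_blocks scaleW (\<rho> u) 2) = int (num_blocks scaleS u0 2) - 1"
      "\<forall>m\<ge>1. m \<noteq> 2 \<longrightarrow> int (num_blocks scaleW (\<rho> u) m) = int (num_blocks scaleS u0 m)" by blast+
  qed
qed

end
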